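(* Let $\Gamma$ be a finite Gorenstein scheme of degree $r+s+2$ over a field $k$. Let $\Gamma_1\subset\Gamma$ be a subscheme and let $\Gamma_2\subset \Gamma$ be the residual scheme to $\Gamma_1$. Let $(V,L)$ be a linear series of projective dimension $r$ on $\Gamma$ (so $L$ is a line bundle on $\Gamma$ and $V\subset \mathrm{H}^0(L)$ is a subspace with $\dim_k V=r+1$), and let $W=V^\perp\subset \mathrm{H}^0(K_\Gamma\otimes L^{-1})$ be its Gale transform. Then the failure of $\Gamma_1$ to span $\mathbf{P}(V)$ is equal to the failure of $\Gamma_2$ to impose independent conditions on $W$.
   Context: A finite Gorenstein scheme over a field $k$ is a finite $k$-scheme $\Gamma$ all of whose local rings are Gorenstein; $K_\Gamma$ denotes its dualizing sheaf (a line bundle on $\Gamma$). Serre duality provides a trace map $\tau:\mathrm{H}^0(K_\Gamma)\to k$. For a line bundle $L$ on $\Gamma$, multiplication followed by $\tau$ gives a perfect pairing $\mathrm{H}^0(L)\otimes_k \mathrm{H}^0(K_\Gamma\otimes L^{-1})\to k$. For a subspace $V\subset \mathrm{H}^0(L)$, $V^\perp\subset \mathrm{H}^0(K_\Gamma\otimes L^{-1})$ denotes its annihilator, and the Gale transform of the linear series $(V,L)$ is the linear series $(V^\perp, K_\Gamma\otimes L^{-1})$. $\mathbf{P}(V)$ is the projective space whose space of linear forms is $V$. The residual scheme $\Gamma_2$ to $\Gamma_1$ in $\Gamma$ is the subscheme with ideal sheaf $\mathcal{I}_{\Gamma_2}=\mathrm{Ann}(\mathcal{I}_{\Gamma_1})$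 in $\mathcal{O}_\Gamma$. The failure of $\Gamma_1$ to span $\mathbf{P}(V)$ is the codimension of the linear span of the image of $\Gamma_1$ in $\mathbf{P}(V)$, i.e. the dimension of the kernel of the restriction map $V\to \mathrm{H}^0(L|_{\Gamma_1})$. The failure of $\Gamma_2$ to impose independent conditions on $W$ is the dimension of the cokernel of the restriction map $W\to \mathrm{H}^0((K_\Gamma\otimes L^{-1})|_{\Gamma_2})$. *)

theory Defs
  imports
    "HOL-Algebra.Free_Abelian_Groups"
    "HOL-Algebra.Ring_Divisibility"
    "Jordan_Normal_Form.Missing_VectorSpace"
begin

text \<open>
  A finite scheme over a field \<open>k\<close> is \<open>Spec A\<close> for a commutative \<open>k\<close>-algebra \<open>A\<close> of finite dimension.
  Quasi-coherent sheaves on it are \<open>A\<close>-modules (the module being the space of global sections), and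
  subschemes, all of which are closed, are ideals of \<open>A\<close>.
  The library's record of modules extends the record of rings, so every module carries fields \<open>mult\<close>
  and \<open>one\<close>. They have no meaning for a module and are left undefined below.
\<close>

section \<open>Modules\<close>

definition self_module :: "('a, 'r) ring_scheme \<Rightarrow> ('a, 'a) module" where
  "self_module R = \<lparr>carrier = carrier R, monoid.mult = monoid.mult R, monoid.one = monoid.one R,
     ring.zero = ring.zero R, ring.add = ring.add R, smult = monoid.mult R\<rparr>"

definition isomorphic_modules ::
  "('a, 'r) ring_scheme \<Rightarrow> ('a, 'm, 'e) module_scheme \<Rightarrow> ('a, 'n, 'f) module_scheme \<Rightarrow> bool" where
  "isomorphic_modules R M N \<longleftrightarrow> (\<exists>f\<in>module_hom R M N. bij_betw f (carrier M) (carrier N))"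

definition restrict_scalars ::
  "('k, 'a, 'e) module_scheme \<Rightarrow> ('a, 'm, 'f) module_scheme \<Rightarrow> ('k, 'm) module" where
  "restrict_scalars A M = \<lparr>carrier = carrier M, monoid.mult = monoid.mult M, monoid.one = monoid.one M,
     ring.zero = ring.zero M, ring.add = ring.add M, smult = (\<lambda>c x. (c \<odot>\<^bsub>A\<^esub> \<one>\<^bsub>A\<^esub>) \<odot>\<^bsub>M\<^esub> x)\<rparr>"

definition quotient_module ::
  "('a, 'm, 'e) module_scheme \<Rightarrow> 'm set \<Rightarrow> ('a, 'm set) module" where
  "quotient_module M N = \<lparr>carrier = a_rcosets\<^bsub>M\<^esub> N, monoid.mult = undefined, monoid.one = undefined,
     ring.zero = N, ring.add = set_add M, smult = (\<lambda>a X. \<Union>x\<in>X. N +>\<^bsub>M\<^esub> (a \<odot>\<^bsub>M\<^esub> x))\<rparr>"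

definition ideal_times ::
  "('a, 'r) ring_scheme \<Rightarrow> 'a set \<Rightarrow> ('a, 'm, 'e) module_scheme \<Rightarrow> 'm set" where
  "ideal_times R I M = module.span R M {a \<odot>\<^bsub>M\<^esub> x | a x. a \<in> I \<and> x \<in> carrier M}"

text \<open>Homomorphisms are made extensional, so that equal homomorphisms are equal functions.\<close>

definition hom_module ::
  "('a, 'r) ring_scheme \<Rightarrow> ('a, 'm, 'e) module_scheme \<Rightarrow> ('a, 'n, 'f) module_scheme
    \<Rightarrow> ('a, 'm \<Rightarrow> 'n) module" where
  "hom_module R M N = \<lparr>carrier = module_hom R M N \<inter> extensional (carrier M),
     monoid.mult = undefined, monoid.one = undefined,
     ring.zero = (\<lambda>x\<in>carrier M. \<zero>\<^bsub>N\<^esub>),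
     ring.add = (\<lambda>f g. \<lambda>x\<in>carrier M. f x \<oplus>\<^bsub>N\<^esub> g x),
     smult = (\<lambda>a f. \<lambda>x\<in>carrier M. a \<odot>\<^bsub>N\<^esub> f x)\<rparr>"


subsection \<open>Tensor products\<close>

definition tensor_relations ::
  "('a, 'r) ring_scheme \<Rightarrow> ('a, 'm, 'e) module_scheme \<Rightarrow> ('a, 'n, 'f) module_scheme
    \<Rightarrow> (('m \<times> 'n) \<Rightarrow>\<^sub>0 int) set" where
  "tensor_relations R M N =
     {frag_of (m \<oplus>\<^bsub>M\<^esub> m', n) - frag_of (m, n) - frag_of (m', n) | m m' n.
        m \<in> carrier M \<and> m' \<in> carrier M \<and> n \<in> carrier N} \<union>
     {frag_of (m, n \<oplus>\<^bsub>N\<^esub> n') - frag_of (m, n) - frag_of (m, n') | m n n'.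
        m \<in> carrier M \<and> n \<in> carrier N \<and> n' \<in> carrier N} \<union>
     {frag_of (a \<odot>\<^bsub>M\<^esub> m, n) - frag_of (m, a \<odot>\<^bsub>N\<^esub> n) | a m n.
        a \<in> carrier R \<and> m \<in> carrier M \<and> n \<in> carrier N}"

definition tensor_kernel ::
  "('a, 'r) ring_scheme \<Rightarrow> ('a, 'm, 'e) module_scheme \<Rightarrow> ('a, 'n, 'f) module_scheme
    \<Rightarrow> (('m \<times> 'n) \<Rightarrow>\<^sub>0 int) set" where
  "tensor_kernel R M N =
     generate (free_Abelian_group (carrier M \<times> carrier N)) (tensor_relations R M N)"

definition pure_tensor ::
  "('a, 'r) ring_scheme \<Rightarrow> ('a, 'm, 'e) module_scheme \<Rightarrow> ('a, 'n, 'f) module_scheme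
    \<Rightarrow> 'm \<Rightarrow> 'n \<Rightarrow> (('m \<times> 'n) \<Rightarrow>\<^sub>0 int) set" where
  "pure_tensor R M N m n =
     tensor_kernel R M N #>\<^bsub>free_Abelian_group (carrier M \<times> carrier N)\<^esub> frag_of (m, n)"

definition tensor_module ::
  "('a, 'r) ring_scheme \<Rightarrow> ('a, 'm, 'e) module_scheme \<Rightarrow> ('a, 'n, 'f) module_scheme
    \<Rightarrow> ('a, (('m \<times> 'n) \<Rightarrow>\<^sub>0 int) set) module" where
  "tensor_module R M N =
     (let F = free_Abelian_group (carrier M \<times> carrier N); H = tensor_kernel R M N
      in \<lparr>carrier = carrier (F Mod H), monoid.mult = undefined, monoid.one = undefined,
          ring.zero = monoid.one (F Mod H), ring.add = monoid.mult (F Mod H),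
          smult = (\<lambda>a X. \<Union>c\<in>X. H #>\<^bsub>F\<^esub> frag_extend (\<lambda>(m, n). frag_of (a \<odot>\<^bsub>M\<^esub> m, n)) c)\<rparr>)"

text \<open>The homomorphism \<open>M \<otimes> N \<rightarrow> P\<close> induced by a bilinear map \<open>b\<close>.\<close>

definition tensor_lift ::
  "('a, 'r) ring_scheme \<Rightarrow> ('a, 'm, 'e) module_scheme \<Rightarrow> ('a, 'n, 'f) module_scheme
    \<Rightarrow> ('a, 'p, 'g) module_scheme \<Rightarrow> ('m \<Rightarrow> 'n \<Rightarrow> 'p) \<Rightarrow> (('m \<times> 'n) \<Rightarrow>\<^sub>0 int) set \<Rightarrow> 'p" where
  "tensor_lift R M N P b =
     (THE h. h \<in> module_hom R (tensor_module R M N) P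
           \<and> h \<in> extensional (carrier (tensor_module R M N))
           \<and> (\<forall>m\<in>carrier M. \<forall>n\<in>carrier N. h (pure_tensor R M N m n) = b m n))"


subsection \<open>Localization\<close>

text \<open>\<open>fraction R S M m s\<close> is the equivalence class of pairs denoted \<open>m / s\<close> in \<open>S\<^sup>-\<^sup>1M\<close>.\<close>

definition fraction ::
  "('a, 'r) ring_scheme \<Rightarrow> 'a set \<Rightarrow> ('a, 'm, 'e) module_scheme \<Rightarrow> 'm \<Rightarrow> 'a \<Rightarrow> ('m \<times> 'a) set" where
  "fraction R S M m s = {(m', s'). m' \<in> carrier M \<and> s' \<in> S \<and>
     (\<exists>u\<in>S. u \<odot>\<^bsub>M\<^esub> (s \<odot>\<^bsub>M\<^esub> m') = u \<odot>\<^bsub>M\<^esub> (s' \<odot>\<^bsub>M\<^esub> m))}"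

text \<open>The unions below range over all representatives and are unions of equal classes.\<close>

definition localized_module ::
  "('a, 'r) ring_scheme \<Rightarrow> 'a set \<Rightarrow> ('a, 'm, 'e) module_scheme
    \<Rightarrow> (('a \<times> 'a) set, ('m \<times> 'a) set) module" where
  "localized_module R S M =
     \<lparr>carrier = {fraction R S M m s | m s. m \<in> carrier M \<and> s \<in> S},
      monoid.mult = undefined, monoid.one = undefined,
      ring.zero = fraction R S M \<zero>\<^bsub>M\<^esub> \<one>\<^bsub>R\<^esub>,
      ring.add = (\<lambda>X Y. \<Union>(m, s)\<in>X. \<Union>(n, t)\<in>Y.
               fraction R S M ((t \<odot>\<^bsub>M\<^esub> m) \<oplus>\<^bsub>M\<^esub> (s \<odot>\<^bsub>M\<^esub> n)) (s \<otimes>\<^bsub>R\<^esub> t)),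
      smult = (\<lambda>X Y. \<Union>(a, s)\<in>X. \<Union>(m, t)\<in>Y. fraction R S M (a \<odot>\<^bsub>M\<^esub> m) (s \<otimes>\<^bsub>R\<^esub> t))\<rparr>"

definition localized_ring :: "('a, 'r) ring_scheme \<Rightarrow> 'a set \<Rightarrow> ('a \<times> 'a) set ring" where
  "localized_ring R S =
     \<lparr>carrier = carrier (localized_module R S (self_module R)),
      monoid.mult = smult (localized_module R S (self_module R)),
      monoid.one = fraction R S (self_module R) \<one>\<^bsub>R\<^esub> \<one>\<^bsub>R\<^esub>,
      ring.zero = ring.zero (localized_module R S (self_module R)),
      ring.add = ring.add (localized_module R S (self_module R))\<rparr>"


section \<open>Gorenstein rings\<close>

definition injective_module :: "('a, 'r) ring_scheme \<Rightarrow> ('a, 'u) module \<Rightarrow> bool" where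
  "injective_module R E \<longleftrightarrow> module R E \<and>
     (\<forall>(N :: ('a, 'u) module) N' f.
        module R N \<and> submodule R N' N \<and> f \<in> module_hom R (N\<lparr>carrier := N'\<rparr>) E
        \<longrightarrow> (\<exists>g\<in>module_hom R N E. \<forall>x\<in>N'. g x = f x))"

text \<open>
  \<open>M\<close> has a finite resolution \<open>0 \<rightarrow> M \<rightarrow> E\<^sub>0 \<rightarrow> \<dots> \<rightarrow> E\<^sub>n \<rightarrow> 0\<close> by injective modules; the resolution is built
  one short exact sequence \<open>0 \<rightarrow> M \<rightarrow> E \<rightarrow> C \<rightarrow> 0\<close> at a time.
\<close>

inductive finite_injective_dimension :: "('a, 'r) ring_scheme \<Rightarrow> ('a, 'u) module \<Rightarrow> bool"
  for R :: "('a, 'r) ring_scheme" where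
  injective: "injective_module R M \<Longrightarrow> finite_injective_dimension R M"
| cosyzygy:
    "\<lbrakk>module R M; injective_module R (E :: ('a, 'u) module); module R C;
      i \<in> module_hom R M E; inj_on i (carrier M);
      p \<in> module_hom R E C; p ` carrier E = carrier C;
      i ` carrier M = {x \<in> carrier E. p x = \<zero>\<^bsub>C\<^esub>};
      finite_injective_dimension R C\<rbrakk>
     \<Longrightarrow> finite_injective_dimension R M"

definition local_ring :: "('a, 'r) ring_scheme \<Rightarrow> bool" where
  "local_ring R \<longleftrightarrow> cring R \<and> (\<exists>!\<mm>. maximalideal \<mm> R)"

text \<open>
  A Noetherian local ring is Gorenstein if it has finite injective dimension as a module over itself.
  HOL has no quantification over types inside a formula, so the modules in the resolution, and the
  modules against which injectivity is tested, have carriers in the fixed type \<open>nat \<times> 'a\<close>. This is no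
  restriction. The type has room for a copy of \<open>R\<close>, so by Baer's criterion \<open>injective_module\<close> is
  injectivity in the usual sense. If \<open>R\<close> is infinite, the modules in a minimal injective resolution of
  \<open>R\<close> have at most the cardinality of \<open>nat \<times> 'a\<close>. If \<open>R\<close> is finite, it is Artinian, and then finite
  injective dimension means that \<open>R\<close> itself is injective.
\<close>

definition gorenstein_local_ring :: "('a, 'r) ring_scheme \<Rightarrow> bool" where
  "gorenstein_local_ring R \<longleftrightarrow> noetherian_ring R \<and> local_ring R \<and>
     (\<exists>M :: ('a, nat \<times> 'a) module.
        module R M \<and> isomorphic_modules R M (self_module R) \<and> finite_injective_dimension R M)"


section \<open>Finite schemes over a field\<close>

definition finite_scheme :: "('k, 'z) ring_scheme \<Rightarrow> ('k, 'a) module \<Rightarrow> bool" where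
  "finite_scheme k A \<longleftrightarrow> field k \<and> algebra k A \<and> vectorspace.fin_dim k A"

definition finite_gorenstein_scheme :: "('k, 'z) ring_scheme \<Rightarrow> ('k, 'a) module \<Rightarrow> bool" where
  "finite_gorenstein_scheme k A \<longleftrightarrow> finite_scheme k A \<and>
     (\<forall>P. primeideal P A \<longrightarrow> gorenstein_local_ring (localized_ring A (carrier A - P)))"

definition degree_of :: "('k, 'z) ring_scheme \<Rightarrow> ('k, 'a) module \<Rightarrow> nat" where
  "degree_of k A = vectorspace.dim k A"

definition residual_ideal :: "('a, 'r) ring_scheme \<Rightarrow> 'a set \<Rightarrow> 'a set" where
  "residual_ideal A I = {a \<in> carrier A. \<forall>b\<in>I. a \<otimes>\<^bsub>A\<^esub> b = \<zero>\<^bsub>A\<^esub>}"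

text \<open>Locally free of rank one: trivial on a basic open neighbourhood \<open>D(f)\<close> of every point.\<close>

definition line_bundle :: "('a, 'r) ring_scheme \<Rightarrow> ('a, 'l) module \<Rightarrow> bool" where
  "line_bundle A L \<longleftrightarrow> module A L \<and>
     (\<forall>P. primeideal P A \<longrightarrow>
        (\<exists>f\<in>carrier A - P. let S = {f [^]\<^bsub>A\<^esub> n | n :: nat. True} in
           isomorphic_modules (localized_ring A S)
             (localized_module A S L) (localized_module A S (self_module A))))"

definition inverse_bundle :: "('a, 'r) ring_scheme \<Rightarrow> ('a, 'l) module \<Rightarrow> ('a, 'l \<Rightarrow> 'a) module" where
  "inverse_bundle A L = hom_module A L (self_module A)"

text \<open>
  For the structure map \<open>f : Spec A \<rightarrow> Spec k\<close>, the dualizing sheaf is \<open>f\<^sup>! k = Hom\<^sub>k(A, k)\<close> with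
  \<open>A\<close> acting on the argument, and the trace map of Serre duality is evaluation at \<open>1\<close>.
\<close>

definition dualizing_module ::
  "('k, 'z) ring_scheme \<Rightarrow> ('k, 'a) module \<Rightarrow> ('a, 'a \<Rightarrow> 'k) module" where
  "dualizing_module k A =
     \<lparr>carrier = carrier (hom_module k A (self_module k)), monoid.mult = undefined, monoid.one = undefined,
      ring.zero = ring.zero (hom_module k A (self_module k)), ring.add = ring.add (hom_module k A (self_module k)),
      smult = (\<lambda>a \<kappa>. \<lambda>b\<in>carrier A. \<kappa> (a \<otimes>\<^bsub>A\<^esub> b))\<rparr>"

definition trace_map :: "('k, 'a) module \<Rightarrow> ('a \<Rightarrow> 'k) \<Rightarrow> 'k" where
  "trace_map A \<kappa> = \<kappa> \<one>\<^bsub>A\<^esub>"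


section \<open>Linear series and the Gale transform\<close>

text \<open>The line bundle \<open>K \<otimes> L\<^sup>-\<^sup>1\<close>.\<close>

definition gale_bundle ::
  "('k, 'z) ring_scheme \<Rightarrow> ('k, 'a) module \<Rightarrow> ('a, 'l) module
    \<Rightarrow> ('a, ((('a \<Rightarrow> 'k) \<times> ('l \<Rightarrow> 'a)) \<Rightarrow>\<^sub>0 int) set) module" where
  "gale_bundle k A L = tensor_module A (dualizing_module k A) (inverse_bundle A L)"

text \<open>Multiplication \<open>L \<times> (K \<otimes> L\<^sup>-\<^sup>1) \<rightarrow> K\<close>, which sends \<open>(l, \<kappa> \<otimes> \<phi>)\<close> to \<open>\<phi>(l) \<kappa>\<close>.\<close>

definition multiply_sections ::
  "('k, 'z) ring_scheme \<Rightarrow> ('k, 'a) module \<Rightarrow> ('a, 'l) module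
    \<Rightarrow> 'l \<Rightarrow> ((('a \<Rightarrow> 'k) \<times> ('l \<Rightarrow> 'a)) \<Rightarrow>\<^sub>0 int) set \<Rightarrow> ('a \<Rightarrow> 'k)" where
  "multiply_sections k A L l =
     tensor_lift A (dualizing_module k A) (inverse_bundle A L) (dualizing_module k A)
       (\<lambda>\<kappa> \<phi>. \<phi> l \<odot>\<^bsub>dualizing_module k A\<^esub> \<kappa>)"

definition linear_series ::
  "('k, 'z) ring_scheme \<Rightarrow> ('k, 'a) module \<Rightarrow> 'l set \<Rightarrow> ('a, 'l) module \<Rightarrow> bool" where
  "linear_series k A V L \<longleftrightarrow> line_bundle A L \<and> subspace k V (restrict_scalars A L)"

definition projective_dimension ::
  "('k, 'z) ring_scheme \<Rightarrow> ('k, 'a) module \<Rightarrow> 'l set \<Rightarrow> ('a, 'l) module \<Rightarrow> int" where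
  "projective_dimension k A V L =
     int (vectorspace.dim k ((restrict_scalars A L)\<lparr>carrier := V\<rparr>)) - 1"

definition gale_transform ::
  "('k, 'z) ring_scheme \<Rightarrow> ('k, 'a) module \<Rightarrow> 'l set \<Rightarrow> ('a, 'l) module
    \<Rightarrow> ((('a \<Rightarrow> 'k) \<times> ('l \<Rightarrow> 'a)) \<Rightarrow>\<^sub>0 int) set set" where
  "gale_transform k A V L =
     {t \<in> carrier (gale_bundle k A L). \<forall>v\<in>V. trace_map A (multiply_sections k A L v t) = \<zero>\<^bsub>k\<^esub>}"

text \<open>The restriction of \<open>M\<close> to the subscheme with ideal \<open>I\<close> is \<open>M / IM\<close>.\<close>

definition restricted_sheaf ::
  "('a, 'r) ring_scheme \<Rightarrow> 'a set \<Rightarrow> ('a, 'm, 'e) module_scheme \<Rightarrow> ('a, 'm set) module" where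
  "restricted_sheaf A I M = quotient_module M (ideal_times A I M)"

definition restriction_map ::
  "('a, 'r) ring_scheme \<Rightarrow> 'a set \<Rightarrow> ('a, 'm, 'e) module_scheme \<Rightarrow> 'm \<Rightarrow> 'm set" where
  "restriction_map A I M x = ideal_times A I M +>\<^bsub>M\<^esub> x"

definition failure_to_span ::
  "('k, 'z) ring_scheme \<Rightarrow> ('k, 'a) module \<Rightarrow> 'a set \<Rightarrow> 'm set \<Rightarrow> ('a, 'm) module \<Rightarrow> nat" where
  "failure_to_span k A I V M =
     vectorspace.dim k ((restrict_scalars A M)
       \<lparr>carrier := {v \<in> V. restriction_map A I M v = \<zero>\<^bsub>restricted_sheaf A I M\<^esub>}\<rparr>)"

definition failure_of_independent_conditions ::
  "('k, 'z) ring_scheme \<Rightarrow> ('k, 'a) module \<Rightarrow> 'a set \<Rightarrow> 'm set \<Rightarrow> ('a, 'm) module \<Rightarrow> nat" where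
  "failure_of_independent_conditions k A I W M =
     vectorspace.dim k
       (quotient_module (restrict_scalars A (restricted_sheaf A I M)) (restriction_map A I M ` W))"

end

theory Submission
  imports Defs
begin

text \<open>
  Let \<open>I\<close> be the ideal of \<open>\<Gamma>\<^sub>1\<close> and \<open>J = Ann I\<close> that of \<open>\<Gamma>\<^sub>2\<close>, and write \<open>K\<close> for the dualizing module
  and \<open>G\<close> for \<open>K \<otimes> L\<^sup>-\<^sup>1\<close>. The failure of \<open>\<Gamma>\<^sub>1\<close> to span is \<open>dim (V \<inter> IL)\<close>, and the failure of \<open>\<Gamma>\<^sub>2\<close> to
  impose independent conditions is \<open>dim G / (JG + W)\<close>. The pairing \<open>L \<times> G \<rightarrow> k\<close> given by multiplication
  and trace is perfect. If the annihilator of \<open>IL\<close> in \<open>G\<close> is \<open>JG\<close>, then the annihilator of \<open>V \<inter> IL\<close> is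
  \<open>JG + W\<close>, so that \<open>V \<inter> IL\<close> and \<open>G / (JG + W)\<close> are dual to each other and have equal dimensions
  (\<open>pairing_dim_eq\<close>).

  A finite-dimensional algebra is semilocal, so the line bundle \<open>L\<close> is globally free, on a generator \<open>x\<close>
  (\<open>line_bundle_free_generator\<close>). Then \<open>L\<^sup>-\<^sup>1\<close> is free on the coordinate function \<open>\<psi>\<close>, and
  \<open>\<kappa> \<mapsto> \<kappa> \<otimes> \<psi>\<close> identifies \<open>K = Hom\<^sub>k(A, k)\<close> with \<open>G\<close> (\<open>tensor_free_right\<close>). Under this identification the
  pairing of \<open>ax\<close> with \<open>\<kappa>\<close> is just \<open>\<kappa>(a)\<close> (\<open>trace_multiply_sections\<close>), and its properties are statements on
  linear forms on \<open>A\<close>.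

  In these terms the annihilator of \<open>IL\<close> consists of the forms that vanish on \<open>I\<close>. The forms in \<open>JK\<close> do,
  because \<open>JI = 0\<close>. Conversely, a form that vanishes on \<open>Ann J\<close> lies in \<open>JK\<close>
  (\<open>form_vanishing_on_annihilator\<close>), so what remains is \<open>Ann (Ann I) = I\<close>, and this is where the Gorenstein
  condition enters (\<open>gorenstein_double_annihilator\<close>, \<open>residual_ideal_times_dualizing_module\<close>). The question is local. An Artinian local ring \<open>R\<close> of
  finite injective dimension is injective over itself: in \<open>0 \<rightarrow> M \<rightarrow> E \<rightarrow> C \<rightarrow> 0\<close> with \<open>E\<close> and \<open>C\<close>
  injective, \<open>M\<close> is injective as soon as each element of \<open>C\<close> that is killed by an ideal \<open>I\<close> lifts to an
  element of \<open>E\<close> killed by \<open>I\<close>, and this follows from the case of the maximal ideal, where it is enough that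
  \<open>R\<close> contains a copy of its residue field (\<open>lift_annihilated_element\<close>). Finally, in a self-injective local
  ring, an element outside of \<open>I\<close> can be mapped to a nonzero element of the socle by a homomorphism
  \<open>R/I \<rightarrow> R\<close>, which is multiplication by an element of \<open>Ann I\<close>.
\<close>


section \<open>Rings of finite length\<close>

context cring
begin

lemma ideal_criterion:
  assumes "I \<subseteq> carrier R" "\<zero> \<in> I"
    and add: "\<And>x y. \<lbrakk>x \<in> I; y \<in> I\<rbrakk> \<Longrightarrow> x \<oplus> y \<in> I"
    and mult: "\<And>r x. \<lbrakk>r \<in> carrier R; x \<in> I\<rbrakk> \<Longrightarrow> r \<otimes> x \<in> I"
  shows "ideal I R"
proof (rule idealI)
  show "ring R" by (rule ring_axioms)
  show "subgroup I (add_monoid R)"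
  proof (rule add.subgroupI)
    fix x assume x: "x \<in> I"
    then have "(\<ominus> \<one>) \<otimes> x \<in> I" by (intro mult) auto
    with x assms(1) show "\<ominus> x \<in> I" by (metis l_minus l_one one_closed subsetD)
  qed (use assms in auto)
  show "\<And>a x. \<lbrakk>a \<in> I; x \<in> carrier R\<rbrakk> \<Longrightarrow> x \<otimes> a \<in> I" by (rule mult)
  show "\<And>a x. \<lbrakk>a \<in> I; x \<in> carrier R\<rbrakk> \<Longrightarrow> a \<otimes> x \<in> I" using assms(1) mult by (metis m_comm subsetD)
qed

end

definition ideal_colon :: "('a, 'r) ring_scheme \<Rightarrow> 'a set \<Rightarrow> 'a \<Rightarrow> 'a set" where
  "ideal_colon R I a = {x \<in> carrier R. x \<otimes>\<^bsub>R\<^esub> a \<in> I}"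

definition ideal_adjoin :: "('a, 'r) ring_scheme \<Rightarrow> 'a set \<Rightarrow> 'a \<Rightarrow> 'a set" where
  "ideal_adjoin R I a = {i \<oplus>\<^bsub>R\<^esub> x \<otimes>\<^bsub>R\<^esub> a | i x. i \<in> I \<and> x \<in> carrier R}"

text \<open>
  A substitute for the length of ideals, which serves to choose minimal and maximal ideals and as an
  induction measure. For a finite-dimensional algebra it will be the dimension over the base field.
\<close>

definition length_function :: "('a, 'r) ring_scheme \<Rightarrow> ('a set \<Rightarrow> nat) \<Rightarrow> bool" where
  "length_function R d \<longleftrightarrow> (\<forall>I J. ideal I R \<longrightarrow> ideal J R \<longrightarrow> I \<subset> J \<longrightarrow> d I < d J)"

context cring
begin

lemma ideal_colon_ideal:
  assumes I: "ideal I R" and a: "a \<in> carrier R"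
  shows "ideal (ideal_colon R I a) R"
proof -
  interpret I: ideal I R by fact
  show ?thesis
    by (rule ideal_criterion)
      (use a in \<open>auto simp: ideal_colon_def l_distr m_assoc I.I_l_closed\<close>)
qed

lemma ideal_adjoin_ideal:
  assumes I: "ideal I R" and a: "a \<in> carrier R"
  shows "ideal (ideal_adjoin R I a) R"
proof -
  interpret I: ideal I R by fact
  note [simp] = I.Icarr
  show ?thesis
  proof (rule ideal_criterion)
    show "ideal_adjoin R I a \<subseteq> carrier R" using a by (auto simp: ideal_adjoin_def)
    have "\<zero> = \<zero> \<oplus> \<zero> \<otimes> a" using a by simp
    then show "\<zero> \<in> ideal_adjoin R I a" unfolding ideal_adjoin_def using I.zero_closed by blast
  next
    fix x y assume "x \<in> ideal_adjoin R I a" "y \<in> ideal_adjoin R I a"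
    then obtain i r j s where 1: "x = i \<oplus> r \<otimes> a" "y = j \<oplus> s \<otimes> a" "i \<in> I" "j \<in> I" "r \<in> carrier R" "s \<in> carrier R"
      by (auto simp: ideal_adjoin_def)
    then have "x \<oplus> y = (i \<oplus> j) \<oplus> (r \<oplus> s) \<otimes> a" using a by (simp add: l_distr a_ac)
    with 1 show "x \<oplus> y \<in> ideal_adjoin R I a" unfolding ideal_adjoin_def by blast
  next
    fix t x assume t: "t \<in> carrier R" and "x \<in> ideal_adjoin R I a"
    then obtain i r where 1: "x = i \<oplus> r \<otimes> a" "i \<in> I" "r \<in> carrier R"
      by (auto simp: ideal_adjoin_def)
    then have "t \<otimes> x = t \<otimes> i \<oplus> (t \<otimes> r) \<otimes> a" using a t by (simp add: r_distr m_assoc)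
    with 1 t show "t \<otimes> x \<in> ideal_adjoin R I a" unfolding ideal_adjoin_def using I.I_l_closed by blast
  qed
qed

lemma ideal_adjoin_upper:
  assumes I: "ideal I R" and a: "a \<in> carrier R"
  shows "I \<subseteq> ideal_adjoin R I a" "a \<in> ideal_adjoin R I a"
proof -
  interpret I: ideal I R by fact
  show "I \<subseteq> ideal_adjoin R I a"
  proof
    fix i assume "i \<in> I"
    moreover from this have "i = i \<oplus> \<zero> \<otimes> a" using a I.Icarr by simp
    ultimately show "i \<in> ideal_adjoin R I a" unfolding ideal_adjoin_def by blast
  qed
  have "a = \<zero> \<oplus> \<one> \<otimes> a" using a by simp
  then show "a \<in> ideal_adjoin R I a" unfolding ideal_adjoin_def using I.zero_closed by blast
qed

lemma ideal_adjoin_least: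
  assumes "ideal J R" "I \<subseteq> J" "a \<in> J"
  shows "ideal_adjoin R I a \<subseteq> J"
proof -
  interpret J: ideal J R by fact
  show ?thesis using assms J.I_l_closed by (auto simp: ideal_adjoin_def)
qed

text \<open>
  Take the multiple \<open>r a\<close> for which the ideal \<open>I + (r a)\<close> is as small as possible: the module
  \<open>(I + (r a)) / I\<close> is then simple, and \<open>(I : r a)\<close> is its annihilator.
\<close>

lemma exists_multiple_with_maximal_colon:
  assumes d: "length_function R d" and I: "ideal I R" and a: "a \<in> carrier R" "a \<notin> I"
  obtains r where "r \<in> carrier R" "r \<otimes> a \<notin> I" "maximalideal (ideal_colon R I (r \<otimes> a)) R"
proof -
  interpret I: ideal I R by fact
  define P where "P r \<longleftrightarrow> r \<in> carrier R \<and> r \<otimes> a \<notin> I" for r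
  have "P \<one>" using a by (simp add: P_def)
  then obtain r where r: "P r"
    and min: "\<And>s. P s \<Longrightarrow> d (ideal_adjoin R I (r \<otimes> a)) \<le> d (ideal_adjoin R I (s \<otimes> a))"
    using ex_has_least_nat[of P \<one> "\<lambda>s. d (ideal_adjoin R I (s \<otimes> a))"] by blast
  let ?b = "r \<otimes> a"
  have rc: "r \<in> carrier R" and b: "?b \<in> carrier R" "?b \<notin> I" using r a by (auto simp: P_def)
  note ib = ideal_colon_ideal[OF I b(1)]
  have "maximalideal (ideal_colon R I ?b) R"
  proof (rule maximalidealI[OF ib])
    show "carrier R \<noteq> ideal_colon R I ?b"
      using b l_one[OF b(1)] one_closed unfolding ideal_colon_def by (metis (mono_tags, lifting) mem_Collect_eq)
  next
    fix J assume J: "ideal J R" "ideal_colon R I ?b \<subseteq> J" "J \<subseteq> carrier R"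
    interpret J: ideal J R by fact
    show "J = ideal_colon R I ?b \<or> J = carrier R"
    proof (cases "J \<subseteq> ideal_colon R I ?b")
      case False
      then obtain x where x: "x \<in> J" "x \<notin> ideal_colon R I ?b" by blast
      then have xc: "x \<in> carrier R" and xb: "x \<otimes> ?b \<notin> I" by (auto simp: ideal_colon_def J.Icarr)
      have P: "P (x \<otimes> r)" using xc rc xb a by (simp add: P_def m_assoc)
      let ?c = "x \<otimes> r \<otimes> a"
      have c: "?c = x \<otimes> ?b" "?c \<in> carrier R" using xc rc a by (simp_all add: m_assoc)
      have "?c \<in> ideal_adjoin R I ?b"
        using ideal.I_l_closed[OF ideal_adjoin_ideal[OF I b(1)] ideal_adjoin_upper(2)[OF I b(1)] xc] c by simp
      then have sub: "ideal_adjoin R I ?c \<subseteq> ideal_adjoin R I ?b"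
        using ideal_adjoin_least[OF ideal_adjoin_ideal[OF I b(1)]] ideal_adjoin_upper[OF I b(1)] by blast
      have "ideal_adjoin R I ?c = ideal_adjoin R I ?b"
        using d sub min[OF P] ideal_adjoin_ideal[OF I b(1)] ideal_adjoin_ideal[OF I c(2)]
        unfolding length_function_def by (metis leD psubsetI)
      then have "?b \<in> ideal_adjoin R I ?c" using ideal_adjoin_upper(2)[OF I b(1)] by simp
      then obtain i y where iy: "?b = i \<oplus> y \<otimes> ?c" "i \<in> I" "y \<in> carrier R"
        by (auto simp: ideal_adjoin_def)
      have eq: "(\<one> \<ominus> y \<otimes> x) \<otimes> ?b = ?b \<ominus> y \<otimes> ?c"
        using iy(3) xc b(1) rc a by (simp add: c(1) minus_eq l_distr l_minus m_assoc)
      have "i \<oplus> y \<otimes> ?c \<ominus> y \<otimes> ?c = i" using iy(2,3) I.Icarr c(2)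
        by (simp add: minus_eq a_assoc r_neg)
      then have "?b \<ominus> y \<otimes> ?c = i" using iy(1) by simp
      then have "\<one> \<ominus> y \<otimes> x \<in> ideal_colon R I ?b"
        using eq iy xc by (simp add: ideal_colon_def)
      then have 1: "\<one> \<ominus> y \<otimes> x \<in> J" using J(2) by blast
      have 2: "y \<otimes> x \<in> J" using x(1) iy(3) J.I_l_closed by blast
      have "(\<one> \<ominus> y \<otimes> x) \<oplus> y \<otimes> x = \<one>" using iy(3) xc by (simp add: minus_eq a_assoc l_neg)
      then have "\<one> \<in> J" using J.a_closed[OF 1 2] by simp
      then show ?thesis using J.one_imp_carrier by simp
    qed (use J in blast)
  qed
  with that rc b show thesis by blast
qed

lemma exists_maximalideal_above:
  assumes "length_function R d" and I: "ideal I R" "\<one> \<notin> I"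
  obtains M where "maximalideal M R" "I \<subseteq> M"
proof -
  interpret I: ideal I R by fact
  obtain r where r: "r \<in> carrier R" "maximalideal (ideal_colon R I (r \<otimes> \<one>)) R"
    using exists_multiple_with_maximal_colon[OF assms(1) I(1) _ I(2)] by blast
  moreover have "I \<subseteq> ideal_colon R I (r \<otimes> \<one>)"
    using r by (auto simp: ideal_colon_def I.Icarr I.I_r_closed)
  ultimately show thesis using that by blast
qed

end


section \<open>Self-injectivity of Artinian Gorenstein local rings\<close>

text \<open>
  The extension property of injective modules for the inclusions \<open>I \<subseteq> I + (a)\<close> and the homomorphisms
  \<open>I + (a) \<rightarrow> E\<close> that vanish on \<open>I\<close> and send \<open>a\<close> to \<open>x\<close>. The image \<open>y\<close> of \<open>1\<close> stands for the extension.
\<close>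

definition cyclically_injective :: "('a, 'r) ring_scheme \<Rightarrow> ('a, 'm, 'e) module_scheme \<Rightarrow> bool" where
  "cyclically_injective R E \<longleftrightarrow>
     (\<forall>I a x. ideal I R \<longrightarrow> a \<in> carrier R \<longrightarrow> x \<in> carrier E \<longrightarrow>
        (\<forall>r\<in>ideal_colon R I a. r \<odot>\<^bsub>E\<^esub> x = \<zero>\<^bsub>E\<^esub>) \<longrightarrow>
        (\<exists>y\<in>carrier E. (\<forall>i\<in>I. i \<odot>\<^bsub>E\<^esub> y = \<zero>\<^bsub>E\<^esub>) \<and> a \<odot>\<^bsub>E\<^esub> y = x))"

lemma cyclically_injectiveD:
  assumes "cyclically_injective R E" "ideal I R" "a \<in> carrier R" "x \<in> carrier E"
    "\<And>r. r \<in> ideal_colon R I a \<Longrightarrow> r \<odot>\<^bsub>E\<^esub> x = \<zero>\<^bsub>E\<^esub>"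
  obtains y where "y \<in> carrier E" "\<And>i. i \<in> I \<Longrightarrow> i \<odot>\<^bsub>E\<^esub> y = \<zero>\<^bsub>E\<^esub>" "a \<odot>\<^bsub>E\<^esub> y = x"
  using assms unfolding cyclically_injective_def by blast

lemma module_homI:
  assumes "\<And>x. x \<in> carrier M \<Longrightarrow> f x \<in> carrier N"
    and "\<And>x y. \<lbrakk>x \<in> carrier M; y \<in> carrier M\<rbrakk> \<Longrightarrow> f (x \<oplus>\<^bsub>M\<^esub> y) = f x \<oplus>\<^bsub>N\<^esub> f y"
    and "\<And>r x. \<lbrakk>r \<in> carrier R; x \<in> carrier M\<rbrakk> \<Longrightarrow> f (r \<odot>\<^bsub>M\<^esub> x) = r \<odot>\<^bsub>N\<^esub> f x"
  shows "f \<in> module_hom R M N"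
  using assms by (auto simp: module_hom_def)

lemma carrier_carrier_update: "carrier (M\<lparr>carrier := N\<rparr>) = N"
  by simp

text \<open>
  Extend the homomorphism \<open>i + r a \<mapsto> r x\<close> from \<open>I + (a)\<close> to \<open>R\<close> and evaluate at \<open>1\<close>. Injectivity is
  tested against modules whose elements have the same type as those of \<open>E\<close>; hence the copy \<open>F\<close> of \<open>R\<close>.
\<close>

lemma injective_imp_cyclically_injective:
  fixes R (structure) and E F :: "('a, 'u) module"
  assumes E: "injective_module R E" and F: "module R F" "isomorphic_modules R F (self_module R)"
  shows "cyclically_injective R E"
  unfolding cyclically_injective_def
proof (intro allI impI)
  fix I a x
  assume I: "ideal I R" and a: "a \<in> carrier R" and x: "x \<in> carrier E"
    and ann: "\<forall>r\<in>ideal_colon R I a. r \<odot>\<^bsub>E\<^esub> x = \<zero>\<^bsub>E\<^esub>"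
  interpret E: module R E using E by (simp add: injective_module_def)
  interpret F: module R F by fact
  interpret I: ideal I R by fact
  let ?J = "ideal_adjoin R I a"
  interpret J: ideal ?J R by (rule E.ideal_adjoin_ideal[OF I a])
  obtain \<theta> where \<theta>: "\<theta> \<in> module_hom R F (self_module R)" "bij_betw \<theta> (carrier F) (carrier R)"
    using F(2) by (auto simp: isomorphic_modules_def self_module_def)
  have \<theta>c: "\<theta> y \<in> carrier R" if "y \<in> carrier F" for y using \<theta>(2) that by (auto simp: bij_betw_def)
  have \<theta>a: "\<theta> (y \<oplus>\<^bsub>F\<^esub> z) = \<theta> y \<oplus> \<theta> z" if "y \<in> carrier F" "z \<in> carrier F" for y z
    using module_hom_add[OF \<theta>(1) that] by (simp add: self_module_def)
  have \<theta>s: "\<theta> (r \<odot>\<^bsub>F\<^esub> y) = r \<otimes> \<theta> y" if "r \<in> carrier R" "y \<in> carrier F" for r y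
    using module_hom_smult[OF \<theta>(1) that] by (simp add: self_module_def)
  have \<theta>0: "\<theta> \<zero>\<^bsub>F\<^esub> = \<zero>" using \<theta>s[of "\<zero>" "\<zero>\<^bsub>F\<^esub>"] \<theta>c[of "\<zero>\<^bsub>F\<^esub>"] by simp
  define N where "N = {y \<in> carrier F. \<theta> y \<in> ?J}"
  have N: "submodule R N F"
    unfolding submodule_def N_def
    using F(1) by (auto simp: \<theta>a \<theta>s \<theta>0 J.I_l_closed)
  define f where "f y = (SOME r. r \<in> carrier R \<and> (\<exists>i\<in>I. \<theta> y = i \<oplus> r \<otimes> a)) \<odot>\<^bsub>E\<^esub> x" for y
  have uniq: "r \<odot>\<^bsub>E\<^esub> x = s \<odot>\<^bsub>E\<^esub> x"
    if "i \<oplus> r \<otimes> a = j \<oplus> s \<otimes> a" "i \<in> I" "j \<in> I" "r \<in> carrier R" "s \<in> carrier R" for i j r s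
  proof -
    have c: "i \<in> carrier R" "j \<in> carrier R" using that I.Icarr by auto
    have "(r \<ominus> s) \<otimes> a = r \<otimes> a \<ominus> s \<otimes> a"
      using that a by (simp add: E.R.minus_eq E.l_distr E.l_minus)
    also have "\<dots> = j \<ominus> i"
    proof -
      have "r \<otimes> a \<ominus> s \<otimes> a = (i \<oplus> r \<otimes> a) \<ominus> (i \<oplus> s \<otimes> a)"
        using c that(4,5) a by algebra
      also have "\<dots> = (j \<oplus> s \<otimes> a) \<ominus> (i \<oplus> s \<otimes> a)" using that(1) by simp
      also have "\<dots> = j \<ominus> i" using c that(4,5) a by algebra
      finally show ?thesis .
    qed
    also have "\<dots> \<in> I" using that by (simp add: E.R.minus_eq)
    finally have "(r \<ominus> s) \<odot>\<^bsub>E\<^esub> x = \<zero>\<^bsub>E\<^esub>" using ann that by (simp add: ideal_colon_def)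
    moreover have "(r \<ominus> s) \<odot>\<^bsub>E\<^esub> x = r \<odot>\<^bsub>E\<^esub> x \<ominus>\<^bsub>E\<^esub> s \<odot>\<^bsub>E\<^esub> x"
      using that x by (simp add: E.R.minus_eq E.M.minus_eq E.smult_l_distr E.smult_l_minus)
    ultimately show ?thesis using that x E.M.minus_other_side[of "r \<odot>\<^bsub>E\<^esub> x" "s \<odot>\<^bsub>E\<^esub> x"] by simp
  qed
  have fI: "f y = r \<odot>\<^bsub>E\<^esub> x" if "\<theta> y = i \<oplus> r \<otimes> a" "i \<in> I" "r \<in> carrier R" for y i r
  proof -
    define s where "s = (SOME r. r \<in> carrier R \<and> (\<exists>i\<in>I. \<theta> y = i \<oplus> r \<otimes> a))"
    have "\<exists>r. r \<in> carrier R \<and> (\<exists>i\<in>I. \<theta> y = i \<oplus> r \<otimes> a)" using that by blast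
    from someI_ex[OF this] obtain j where "s \<in> carrier R" "j \<in> I" "\<theta> y = j \<oplus> s \<otimes> a"
      unfolding s_def by blast
    then show ?thesis unfolding f_def s_def[symmetric] using uniq[of j s i r] that by simp
  qed
  have ex: "\<exists>i r. i \<in> I \<and> r \<in> carrier R \<and> \<theta> y = i \<oplus> r \<otimes> a" if "y \<in> N" for y
    using that unfolding N_def ideal_adjoin_def by blast
  have f: "f \<in> module_hom R (F\<lparr>carrier := N\<rparr>) E"
  proof (rule module_homI; unfold carrier_carrier_update)
    fix y assume "y \<in> N"
    with ex obtain i r where "i \<in> I" "r \<in> carrier R" "\<theta> y = i \<oplus> r \<otimes> a" by blast
    then show "f y \<in> carrier E" using fI x by simp
  next
    fix y z assume yz: "y \<in> N" "z \<in> N"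
    obtain i r where 1: "i \<in> I" "r \<in> carrier R" "\<theta> y = i \<oplus> r \<otimes> a" using ex yz(1) by blast
    obtain j s where 2: "j \<in> I" "s \<in> carrier R" "\<theta> z = j \<oplus> s \<otimes> a" using ex yz(2) by blast
    have c: "i \<in> carrier R" "j \<in> carrier R" using 1 2 I.Icarr by auto
    have "\<theta> (y \<oplus>\<^bsub>F\<^esub> z) = (i \<oplus> r \<otimes> a) \<oplus> (j \<oplus> s \<otimes> a)"
      using yz 1 2 by (simp add: N_def \<theta>a)
    also have "\<dots> = (i \<oplus> j) \<oplus> (r \<oplus> s) \<otimes> a"
      using 1(2) 2(2) c a by algebra
    finally show "f (y \<oplus>\<^bsub>F\<lparr>carrier := N\<rparr>\<^esub> z) = f y \<oplus>\<^bsub>E\<^esub> f z"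
      using fI[of _ "i \<oplus> j" "r \<oplus> s"] fI[OF 1(3,1,2)] fI[OF 2(3,1,2)] 1 2 x by (simp add: E.smult_l_distr)
  next
    fix t y assume t: "t \<in> carrier R" and y: "y \<in> N"
    obtain i r where 1: "i \<in> I" "r \<in> carrier R" "\<theta> y = i \<oplus> r \<otimes> a" using ex y by blast
    have c: "i \<in> carrier R" using 1 I.Icarr by auto
    have "\<theta> (t \<odot>\<^bsub>F\<^esub> y) = t \<otimes> (i \<oplus> r \<otimes> a)" using t y 1 by (simp add: N_def \<theta>s)
    also have "\<dots> = (t \<otimes> i) \<oplus> (t \<otimes> r) \<otimes> a" using t 1 c a by algebra
    finally show "f (t \<odot>\<^bsub>F\<lparr>carrier := N\<rparr>\<^esub> y) = t \<odot>\<^bsub>E\<^esub> f y"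
      using fI[of _ "t \<otimes> i" "t \<otimes> r"] fI[OF 1(3,1,2)] 1 t x by (simp add: E.smult_assoc1 I.I_l_closed)
  qed
  obtain g where g: "g \<in> module_hom R F E" "\<forall>y\<in>N. g y = f y"
    using E N f F(1) unfolding injective_module_def by blast
  obtain u where u: "u \<in> carrier F" "\<theta> u = \<one>" using \<theta>(2) E.one_closed unfolding bij_betw_def by (metis imageE)
  have gu: "r \<odot>\<^bsub>E\<^esub> g u = s \<odot>\<^bsub>E\<^esub> x" if "r \<in> carrier R" "r = i \<oplus> s \<otimes> a" "i \<in> I" "s \<in> carrier R" for r i s
  proof -
    have "\<theta> (r \<odot>\<^bsub>F\<^esub> u) = i \<oplus> s \<otimes> a" using that(1) u by (simp add: \<theta>s) (use that(2) in simp)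
    moreover from this have "r \<odot>\<^bsub>F\<^esub> u \<in> N" using that u unfolding N_def ideal_adjoin_def by auto
    ultimately have "g (r \<odot>\<^bsub>F\<^esub> u) = s \<odot>\<^bsub>E\<^esub> x" using g fI that by simp
    then show ?thesis using module_hom_smult[OF g(1) that(1) u(1)] by simp
  qed
  show "\<exists>y\<in>carrier E. (\<forall>i\<in>I. i \<odot>\<^bsub>E\<^esub> y = \<zero>\<^bsub>E\<^esub>) \<and> a \<odot>\<^bsub>E\<^esub> y = x"
  proof (intro bexI[of _ "g u"] conjI ballI)
    show "g u \<in> carrier E" using g(1) u by (auto simp: module_hom_def)
    show "a \<odot>\<^bsub>E\<^esub> g u = x" using gu[of a "\<zero>" "\<one>"] a x by simp
    show "i \<odot>\<^bsub>E\<^esub> g u = \<zero>\<^bsub>E\<^esub>" if "i \<in> I" for i using gu[of i i "\<zero>"] I.Icarr[OF that] that a x by simp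
  qed
qed

text \<open>
  The functor \<open>Hom(R/I, -)\<close> preserves the surjection \<open>p\<close>. The proof climbs a composition series of
  \<open>R/I\<close> by adjoining to \<open>I\<close> an element \<open>s\<close> for which \<open>(I : s)\<close> is the maximal ideal \<open>\<mm>\<close>. Then \<open>\<mm>\<close> kills
  \<open>s c\<close>. If \<open>z\<close> generates a copy of \<open>R/\<mm>\<close> in \<open>R\<close>, the extension property of \<open>C\<close> gives \<open>s c = z p(e')\<close>, and \<open>z e'\<close> is a
  lift of \<open>s c\<close> killed by \<open>\<mm>\<close>. By that of \<open>E\<close>, this lift is \<open>s e\<^sub>1\<close> with \<open>I e\<^sub>1 = 0\<close>, and
  \<open>c - p(e\<^sub>1)\<close> is killed by \<open>I + (s)\<close>.
\<close>

lemma lift_annihilated_element: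
  fixes R (structure)
  assumes loc: "local_ring R" and d: "length_function R d"
    and E: "module R E" "cyclically_injective R E" and C: "module R C" "cyclically_injective R C"
    and p: "p \<in> module_hom R E C" "p ` carrier E = carrier C"
    and I: "ideal I R" and c: "c \<in> carrier C" "\<forall>i\<in>I. i \<odot>\<^bsub>C\<^esub> c = \<zero>\<^bsub>C\<^esub>"
  shows "\<exists>e\<in>carrier E. (\<forall>i\<in>I. i \<odot>\<^bsub>E\<^esub> e = \<zero>\<^bsub>E\<^esub>) \<and> p e = c"
  using I c
proof (induction "d (carrier R) - d I" arbitrary: I c rule: less_induct)
  case less
  note I = less.prems(1) and c = less.prems(2,3)
  interpret R: cring R using loc by (simp add: local_ring_def)
  interpret E: module R E by fact
  interpret C: module R C by fact
  interpret p: mod_hom R E C p by unfold_locales fact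
  interpret I: ideal I R by fact
  show ?case
  proof (cases "\<one> \<in> I")
    case True
    then have "c = \<zero>\<^bsub>C\<^esub>" using c C.smult_one by force
    then show ?thesis by (intro bexI[of _ "\<zero>\<^bsub>E\<^esub>"]) (auto simp: I.Icarr)
  next
    case False
    then have nz: "\<one> \<notin> {\<zero>}" using I.zero_closed by auto
    obtain s where "s \<in> carrier R" "s \<otimes> \<one> \<notin> I" "maximalideal (ideal_colon R I (s \<otimes> \<one>)) R"
      using R.exists_multiple_with_maximal_colon[OF d I R.one_closed False] by blast
    then have s: "s \<in> carrier R" "s \<notin> I" "maximalideal (ideal_colon R I s) R" by auto
    obtain z where "z \<in> carrier R" "z \<otimes> \<one> \<notin> {\<zero>}"
      "maximalideal (ideal_colon R {\<zero>} (z \<otimes> \<one>)) R"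
      using R.exists_multiple_with_maximal_colon[OF d R.zeroideal R.one_closed nz] by blast
    then have z: "z \<in> carrier R" "maximalideal (ideal_colon R {\<zero>} z) R" by auto
    have m: "ideal_colon R {\<zero>} z = ideal_colon R I s"
      using loc s z unfolding local_ring_def by blast
    have k1: "t \<odot>\<^bsub>C\<^esub> (s \<odot>\<^bsub>C\<^esub> c) = \<zero>\<^bsub>C\<^esub>" if "t \<in> ideal_colon R I s" for t
      using that c s C.smult_assoc1[of t s c] by (auto simp: ideal_colon_def)
    obtain y where y: "y \<in> carrier C" "z \<odot>\<^bsub>C\<^esub> y = s \<odot>\<^bsub>C\<^esub> c"
      using cyclically_injectiveD[OF C(2) R.zeroideal z(1), of "s \<odot>\<^bsub>C\<^esub> c"] k1 s c m by auto
    obtain e' where e': "e' \<in> carrier E" "p e' = y" using p(2) y(1) by (metis imageE)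
    have k2: "t \<odot>\<^bsub>E\<^esub> (z \<odot>\<^bsub>E\<^esub> e') = \<zero>\<^bsub>E\<^esub>" if "t \<in> ideal_colon R I s" for t
      using that[folded m] e' z E.smult_assoc1[of t z e'] by (auto simp: ideal_colon_def)
    obtain e1 where e1: "e1 \<in> carrier E" "\<And>i. i \<in> I \<Longrightarrow> i \<odot>\<^bsub>E\<^esub> e1 = \<zero>\<^bsub>E\<^esub>" "s \<odot>\<^bsub>E\<^esub> e1 = z \<odot>\<^bsub>E\<^esub> e'"
      using cyclically_injectiveD[OF E(2) I s(1), of "z \<odot>\<^bsub>E\<^esub> e'"] k2 z e' by auto
    have pe1: "s \<odot>\<^bsub>C\<^esub> p e1 = s \<odot>\<^bsub>C\<^esub> c"
      using p.f_smult[OF s(1) e1(1)] e1(3) p.f_smult[OF z(1) e'(1)] e' y by simp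
    let ?J = "ideal_adjoin R I s" and ?c = "c \<ominus>\<^bsub>C\<^esub> p e1"
    have J: "ideal ?J R" by (rule R.ideal_adjoin_ideal[OF I s(1)])
    have cc: "?c \<in> carrier C" using c e1 p.f_im by simp
    have kill: "j \<odot>\<^bsub>C\<^esub> ?c = \<zero>\<^bsub>C\<^esub>" if jJ: "j \<in> ?J" for j
    proof -
      obtain i t where it: "i \<in> I" "t \<in> carrier R" "j = i \<oplus> t \<otimes> s"
        using jJ by (auto simp: ideal_adjoin_def)
      have ic: "i \<in> carrier R" using it I.Icarr by auto
      have pc: "p e1 \<in> carrier C" using e1 p.f_im by simp
      have "i \<odot>\<^bsub>C\<^esub> p e1 = \<zero>\<^bsub>C\<^esub>" using p.f_smult[OF ic e1(1)] e1(2)[OF it(1)] p.f0_is_0 by simp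
      then have "i \<odot>\<^bsub>C\<^esub> ?c = \<zero>\<^bsub>C\<^esub>"
        using it ic c pc by (simp add: C.M.minus_eq C.smult_r_distr C.smult_r_minus)
      moreover have "(t \<otimes> s) \<odot>\<^bsub>C\<^esub> ?c = \<zero>\<^bsub>C\<^esub>"
        using it s c pc pe1 by (simp add: C.M.minus_eq C.smult_r_distr C.smult_r_minus C.smult_assoc1 C.M.r_neg)
      ultimately show ?thesis using it ic s cc by (simp add: C.smult_l_distr)
    qed
    have "I \<subset> ?J" using R.ideal_adjoin_upper[OF I s(1)] s(2) by auto
    then have 1: "d I < d ?J" using d I J by (simp add: length_function_def)
    have "?J \<subseteq> carrier R" using ideal.Icarr[OF J] by auto
    then have "d ?J \<le> d (carrier R)"
      using d J R.oneideal unfolding length_function_def by (metis less_imp_le order_refl psubsetI)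
    then have "d (carrier R) - d ?J < d (carrier R) - d I" using 1 by simp
    from less.hyps[OF this J cc] kill
    obtain e2 where e2: "e2 \<in> carrier E" "\<forall>j\<in>?J. j \<odot>\<^bsub>E\<^esub> e2 = \<zero>\<^bsub>E\<^esub>" "p e2 = ?c" by auto
    show ?thesis
    proof (intro bexI[of _ "e1 \<oplus>\<^bsub>E\<^esub> e2"] conjI ballI)
      show "p (e1 \<oplus>\<^bsub>E\<^esub> e2) = c" using e1 e2 c p.f_im[OF e1(1)]
        by (simp add: C.M.minus_eq C.M.a_lcomm C.M.r_neg)
      show "i \<odot>\<^bsub>E\<^esub> (e1 \<oplus>\<^bsub>E\<^esub> e2) = \<zero>\<^bsub>E\<^esub>" if "i \<in> I" for i
      proof -
        have "i \<in> ?J" using that R.ideal_adjoin_upper[OF I s(1)] by auto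
        then show ?thesis using that e1 e2 I.Icarr[OF that] by (simp add: E.smult_r_distr)
      qed
    qed (use e1 e2 in auto)
  qed
qed

text \<open>
  An extension \<open>e\<close> with values in \<open>E\<close> maps into the cokernel to an element killed by \<open>I + (a)\<close>; subtracting
  a lift that is killed by \<open>I + (a)\<close> as well brings it back into \<open>M\<close>.
\<close>

lemma cyclically_injective_kernel:
  assumes loc: "local_ring R" and d: "length_function R d" and M: "module R M"
    and E: "module R E" "cyclically_injective R E" and C: "module R C" "cyclically_injective R C"
    and i: "i \<in> module_hom R M E" "inj_on i (carrier M)"
    and p: "p \<in> module_hom R E C" "p ` carrier E = carrier C"
    and ex: "i ` carrier M = {x \<in> carrier E. p x = \<zero>\<^bsub>C\<^esub>}"
  shows "cyclically_injective R M"
  unfolding cyclically_injective_def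
proof (intro allI impI)
  fix I a x
  assume I: "ideal I R" and a: "a \<in> carrier R" and x: "x \<in> carrier M"
    and ann: "\<forall>r\<in>ideal_colon R I a. r \<odot>\<^bsub>M\<^esub> x = \<zero>\<^bsub>M\<^esub>"
  interpret R: cring R using loc by (simp add: local_ring_def)
  interpret M: module R M by fact
  interpret E: module R E by fact
  interpret C: module R C by fact
  interpret p: mod_hom R E C p by unfold_locales fact
  interpret i: mod_hom R M E i by unfold_locales fact
  interpret I: ideal I R by fact
  have ix: "i x \<in> carrier E" using x i.f_im by simp
  have "r \<odot>\<^bsub>E\<^esub> i x = \<zero>\<^bsub>E\<^esub>" if "r \<in> ideal_colon R I a" for r
    using that ann x i.f_smult[of r x] by (simp add: ideal_colon_def)
  then obtain e where e: "e \<in> carrier E" "\<And>r. r \<in> I \<Longrightarrow> r \<odot>\<^bsub>E\<^esub> e = \<zero>\<^bsub>E\<^esub>" "a \<odot>\<^bsub>E\<^esub> e = i x"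
    using cyclically_injectiveD[OF E(2) I a ix] by auto
  let ?J = "ideal_adjoin R I a"
  have J: "ideal ?J R" by (rule R.ideal_adjoin_ideal[OF I a])
  have pix: "p (i x) = \<zero>\<^bsub>C\<^esub>" using ex x by auto
  have pe: "p e \<in> carrier C" using e p.f_im by simp
  have "j \<odot>\<^bsub>C\<^esub> p e = \<zero>\<^bsub>C\<^esub>" if jJ: "j \<in> ?J" for j
  proof -
    obtain r t where rt: "r \<in> I" "t \<in> carrier R" "j = r \<oplus>\<^bsub>R\<^esub> t \<otimes>\<^bsub>R\<^esub> a"
      using jJ by (auto simp: ideal_adjoin_def)
    have rc: "r \<in> carrier R" using rt I.Icarr by auto
    have "j \<odot>\<^bsub>E\<^esub> e = t \<odot>\<^bsub>E\<^esub> i x"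
      using rt rc a e ix by (simp add: E.smult_l_distr E.smult_assoc1)
    then have "p (j \<odot>\<^bsub>E\<^esub> e) = \<zero>\<^bsub>C\<^esub>" using rt pix p.f_smult[OF rt(2) ix] by simp
    then show ?thesis using p.f_smult[OF ideal.Icarr[OF J jJ] e(1)] by simp
  qed
  then obtain e' where e': "e' \<in> carrier E" "\<forall>j\<in>?J. j \<odot>\<^bsub>E\<^esub> e' = \<zero>\<^bsub>E\<^esub>" "p e' = p e"
    using lift_annihilated_element[OF loc d E C p J pe] by blast
  have "p (e \<ominus>\<^bsub>E\<^esub> e') = \<zero>\<^bsub>C\<^esub>" using e e' pe by simp
  moreover have "e \<ominus>\<^bsub>E\<^esub> e' \<in> carrier E" using e e' by simp
  ultimately obtain y where y: "y \<in> carrier M" "i y = e \<ominus>\<^bsub>E\<^esub> e'" using ex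
    by (metis (mono_tags, lifting) imageE mem_Collect_eq)
  have kill: "r \<odot>\<^bsub>M\<^esub> y = \<zero>\<^bsub>M\<^esub>" if "r \<in> I" for r
  proof -
    have rc: "r \<in> carrier R" "r \<in> ?J" using that R.ideal_adjoin_upper[OF I a] I.Icarr by auto
    have "i (r \<odot>\<^bsub>M\<^esub> y) = \<zero>\<^bsub>E\<^esub>"
      using rc y e(1) e(2)[OF that] e'(1,2) by (simp add: E.M.minus_eq E.smult_r_distr E.smult_r_minus)
    then have "i (r \<odot>\<^bsub>M\<^esub> y) = i \<zero>\<^bsub>M\<^esub>" by simp
    then show ?thesis using i(2) rc y by (meson M.M.zero_closed M.smult_closed inj_onD)
  qed
  have "i (a \<odot>\<^bsub>M\<^esub> y) = i x"
    using a y e e' R.ideal_adjoin_upper[OF I a] ix by (simp add: E.M.minus_eq E.smult_r_distr E.smult_r_minus)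
  then have "a \<odot>\<^bsub>M\<^esub> y = x" using i(2) a y x by (meson M.smult_closed inj_onD)
  then show "\<exists>y\<in>carrier M. (\<forall>i\<in>I. i \<odot>\<^bsub>M\<^esub> y = \<zero>\<^bsub>M\<^esub>) \<and> a \<odot>\<^bsub>M\<^esub> y = x" using y kill by blast
qed

lemma finite_injective_dimension_imp_cyclically_injective:
  fixes M F :: "('a, 'u) module"
  assumes "finite_injective_dimension R M" and loc: "local_ring R" and d: "length_function R d"
    and F: "module R F" "isomorphic_modules R F (self_module R)"
  shows "cyclically_injective R M"
  using assms(1)
proof (induction rule: finite_injective_dimension.induct)
  case (injective M)
  then show ?case by (rule injective_imp_cyclically_injective[OF _ F])
next
  case (cosyzygy M E C i p)
  have E: "module R E" using cosyzygy(2) by (simp add: injective_module_def)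
  show ?case
    by (rule cyclically_injective_kernel[OF loc d cosyzygy(1) E
          injective_imp_cyclically_injective[OF cosyzygy(2) F] cosyzygy(3) cosyzygy(10)
          cosyzygy(4,5,6,7,8)])
qed

text \<open>
  The homomorphism \<open>(I + (b)) / I \<rightarrow> R\<close> that sends \<open>b\<close> to a nonzero element of the socle is well
  defined, since \<open>(I : b)\<close> lies in the maximal ideal. It extends to \<open>R / I\<close>, where it is multiplication by
  an element that kills \<open>I\<close>.
\<close>

lemma gorenstein_double_annihilator_local:
  fixes R (structure)
  assumes gor: "gorenstein_local_ring R" and d: "length_function R d"
    and I: "ideal I R" and b: "b \<in> carrier R" "b \<notin> I"
  obtains x where "x \<in> carrier R" "\<And>i. i \<in> I \<Longrightarrow> x \<otimes> i = \<zero>" "x \<otimes> b \<noteq> \<zero>"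
proof -
  have loc: "local_ring R" using gor by (simp add: gorenstein_local_ring_def)
  interpret R: cring R using loc by (simp add: local_ring_def)
  interpret I: ideal I R by fact
  obtain M :: "('a, nat \<times> 'a) module" where M: "module R M" "isomorphic_modules R M (self_module R)"
    "finite_injective_dimension R M" using gor by (auto simp: gorenstein_local_ring_def)
  have inj: "cyclically_injective R M"
    by (rule finite_injective_dimension_imp_cyclically_injective[OF M(3) loc d M(1,2)])
  interpret M: module R M by fact
  obtain \<theta> where \<theta>: "\<theta> \<in> module_hom R M (self_module R)" "bij_betw \<theta> (carrier M) (carrier R)"
    using M(2) by (auto simp: isomorphic_modules_def self_module_def)
  have \<theta>c: "\<theta> y \<in> carrier R" if "y \<in> carrier M" for y using \<theta>(2) that by (auto simp: bij_betw_def)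
  have \<theta>s: "\<theta> (r \<odot>\<^bsub>M\<^esub> y) = r \<otimes> \<theta> y" if "r \<in> carrier R" "y \<in> carrier M" for r y
    using module_hom_smult[OF \<theta>(1) that] by (simp add: self_module_def)
  have \<theta>0: "\<theta> \<zero>\<^bsub>M\<^esub> = \<zero>" using \<theta>s[of "\<zero>" "\<zero>\<^bsub>M\<^esub>"] \<theta>c[of "\<zero>\<^bsub>M\<^esub>"] by simp
  have one: "\<one> \<notin> I" using b I.one_imp_carrier by auto
  then have nz: "\<one> \<notin> {\<zero>}" using I.zero_closed by auto
  obtain z where "z \<in> carrier R" "z \<otimes> \<one> \<notin> {\<zero>}" "maximalideal (ideal_colon R {\<zero>} (z \<otimes> \<one>)) R"
    using R.exists_multiple_with_maximal_colon[OF d R.zeroideal R.one_closed nz] by blast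
  then have z: "z \<in> carrier R" "z \<noteq> \<zero>" "maximalideal (ideal_colon R {\<zero>} z) R" by auto
  have "\<one> \<notin> ideal_colon R I b" using b by (simp add: ideal_colon_def)
  then obtain N where "maximalideal N R" "ideal_colon R I b \<subseteq> N"
    using R.exists_maximalideal_above[OF d R.ideal_colon_ideal[OF I b(1)]] by blast
  then have sub: "ideal_colon R I b \<subseteq> ideal_colon R {\<zero>} z"
    using loc z(3) unfolding local_ring_def by blast
  obtain w where w: "w \<in> carrier M" "\<theta> w = z" using \<theta>(2) z(1) unfolding bij_betw_def by (metis imageE)
  have "r \<odot>\<^bsub>M\<^esub> w = \<zero>\<^bsub>M\<^esub>" if "r \<in> ideal_colon R I b" for r
  proof -
    have r: "r \<in> carrier R" "r \<otimes> z = \<zero>" using that sub by (auto simp: ideal_colon_def)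
    then have "\<theta> (r \<odot>\<^bsub>M\<^esub> w) = \<theta> \<zero>\<^bsub>M\<^esub>" using \<theta>s w \<theta>0 by simp
    then show ?thesis using \<theta>(2) r w unfolding bij_betw_def by (meson M.M.zero_closed M.smult_closed inj_onD)
  qed
  then obtain y where y: "y \<in> carrier M" "\<And>i. i \<in> I \<Longrightarrow> i \<odot>\<^bsub>M\<^esub> y = \<zero>\<^bsub>M\<^esub>" "b \<odot>\<^bsub>M\<^esub> y = w"
    using cyclically_injectiveD[OF inj I b(1) w(1)] by blast
  show thesis
  proof (rule that)
    show "\<theta> y \<in> carrier R" using \<theta>c y by simp
    show "\<theta> y \<otimes> i = \<zero>" if "i \<in> I" for i
      using \<theta>s[of i y] y(1) y(2)[OF that] \<theta>0 \<theta>c I.Icarr[OF that] by (simp add: R.m_comm)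
    show "\<theta> y \<otimes> b \<noteq> \<zero>" using \<theta>s[of b y] y \<theta>c b w z by (simp add: R.m_comm)
  qed
qed


section \<open>Localization\<close>

lemma self_module_simps [simp]:
  "carrier (self_module R) = carrier R" "smult (self_module R) = monoid.mult R"
  "ring.add (self_module R) = ring.add R" "ring.zero (self_module R) = ring.zero R"
  by (simp_all add: self_module_def)

lemma (in cring) module_self_module: "module R (self_module R)"
proof (rule moduleI)
  show "cring R" by (rule is_cring)
  show "abelian_group (self_module R)"
    proof (rule abelian_groupI)
    fix x assume "x \<in> carrier (self_module R)"
    then show "\<exists>y\<in>carrier (self_module R). y \<oplus>\<^bsub>self_module R\<^esub> x = \<zero>\<^bsub>self_module R\<^esub>"
      using l_neg[of x] a_inv_closed[of x] by auto
  qed (simp_all add: a_ac)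
qed (auto simp: l_distr r_distr m_assoc)

definition multiplicative_set :: "('a, 'r) ring_scheme \<Rightarrow> 'a set \<Rightarrow> bool" where
  "multiplicative_set R S \<longleftrightarrow> S \<subseteq> carrier R \<and> \<one>\<^bsub>R\<^esub> \<in> S \<and> (\<forall>s\<in>S. \<forall>t\<in>S. s \<otimes>\<^bsub>R\<^esub> t \<in> S)"

context module
begin

context
  fixes S assumes S: "multiplicative_set R S"
begin

lemma mult_set_closed: "s \<in> S \<Longrightarrow> s \<in> carrier R" "\<one> \<in> S" "s \<in> S \<Longrightarrow> t \<in> S \<Longrightarrow> s \<otimes> t \<in> S"
  using S by (auto simp: multiplicative_set_def)

lemma mem_fraction:
  assumes "m \<in> carrier M" "s \<in> S"
  shows "(m', s') \<in> fraction R S M m s \<longleftrightarrow>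
    m' \<in> carrier M \<and> s' \<in> S \<and> (\<exists>u\<in>S. (u \<otimes> s) \<odot>\<^bsub>M\<^esub> m' = (u \<otimes> s') \<odot>\<^bsub>M\<^esub> m)"
  using assms mult_set_closed by (auto simp: fraction_def smult_assoc1)

lemma fraction_self:
  assumes "m \<in> carrier M" "s \<in> S" shows "(m, s) \<in> fraction R S M m s"
  using assms mult_set_closed(2) by (auto simp: mem_fraction)

lemma fraction_eqI_aux:
  assumes m: "m \<in> carrier M" "m' \<in> carrier M" "s \<in> S" "s' \<in> S" "u \<in> S"
    and eq: "(u \<otimes> s) \<odot>\<^bsub>M\<^esub> m' = (u \<otimes> s') \<odot>\<^bsub>M\<^esub> m"
  shows "fraction R S M m s \<subseteq> fraction R S M m' s'"
proof
  fix q assume q: "q \<in> fraction R S M m s"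
  obtain n t where nt: "q = (n, t)" by force
  obtain v where v: "n \<in> carrier M" "t \<in> S" "v \<in> S" "(v \<otimes> s) \<odot>\<^bsub>M\<^esub> n = (v \<otimes> t) \<odot>\<^bsub>M\<^esub> m"
    using q unfolding nt mem_fraction[OF m(1,3)] by blast
  note c = m(1,2) v(1) m(3-5)[THEN mult_set_closed(1)] v(2,3)[THEN mult_set_closed(1)]
  have "(u \<otimes> v \<otimes> s \<otimes> s') \<odot>\<^bsub>M\<^esub> n = (u \<otimes> s') \<odot>\<^bsub>M\<^esub> ((v \<otimes> s) \<odot>\<^bsub>M\<^esub> n)"
    using c by (simp add: smult_assoc1[symmetric] m_ac)
  also have "\<dots> = (v \<otimes> t) \<odot>\<^bsub>M\<^esub> ((u \<otimes> s') \<odot>\<^bsub>M\<^esub> m)"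
    unfolding v(4) using c by (simp add: smult_assoc1[symmetric] m_ac)
  also have "\<dots> = (u \<otimes> v \<otimes> s \<otimes> t) \<odot>\<^bsub>M\<^esub> m'"
    unfolding eq[symmetric] using c by (simp add: smult_assoc1[symmetric] m_ac)
  finally have "(u \<otimes> v \<otimes> s \<otimes> s') \<odot>\<^bsub>M\<^esub> n = (u \<otimes> v \<otimes> s \<otimes> t) \<odot>\<^bsub>M\<^esub> m'" .
  moreover have "u \<otimes> v \<otimes> s \<in> S" by (intro mult_set_closed(3) m v)
  ultimately show "q \<in> fraction R S M m' s'"
    unfolding nt mem_fraction[OF m(2,4)] using v(1,2) by blast
qed

lemma fraction_eq_iff:
  assumes m: "m \<in> carrier M" "m' \<in> carrier M" "s \<in> S" "s' \<in> S"
  shows "fraction R S M m s = fraction R S M m' s' \<longleftrightarrow>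
    (\<exists>u\<in>S. (u \<otimes> s) \<odot>\<^bsub>M\<^esub> m' = (u \<otimes> s') \<odot>\<^bsub>M\<^esub> m)"
proof
  assume "fraction R S M m s = fraction R S M m' s'"
  then have "(m', s') \<in> fraction R S M m s" using fraction_self m by simp
  then show "\<exists>u\<in>S. (u \<otimes> s) \<odot>\<^bsub>M\<^esub> m' = (u \<otimes> s') \<odot>\<^bsub>M\<^esub> m" using m by (simp add: mem_fraction)
next
  assume "\<exists>u\<in>S. (u \<otimes> s) \<odot>\<^bsub>M\<^esub> m' = (u \<otimes> s') \<odot>\<^bsub>M\<^esub> m"
  then obtain u where u: "u \<in> S" "(u \<otimes> s) \<odot>\<^bsub>M\<^esub> m' = (u \<otimes> s') \<odot>\<^bsub>M\<^esub> m" by blast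
  show "fraction R S M m s = fraction R S M m' s'"
    by (rule subset_antisym[OF fraction_eqI_aux[OF m u] fraction_eqI_aux[OF m(2,1,4,3) u(1) u(2)[symmetric]]])
qed

lemma localized_carrier_iff:
  "X \<in> carrier (localized_module R S M) \<longleftrightarrow> (\<exists>m s. X = fraction R S M m s \<and> m \<in> carrier M \<and> s \<in> S)"
  by (auto simp: localized_module_def)

lemma localized_zero: "\<zero>\<^bsub>localized_module R S M\<^esub> = fraction R S M \<zero>\<^bsub>M\<^esub> \<one>"
  by (simp add: localized_module_def)

lemma localized_add:
  assumes m: "m \<in> carrier M" "s \<in> S" "n \<in> carrier M" "t \<in> S"
  shows "fraction R S M m s \<oplus>\<^bsub>localized_module R S M\<^esub> fraction R S M n t =
    fraction R S M (t \<odot>\<^bsub>M\<^esub> m \<oplus>\<^bsub>M\<^esub> s \<odot>\<^bsub>M\<^esub> n) (s \<otimes> t)"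
proof -
  have *: "fraction R S M (t' \<odot>\<^bsub>M\<^esub> m' \<oplus>\<^bsub>M\<^esub> s' \<odot>\<^bsub>M\<^esub> n') (s' \<otimes> t') = fraction R S M (t \<odot>\<^bsub>M\<^esub> m \<oplus>\<^bsub>M\<^esub> s \<odot>\<^bsub>M\<^esub> n) (s \<otimes> t)"
    if ms': "(m', s') \<in> fraction R S M m s" and nt': "(n', t') \<in> fraction R S M n t" for m' s' n' t'
  proof -
    obtain u where u: "m' \<in> carrier M" "s' \<in> S" "u \<in> S" "(u \<otimes> s) \<odot>\<^bsub>M\<^esub> m' = (u \<otimes> s') \<odot>\<^bsub>M\<^esub> m"
      using ms' unfolding mem_fraction[OF m(1,2)] by blast
    obtain v where v: "n' \<in> carrier M" "t' \<in> S" "v \<in> S" "(v \<otimes> t) \<odot>\<^bsub>M\<^esub> n' = (v \<otimes> t') \<odot>\<^bsub>M\<^esub> n"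
      using nt' unfolding mem_fraction[OF m(3,4)] by blast
    note c = m(1,3) u(1) v(1) m(2,4)[THEN mult_set_closed(1)] u(2,3)[THEN mult_set_closed(1)]
      v(2,3)[THEN mult_set_closed(1)]
    have 1: "(u \<otimes> v \<otimes> (s' \<otimes> t')) \<odot>\<^bsub>M\<^esub> (t \<odot>\<^bsub>M\<^esub> m) = (u \<otimes> v \<otimes> (s \<otimes> t)) \<odot>\<^bsub>M\<^esub> (t' \<odot>\<^bsub>M\<^esub> m')"
    proof -
      have "(u \<otimes> v \<otimes> (s' \<otimes> t')) \<odot>\<^bsub>M\<^esub> (t \<odot>\<^bsub>M\<^esub> m) = (v \<otimes> t' \<otimes> t) \<odot>\<^bsub>M\<^esub> ((u \<otimes> s') \<odot>\<^bsub>M\<^esub> m)"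
        using c by (simp add: smult_assoc1[symmetric] m_ac)
      also have "\<dots> = (u \<otimes> v \<otimes> (s \<otimes> t)) \<odot>\<^bsub>M\<^esub> (t' \<odot>\<^bsub>M\<^esub> m')"
        unfolding u(4)[symmetric] using c by (simp add: smult_assoc1[symmetric] m_ac)
      finally show ?thesis .
    qed
    have 2: "(u \<otimes> v \<otimes> (s' \<otimes> t')) \<odot>\<^bsub>M\<^esub> (s \<odot>\<^bsub>M\<^esub> n) = (u \<otimes> v \<otimes> (s \<otimes> t)) \<odot>\<^bsub>M\<^esub> (s' \<odot>\<^bsub>M\<^esub> n')"
    proof -
      have "(u \<otimes> v \<otimes> (s' \<otimes> t')) \<odot>\<^bsub>M\<^esub> (s \<odot>\<^bsub>M\<^esub> n) = (u \<otimes> s' \<otimes> s) \<odot>\<^bsub>M\<^esub> ((v \<otimes> t') \<odot>\<^bsub>M\<^esub> n)"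
        using c by (simp add: smult_assoc1[symmetric] m_ac)
      also have "\<dots> = (u \<otimes> v \<otimes> (s \<otimes> t)) \<odot>\<^bsub>M\<^esub> (s' \<odot>\<^bsub>M\<^esub> n')"
        unfolding v(4)[symmetric] using c by (simp add: smult_assoc1[symmetric] m_ac)
      finally show ?thesis .
    qed
    have "(u \<otimes> v \<otimes> (s' \<otimes> t')) \<odot>\<^bsub>M\<^esub> (t \<odot>\<^bsub>M\<^esub> m \<oplus>\<^bsub>M\<^esub> s \<odot>\<^bsub>M\<^esub> n) =
        (u \<otimes> v \<otimes> (s \<otimes> t)) \<odot>\<^bsub>M\<^esub> (t' \<odot>\<^bsub>M\<^esub> m' \<oplus>\<^bsub>M\<^esub> s' \<odot>\<^bsub>M\<^esub> n')"
      using c 1 2 by (simp add: smult_r_distr)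
    moreover have "u \<otimes> v \<in> S" "s \<otimes> t \<in> S" "s' \<otimes> t' \<in> S" by (intro mult_set_closed(3) m u v)+
    ultimately show ?thesis using c by (subst fraction_eq_iff) auto
  qed
  have "fraction R S M m s \<oplus>\<^bsub>localized_module R S M\<^esub> fraction R S M n t =
    (\<Union>p\<in>fraction R S M m s. \<Union>q\<in>fraction R S M n t.
      fraction R S M (snd q \<odot>\<^bsub>M\<^esub> fst p \<oplus>\<^bsub>M\<^esub> snd p \<odot>\<^bsub>M\<^esub> fst q) (snd p \<otimes> snd q))"
    by (simp add: localized_module_def case_prod_beta)
  also have "\<dots> = (\<Union>p\<in>fraction R S M m s. \<Union>q\<in>fraction R S M n t.
      fraction R S M (t \<odot>\<^bsub>M\<^esub> m \<oplus>\<^bsub>M\<^esub> s \<odot>\<^bsub>M\<^esub> n) (s \<otimes> t))"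
    using * by (intro SUP_cong refl) auto
  also have "\<dots> = fraction R S M (t \<odot>\<^bsub>M\<^esub> m \<oplus>\<^bsub>M\<^esub> s \<odot>\<^bsub>M\<^esub> n) (s \<otimes> t)"
    using fraction_self m by blast
  finally show ?thesis .
qed

lemma localized_smult:
  assumes m: "a \<in> carrier R" "s \<in> S" "m \<in> carrier M" "t \<in> S"
  shows "fraction R S (self_module R) a s \<odot>\<^bsub>localized_module R S M\<^esub> fraction R S M m t =
    fraction R S M (a \<odot>\<^bsub>M\<^esub> m) (s \<otimes> t)"
proof -
  have *: "fraction R S M (a' \<odot>\<^bsub>M\<^esub> m') (s' \<otimes> t') = fraction R S M (a \<odot>\<^bsub>M\<^esub> m) (s \<otimes> t)"
    if as': "(a', s') \<in> fraction R S (self_module R) a s" and mt': "(m', t') \<in> fraction R S M m t" for a' s' m' t'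
  proof -
    obtain u where u: "a' \<in> carrier R" "s' \<in> S" "u \<in> S" "u \<otimes> (s \<otimes> a') = u \<otimes> (s' \<otimes> a)"
      using as' unfolding fraction_def self_module_simps mem_Collect_eq prod.case by blast
    obtain v where v: "m' \<in> carrier M" "t' \<in> S" "v \<in> S" "(v \<otimes> t) \<odot>\<^bsub>M\<^esub> m' = (v \<otimes> t') \<odot>\<^bsub>M\<^esub> m"
      using mt' unfolding mem_fraction[OF m(3,4)] by blast
    note c = m(1,3) u(1) v(1) m(2,4)[THEN mult_set_closed(1)] u(2,3)[THEN mult_set_closed(1)]
      v(2,3)[THEN mult_set_closed(1)]
    have "(u \<otimes> v \<otimes> (s' \<otimes> t')) \<odot>\<^bsub>M\<^esub> (a \<odot>\<^bsub>M\<^esub> m) = (u \<otimes> (s' \<otimes> a)) \<odot>\<^bsub>M\<^esub> ((v \<otimes> t') \<odot>\<^bsub>M\<^esub> m)"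
      using c by (simp add: smult_assoc1[symmetric] m_ac)
    also have "\<dots> = (u \<otimes> (s \<otimes> a')) \<odot>\<^bsub>M\<^esub> ((v \<otimes> t) \<odot>\<^bsub>M\<^esub> m')" by (simp only: u(4) v(4))
    also have "\<dots> = (u \<otimes> v \<otimes> (s \<otimes> t)) \<odot>\<^bsub>M\<^esub> (a' \<odot>\<^bsub>M\<^esub> m')"
      using c by (simp add: smult_assoc1[symmetric] m_ac)
    finally have "(u \<otimes> v \<otimes> (s' \<otimes> t')) \<odot>\<^bsub>M\<^esub> (a \<odot>\<^bsub>M\<^esub> m) = (u \<otimes> v \<otimes> (s \<otimes> t)) \<odot>\<^bsub>M\<^esub> (a' \<odot>\<^bsub>M\<^esub> m')" .
    moreover have "u \<otimes> v \<in> S" "s \<otimes> t \<in> S" "s' \<otimes> t' \<in> S" by (intro mult_set_closed(3) m u v)+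
    ultimately show ?thesis using c by (subst fraction_eq_iff) auto
  qed
  have ne: "(a, s) \<in> fraction R S (self_module R) a s"
    using m mult_set_closed(2) by (auto simp: fraction_def)
  have "fraction R S (self_module R) a s \<odot>\<^bsub>localized_module R S M\<^esub> fraction R S M m t =
    (\<Union>p\<in>fraction R S (self_module R) a s. \<Union>q\<in>fraction R S M m t.
      fraction R S M (fst p \<odot>\<^bsub>M\<^esub> fst q) (snd p \<otimes> snd q))"
    by (simp add: localized_module_def case_prod_beta)
  also have "\<dots> = (\<Union>p\<in>fraction R S (self_module R) a s. \<Union>q\<in>fraction R S M m t.
      fraction R S M (a \<odot>\<^bsub>M\<^esub> m) (s \<otimes> t))"
    using * by (intro SUP_cong refl) auto
  also have "\<dots> = fraction R S M (a \<odot>\<^bsub>M\<^esub> m) (s \<otimes> t)"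
    using fraction_self[OF m(3,4)] ne by blast
  finally show ?thesis .
qed

end

end

lemma localized_ring_simps:
  "carrier (localized_ring R S) = carrier (localized_module R S (self_module R))"
  "monoid.mult (localized_ring R S) = smult (localized_module R S (self_module R))"
  "ring.add (localized_ring R S) = ring.add (localized_module R S (self_module R))"
  "ring.zero (localized_ring R S) = ring.zero (localized_module R S (self_module R))"
  "monoid.one (localized_ring R S) = fraction R S (self_module R) \<one>\<^bsub>R\<^esub> \<one>\<^bsub>R\<^esub>"
  by (simp_all add: localized_ring_def)

text \<open>
  Choose \<open>s \<in> S\<close> with \<open>(s)\<close> as small as possible. Then \<open>(s) = (t s)\<close> for all \<open>t \<in> S\<close>; in particular
  \<open>s = y s\<^sup>2\<close>, and \<open>e = y s\<close>. For such an \<open>e\<close>, localizing at \<open>S\<close> is the same as multiplying by \<open>e\<close>.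
\<close>

lemma (in cring) exists_localizing_idempotent:
  assumes d: "length_function R d" and S: "multiplicative_set R S"
  obtains e s where "e \<in> carrier R" "e \<otimes> e = e" "s \<in> S" "s \<otimes> e = s"
    "\<And>t. t \<in> S \<Longrightarrow> \<exists>h\<in>carrier R. e = h \<otimes> t"
proof -
  have SR: "\<And>s. s \<in> S \<Longrightarrow> s \<in> carrier R" "\<one> \<in> S" "\<And>s t. s \<in> S \<Longrightarrow> t \<in> S \<Longrightarrow> s \<otimes> t \<in> S"
    using S by (auto simp: multiplicative_set_def)
  let ?I = "ideal_adjoin R {\<zero>}"
  obtain s where s: "s \<in> S" and min: "\<And>t. t \<in> S \<Longrightarrow> d (?I s) \<le> d (?I t)"
    using ex_has_least_nat[of "\<lambda>s. s \<in> S" \<one> "\<lambda>s. d (?I s)"] SR(2) by blast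
  have sc: "s \<in> carrier R" using s SR by simp
  have div: "\<exists>y\<in>carrier R. s = y \<otimes> (t \<otimes> s)" if t: "t \<in> S" for t
  proof -
    have c: "t \<in> carrier R" "t \<otimes> s \<in> carrier R" using t sc SR by auto
    have "t \<otimes> s \<in> ?I s"
      using ideal.I_l_closed[OF ideal_adjoin_ideal[OF zeroideal sc] ideal_adjoin_upper(2)[OF zeroideal sc] c(1)] .
    moreover have "{\<zero>} \<subseteq> ?I s" using ideal_adjoin_upper(1)[OF zeroideal sc] .
    ultimately have sub: "?I (t \<otimes> s) \<subseteq> ?I s"
      by (rule ideal_adjoin_least[OF ideal_adjoin_ideal[OF zeroideal sc], rotated])
    have "?I (t \<otimes> s) = ?I s"
      using d sub min[OF SR(3)[OF t s]] ideal_adjoin_ideal[OF zeroideal sc] ideal_adjoin_ideal[OF zeroideal c(2)]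
      unfolding length_function_def by (metis leD psubsetI)
    then have "s \<in> ?I (t \<otimes> s)" using ideal_adjoin_upper(2)[OF zeroideal sc] by simp
    then obtain i y where "s = i \<oplus> y \<otimes> (t \<otimes> s)" "i = \<zero>" "y \<in> carrier R"
      unfolding ideal_adjoin_def by blast
    then show ?thesis using c(2) l_zero m_closed by metis
  qed
  obtain y where y: "y \<in> carrier R" "s = y \<otimes> (s \<otimes> s)" using div[OF s] by blast
  let ?e = "y \<otimes> s"
  have se: "s \<otimes> ?e = s"
  proof -
    have "s \<otimes> ?e = y \<otimes> (s \<otimes> s)" using y(1) sc by (simp add: m_lcomm)
    then show ?thesis using y(2) by simp
  qed
  show thesis
  proof (rule that)
    show "?e \<in> carrier R" using y sc by simp
    show "s \<in> S" by fact
    show "s \<otimes> ?e = s" by (rule se)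
    show "?e \<otimes> ?e = ?e" using se y sc by (simp add: m_assoc)
    show "\<exists>h\<in>carrier R. ?e = h \<otimes> t" if t: "t \<in> S" for t
    proof -
      obtain z where z: "z \<in> carrier R" "s = z \<otimes> (t \<otimes> s)" using div[OF t] by blast
      have "?e = y \<otimes> (z \<otimes> (t \<otimes> s))" using z(2) by simp
      also have "\<dots> = (y \<otimes> z \<otimes> s) \<otimes> t" using y z(1) sc SR(1)[OF t] by (simp add: m_ac)
      finally show ?thesis using y z(1) sc by blast
    qed
  qed
qed


section \<open>Double annihilators in a Gorenstein scheme\<close>

text \<open>
  An ideal of \<open>S\<^sup>-\<^sup>1A\<close> is determined by its contraction to \<open>A\<close>, because \<open>a/s\<close> and \<open>a/1\<close> differ by a unit.
\<close>

lemma localization_length_function: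
  fixes A (structure)
  assumes A: "cring A" and d: "length_function A d" and S: "multiplicative_set A S"
    and R: "cring (localized_ring A S)"
  shows "\<exists>d'. length_function (localized_ring A S) d'"
proof -
  interpret A: cring A by fact
  interpret N: module A "self_module A" by (rule A.module_self_module)
  let ?R = "localized_ring A S"
  interpret R: cring ?R by fact
  let ?fr = "fraction A S (self_module A)"
  have Sc: "s \<in> carrier A" if "s \<in> S" for s using S that by (auto simp: multiplicative_set_def)
  have S1: "\<one> \<in> S" using S by (simp add: multiplicative_set_def)
  have SS: "s \<otimes> t \<in> S" if "s \<in> S" "t \<in> S" for s t using S that by (simp add: multiplicative_set_def)
  define c where "c I = {a \<in> carrier A. ?fr a \<one> \<in> I}" for I
  have frR: "?fr a s \<in> carrier ?R" if "a \<in> carrier A" "s \<in> S" for a s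
    using that by (auto simp: localized_ring_simps N.localized_carrier_iff[OF S])
  have mult: "?fr a s \<otimes>\<^bsub>?R\<^esub> ?fr b t = ?fr (a \<otimes> b) (s \<otimes> t)"
    if "a \<in> carrier A" "b \<in> carrier A" "s \<in> S" "t \<in> S" for a b s t
    using N.localized_smult[OF S] that by (simp add: localized_ring_simps)
  have c: "ideal (c I) A" if I: "ideal I ?R" for I
  proof (rule A.ideal_criterion)
    interpret I: ideal I ?R by fact
    show "c I \<subseteq> carrier A" by (auto simp: c_def)
    have "?fr \<zero> \<one> = \<zero>\<^bsub>?R\<^esub>" using N.localized_zero[OF S] by (simp add: localized_ring_simps)
    then show "\<zero> \<in> c I" using I.zero_closed by (simp add: c_def)
    show "x \<oplus> y \<in> c I" if xy: "x \<in> c I" "y \<in> c I" for x y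
    proof -
      have cc: "x \<in> carrier A" "y \<in> carrier A" "?fr x \<one> \<in> I" "?fr y \<one> \<in> I" using xy by (auto simp: c_def)
      have "?fr x \<one> \<oplus>\<^bsub>?R\<^esub> ?fr y \<one> = ?fr (x \<oplus> y) \<one>"
        using N.localized_add[OF S] cc S1 by (simp add: localized_ring_simps)
      then show ?thesis using I.a_closed[OF cc(3,4)] cc by (simp add: c_def)
    qed
    show "r \<otimes> x \<in> c I" if rx: "r \<in> carrier A" "x \<in> c I" for r x
    proof -
      have cc: "x \<in> carrier A" "?fr x \<one> \<in> I" using rx by (auto simp: c_def)
      have "?fr r \<one> \<otimes>\<^bsub>?R\<^esub> ?fr x \<one> = ?fr (r \<otimes> x) \<one>" using mult cc rx(1) S1 by simp
      then show ?thesis using I.I_l_closed[OF cc(2) frR[OF rx(1) S1]] cc rx(1) by (simp add: c_def)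
    qed
  qed
  have "d (c I) < d (c J)" if I: "ideal I ?R" and J: "ideal J ?R" and IJ: "I \<subset> J" for I J
  proof -
    obtain y where y: "y \<in> J" "y \<notin> I" using IJ by blast
    then have "y \<in> carrier ?R" using ideal.Icarr[OF J] by blast
    then obtain a s where as: "y = ?fr a s" "a \<in> carrier A" "s \<in> S"
      by (auto simp: localized_ring_simps N.localized_carrier_iff[OF S])
    have "?fr s \<one> \<otimes>\<^bsub>?R\<^esub> y = ?fr (s \<otimes> a) s" using mult as S1 Sc by simp
    also have "\<dots> = ?fr a \<one>"
      using as Sc S1 by (subst N.fraction_eq_iff[OF S]) (auto intro!: bexI[of _ "\<one>"])
    finally have "?fr a \<one> \<in> J" using ideal.I_l_closed[OF J y(1) frR[OF Sc[OF as(3)] S1]] by simp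
    moreover have "?fr a \<one> \<notin> I"
    proof
      assume "?fr a \<one> \<in> I"
      then have "?fr \<one> s \<otimes>\<^bsub>?R\<^esub> ?fr a \<one> \<in> I"
        using ideal.I_l_closed[OF I _ frR[OF A.one_closed as(3)]] by blast
      then show False using mult as S1 Sc y by simp
    qed
    ultimately have "a \<in> c J" "a \<notin> c I" using as by (auto simp: c_def)
    moreover have "c I \<subseteq> c J" using IJ by (auto simp: c_def)
    ultimately show ?thesis using d c[OF I] c[OF J] unfolding length_function_def by blast
  qed
  then have "length_function ?R (\<lambda>I. d (c I))" by (simp add: length_function_def)
  then show ?thesis by blast
qed

lemma (in primeideal) multiplicative_set_complement: "multiplicative_set R (carrier R - I)"
  using I_prime one_imp_carrier I_notcarr by (auto simp: multiplicative_set_def)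

text \<open>
  Localize at the maximal ideal \<open>(I : r b)\<close>; the image of \<open>r b\<close> does not lie in the extension of
  \<open>I\<close>. A fraction that kills the extension of \<open>I\<close> but not \<open>r b\<close> is moved back to \<open>A\<close> with the
  idempotent that cuts out the local factor.
\<close>

lemma gorenstein_double_annihilator:
  fixes A (structure)
  assumes A: "cring A" and d: "length_function A d"
    and gor: "\<And>P. primeideal P A \<Longrightarrow> gorenstein_local_ring (localized_ring A (carrier A - P))"
    and I: "ideal I A" and b: "b \<in> carrier A" "b \<notin> I"
  obtains x where "x \<in> carrier A" "\<And>i. i \<in> I \<Longrightarrow> x \<otimes> i = \<zero>" "x \<otimes> b \<noteq> \<zero>"
proof -
  interpret A: cring A by fact
  interpret N: module A "self_module A" by (rule A.module_self_module)
  interpret I: ideal I A by fact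
  obtain r where r: "r \<in> carrier A" "r \<otimes> b \<notin> I" "maximalideal (ideal_colon A I (r \<otimes> b)) A"
    using A.exists_multiple_with_maximal_colon[OF d I b] by blast
  let ?b = "r \<otimes> b" and ?P = "ideal_colon A I (r \<otimes> b)"
  have bc: "?b \<in> carrier A" using r b by simp
  have P: "primeideal ?P A" by (rule A.maximalideal_prime[OF r(3)])
  define S where "S = carrier A - ?P"
  have S: "multiplicative_set A S" unfolding S_def by (rule primeideal.multiplicative_set_complement[OF P])
  let ?R = "localized_ring A S"
  have gorR: "gorenstein_local_ring ?R" using gor[OF P] by (simp add: S_def)
  then have R: "cring ?R" by (simp add: gorenstein_local_ring_def local_ring_def)
  interpret R: cring ?R by fact
  obtain d' where d': "length_function ?R d'" using localization_length_function[OF A d S R] by blast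
  let ?fr = "fraction A S (self_module A)"
  have Sc: "s \<in> carrier A" if "s \<in> S" for s using S that by (auto simp: multiplicative_set_def)
  have S1: "\<one> \<in> S" using S by (simp add: multiplicative_set_def)
  have SS: "s \<otimes> t \<in> S" if "s \<in> S" "t \<in> S" for s t using S that by (simp add: multiplicative_set_def)
  have frR: "?fr a s \<in> carrier ?R" if "a \<in> carrier A" "s \<in> S" for a s
    using that by (auto simp: localized_ring_simps N.localized_carrier_iff[OF S])
  have frE: "\<exists>a s. y = ?fr a s \<and> a \<in> carrier A \<and> s \<in> S" if "y \<in> carrier ?R" for y
    using that by (simp add: localized_ring_simps N.localized_carrier_iff[OF S])
  have mult: "?fr a s \<otimes>\<^bsub>?R\<^esub> ?fr b t = ?fr (a \<otimes> b) (s \<otimes> t)"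
    if "a \<in> carrier A" "b \<in> carrier A" "s \<in> S" "t \<in> S" for a b s t
    using N.localized_smult[OF S] that by (simp add: localized_ring_simps)
  have add: "?fr a s \<oplus>\<^bsub>?R\<^esub> ?fr b t = ?fr (t \<otimes> a \<oplus> s \<otimes> b) (s \<otimes> t)"
    if "a \<in> carrier A" "b \<in> carrier A" "s \<in> S" "t \<in> S" for a b s t
    using N.localized_add[OF S] that by (simp add: localized_ring_simps)
  have zero: "\<zero>\<^bsub>?R\<^esub> = ?fr \<zero> \<one>" using N.localized_zero[OF S] by (simp add: localized_ring_simps)
  have eq0: "?fr a s = \<zero>\<^bsub>?R\<^esub> \<longleftrightarrow> (\<exists>u\<in>S. u \<otimes> a = \<zero>)" if "a \<in> carrier A" "s \<in> S" for a s
  proof -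
    have "?fr a s = \<zero>\<^bsub>?R\<^esub> \<longleftrightarrow> (\<exists>u\<in>S. (u \<otimes> s) \<otimes> \<zero> = (u \<otimes> \<one>) \<otimes> a)"
      unfolding zero using that S1 by (subst N.fraction_eq_iff[OF S]) auto
    also have "\<dots> \<longleftrightarrow> (\<exists>u\<in>S. u \<otimes> a = \<zero>)" using that Sc by (intro bex_cong refl) auto
    finally show ?thesis .
  qed
  define J where "J = {?fr i s | i s. i \<in> I \<and> s \<in> S}"
  have J: "ideal J ?R"
  proof (rule R.ideal_criterion)
    show "J \<subseteq> carrier ?R" using frR I.Icarr by (auto simp: J_def)
    show "\<zero>\<^bsub>?R\<^esub> \<in> J" using zero S1 I.zero_closed unfolding J_def by blast
  next
    fix x y assume "x \<in> J" "y \<in> J"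
    then obtain i s j t where 1: "x = ?fr i s" "i \<in> I" "s \<in> S" "y = ?fr j t" "j \<in> I" "t \<in> S"
      by (auto simp: J_def)
    then have "x \<oplus>\<^bsub>?R\<^esub> y = ?fr (t \<otimes> i \<oplus> s \<otimes> j) (s \<otimes> t)" using add I.Icarr by simp
    moreover have "t \<otimes> i \<oplus> s \<otimes> j \<in> I" using 1 Sc by (simp add: I.I_l_closed)
    moreover have "s \<otimes> t \<in> S" using 1 SS by simp
    ultimately show "x \<oplus>\<^bsub>?R\<^esub> y \<in> J" unfolding J_def by blast
  next
    fix q x assume q: "q \<in> carrier ?R" and "x \<in> J"
    then obtain i s where 1: "x = ?fr i s" "i \<in> I" "s \<in> S" by (auto simp: J_def)
    obtain a t where 2: "q = ?fr a t" "a \<in> carrier A" "t \<in> S" using frE[OF q] by blast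
    have "q \<otimes>\<^bsub>?R\<^esub> x = ?fr (a \<otimes> i) (t \<otimes> s)" using mult 1 2 I.Icarr by simp
    moreover have "a \<otimes> i \<in> I" "t \<otimes> s \<in> S" using 1 2 SS by (simp_all add: I.I_l_closed)
    ultimately show "q \<otimes>\<^bsub>?R\<^esub> x \<in> J" unfolding J_def by blast
  qed
  have bJ: "?fr ?b \<one> \<notin> J"
  proof
    assume "?fr ?b \<one> \<in> J"
    then obtain i s where ij: "?fr ?b \<one> = ?fr i s" "i \<in> I" "s \<in> S" by (auto simp: J_def)
    then obtain u where u: "u \<in> S" "(u \<otimes> \<one>) \<otimes> i = (u \<otimes> s) \<otimes> ?b"
      using N.fraction_eq_iff[OF S, of ?b i "\<one>" s] bc S1 I.Icarr by auto
    have "(u \<otimes> \<one>) \<otimes> i \<in> I" using u(1) ij Sc by (simp add: I.I_l_closed)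
    then have "u \<otimes> s \<in> ?P" unfolding u(2) using u(1) ij(3) Sc by (simp add: ideal_colon_def)
    then show False using SS[OF u(1) ij(3)] by (simp add: S_def)
  qed
  obtain z where z: "z \<in> carrier ?R" "\<And>j. j \<in> J \<Longrightarrow> z \<otimes>\<^bsub>?R\<^esub> j = \<zero>\<^bsub>?R\<^esub>" "z \<otimes>\<^bsub>?R\<^esub> ?fr ?b \<one> \<noteq> \<zero>\<^bsub>?R\<^esub>"
    using gorenstein_double_annihilator_local[OF gorR d' J frR[OF bc S1] bJ] by blast
  obtain y t where y: "z = ?fr y t" "y \<in> carrier A" "t \<in> S" using frE[OF z(1)] by blast
  obtain e s where e: "e \<in> carrier A" "e \<otimes> e = e" "s \<in> S" "s \<otimes> e = s"
    "\<And>t. t \<in> S \<Longrightarrow> \<exists>h\<in>carrier A. e = h \<otimes> t"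
    using A.exists_localizing_idempotent[OF d S] by blast
  have kill: "(e \<otimes> y) \<otimes> i = \<zero>" if i: "i \<in> I" for i
  proof -
    have ic: "i \<in> carrier A" using i I.Icarr by simp
    have "?fr i \<one> \<in> J" using i S1 unfolding J_def by blast
    then have "?fr (y \<otimes> i) t = \<zero>\<^bsub>?R\<^esub>" using z(2) mult y ic S1 Sc by fastforce
    then obtain u where u: "u \<in> S" "u \<otimes> (y \<otimes> i) = \<zero>" using eq0 y ic by auto
    obtain h where h: "h \<in> carrier A" "e = h \<otimes> u" using e(5)[OF u(1)] by blast
    have "(e \<otimes> y) \<otimes> i = h \<otimes> (u \<otimes> (y \<otimes> i))"
      unfolding h(2) using h(1) u(1) y ic Sc by (simp add: A.m_assoc)
    then show ?thesis using u h by simp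
  qed
  have nkill: "(e \<otimes> y) \<otimes> ?b \<noteq> \<zero>"
  proof
    assume 0: "(e \<otimes> y) \<otimes> ?b = \<zero>"
    have "s \<otimes> (y \<otimes> ?b) = (s \<otimes> e) \<otimes> (y \<otimes> ?b)" using e(4) by simp
    also have "\<dots> = s \<otimes> ((e \<otimes> y) \<otimes> ?b)" using e(1,3) y bc Sc by (simp only: A.m_assoc A.m_closed)
    also have "\<dots> = \<zero>" using 0 e(3) Sc by simp
    finally have "?fr (y \<otimes> ?b) t = \<zero>\<^bsub>?R\<^esub>" using eq0 y bc e(3) by (auto simp del: A.m_assoc)
    then show False using z(3) mult y bc S1 Sc by simp
  qed
  show thesis
  proof (rule that)
    show "e \<otimes> y \<in> carrier A" using e y by simp
    show "\<And>i. i \<in> I \<Longrightarrow> (e \<otimes> y) \<otimes> i = \<zero>" by (rule kill)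
    show "(e \<otimes> y) \<otimes> b \<noteq> \<zero>"
    proof
      assume 0: "(e \<otimes> y) \<otimes> b = \<zero>"
      have "(e \<otimes> y) \<otimes> ?b = r \<otimes> ((e \<otimes> y) \<otimes> b)"
        using e(1) y(2) r(1) b(1) by (simp add: A.m_ac)
      then show False using 0 r(1) nkill by simp
    qed
  qed
qed


section \<open>Line bundles over an Artinian ring\<close>

definition free_generator :: "('a, 'r) ring_scheme \<Rightarrow> ('a, 'm, 'e) module_scheme \<Rightarrow> 'm \<Rightarrow> bool" where
  "free_generator R M x \<longleftrightarrow> x \<in> carrier M \<and> bij_betw (\<lambda>a. a \<odot>\<^bsub>M\<^esub> x) (carrier R) (carrier M)"

text \<open>\<open>eM\<close> is a free module over the ring \<open>eR\<close>, with generator \<open>x\<close>.\<close>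

definition free_at :: "('a, 'r) ring_scheme \<Rightarrow> ('a, 'm, 'e) module_scheme \<Rightarrow> 'a \<Rightarrow> 'm \<Rightarrow> bool" where
  "free_at R M e x \<longleftrightarrow> e \<in> carrier R \<and> e \<otimes>\<^bsub>R\<^esub> e = e \<and> x \<in> carrier M \<and> e \<odot>\<^bsub>M\<^esub> x = x \<and>
     (\<forall>a\<in>carrier R. a \<odot>\<^bsub>M\<^esub> x = \<zero>\<^bsub>M\<^esub> \<longrightarrow> a \<otimes>\<^bsub>R\<^esub> e = \<zero>\<^bsub>R\<^esub>) \<and>
     (\<forall>l\<in>carrier M. \<exists>a\<in>carrier R. e \<odot>\<^bsub>M\<^esub> l = a \<odot>\<^bsub>M\<^esub> x)"

context module
begin

lemma free_atD:
  assumes "free_at R M e x"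
  shows "e \<in> carrier R" "e \<otimes> e = e" "x \<in> carrier M" "e \<odot>\<^bsub>M\<^esub> x = x"
    "\<And>a. a \<in> carrier R \<Longrightarrow> a \<odot>\<^bsub>M\<^esub> x = \<zero>\<^bsub>M\<^esub> \<Longrightarrow> a \<otimes> e = \<zero>"
    "\<And>l. l \<in> carrier M \<Longrightarrow> \<exists>a\<in>carrier R. e \<odot>\<^bsub>M\<^esub> l = a \<odot>\<^bsub>M\<^esub> x"
  using assms by (auto simp: free_at_def)

text \<open>
  The join of the idempotents \<open>e\<close> and \<open>f\<close> is \<open>e + (1 - e) f\<close>, a sum of two orthogonal idempotents
  of which the second one lies below \<open>f\<close>.
\<close>

lemma free_at_join:
  assumes e: "free_at R M e x" and f: "free_at R M f y"
  defines "e' \<equiv> \<one> \<ominus> e"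
  shows "free_at R M (e \<oplus> e' \<otimes> f) (x \<oplus>\<^bsub>M\<^esub> e' \<odot>\<^bsub>M\<^esub> y)"
proof -
  note e = free_atD[OF e] and f = free_atD[OF f]
  let ?g = "e \<oplus> e' \<otimes> f" and ?z = "x \<oplus>\<^bsub>M\<^esub> e' \<odot>\<^bsub>M\<^esub> y"
  have e': "e' \<in> carrier R" using e by (simp add: e'_def)
  have ee': "e \<otimes> e' = \<zero>"
    unfolding e'_def using e(1,2) by (simp add: R.minus_eq R.r_distr R.r_minus R.r_neg)
  then have e'e: "e' \<otimes> e = \<zero>" using e e' by (simp add: m_comm)
  have e'e': "e' \<otimes> e' = e'"
  proof -
    have "e' \<otimes> e' = (\<one> \<ominus> e) \<otimes> e'" by (simp add: e'_def)
    also have "\<dots> = e'" using e(1) e' ee' by (simp add: R.minus_eq R.l_distr R.l_minus)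
    finally show ?thesis .
  qed
  have gc: "?g \<in> carrier R" and zc: "?z \<in> carrier M" using e(1,3) e' f(1,3) by simp_all
  have eg: "e \<otimes> ?g = e"
  proof -
    have "e \<otimes> ?g = e \<otimes> e \<oplus> (e \<otimes> e') \<otimes> f" using e(1) e' f(1) by (simp add: r_distr m_assoc)
    then show ?thesis using e(1,2) f(1) ee' by simp
  qed
  have e'g: "e' \<otimes> ?g = e' \<otimes> f"
  proof -
    have "e' \<otimes> ?g = e' \<otimes> e \<oplus> (e' \<otimes> e') \<otimes> f" using e(1) e' f(1) by (simp add: r_distr m_assoc)
    then show ?thesis using e(1) e' f(1) e'e e'e' by simp
  qed
  have ez: "e \<odot>\<^bsub>M\<^esub> ?z = x"
  proof -
    have "e \<odot>\<^bsub>M\<^esub> ?z = e \<odot>\<^bsub>M\<^esub> x \<oplus>\<^bsub>M\<^esub> (e \<otimes> e') \<odot>\<^bsub>M\<^esub> y"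
      using e(1,3) e' f(3) by (simp add: smult_r_distr smult_assoc1)
    then show ?thesis using e(3,4) ee' f(3) by simp
  qed
  have e'z: "e' \<odot>\<^bsub>M\<^esub> ?z = e' \<odot>\<^bsub>M\<^esub> y"
  proof -
    have "e' \<odot>\<^bsub>M\<^esub> ?z = e' \<odot>\<^bsub>M\<^esub> (e \<odot>\<^bsub>M\<^esub> x) \<oplus>\<^bsub>M\<^esub> (e' \<otimes> e') \<odot>\<^bsub>M\<^esub> y"
      using e(1,3) e' f(3) by (simp only: e(4) smult_r_distr smult_assoc1 smult_closed)
    also have "e' \<odot>\<^bsub>M\<^esub> (e \<odot>\<^bsub>M\<^esub> x) = \<zero>\<^bsub>M\<^esub>" using e(1,3) e' e'e by (simp add: smult_assoc1[symmetric])
    finally show ?thesis using e' f(3) e'e' by simp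
  qed
  have "?g \<otimes> ?g = e \<otimes> ?g \<oplus> f \<otimes> (e' \<otimes> ?g)" using e(1) e' f(1) gc by (simp add: l_distr m_ac)
  also have "\<dots> = e \<oplus> e' \<otimes> (f \<otimes> f)" unfolding eg e'g using e' f(1) by (simp add: m_ac)
  finally have gg: "?g \<otimes> ?g = ?g" using f(2) by simp
  have "?g \<odot>\<^bsub>M\<^esub> ?z = e \<odot>\<^bsub>M\<^esub> ?z \<oplus>\<^bsub>M\<^esub> f \<odot>\<^bsub>M\<^esub> (e' \<odot>\<^bsub>M\<^esub> ?z)"
    using e(1) e' f(1) zc by (simp add: smult_l_distr smult_assoc1[symmetric] m_comm)
  also have "\<dots> = x \<oplus>\<^bsub>M\<^esub> e' \<odot>\<^bsub>M\<^esub> (f \<odot>\<^bsub>M\<^esub> y)"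
    unfolding ez e'z using e' f(1,3) by (simp add: smult_assoc1[symmetric] m_comm)
  finally have gz: "?g \<odot>\<^bsub>M\<^esub> ?z = ?z" using f(4) by simp
  have inj: "a \<otimes> ?g = \<zero>" if a: "a \<in> carrier R" "a \<odot>\<^bsub>M\<^esub> ?z = \<zero>\<^bsub>M\<^esub>" for a
  proof -
    have "(a \<otimes> e) \<odot>\<^bsub>M\<^esub> x = (a \<otimes> e) \<odot>\<^bsub>M\<^esub> (e \<odot>\<^bsub>M\<^esub> ?z)" by (simp add: ez)
    also have "\<dots> = e \<odot>\<^bsub>M\<^esub> (a \<odot>\<^bsub>M\<^esub> ?z)"
    proof -
      have "(a \<otimes> e) \<odot>\<^bsub>M\<^esub> (e \<odot>\<^bsub>M\<^esub> ?z) = (a \<otimes> (e \<otimes> e)) \<odot>\<^bsub>M\<^esub> ?z"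
        using a(1) e(1) zc by (simp add: smult_assoc1[symmetric] m_assoc del: M.add.m_closed)
      also have "\<dots> = (e \<otimes> a) \<odot>\<^bsub>M\<^esub> ?z" using a(1) e(1,2) by (simp add: m_comm)
      finally show ?thesis using a(1) e(1) zc by (simp add: smult_assoc1)
    qed
    finally have 1: "a \<otimes> e = \<zero>" using e(5)[of "a \<otimes> e"] a e(1,2) by (simp add: m_assoc)
    have "(a \<otimes> e') \<odot>\<^bsub>M\<^esub> y = a \<odot>\<^bsub>M\<^esub> (e' \<odot>\<^bsub>M\<^esub> ?z)"
      unfolding e'z using a(1) e' f(3) by (simp add: smult_assoc1)
    also have "\<dots> = e' \<odot>\<^bsub>M\<^esub> (a \<odot>\<^bsub>M\<^esub> ?z)"
      using a(1) e' zc by (simp add: smult_assoc1[symmetric] m_comm)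
    finally have 2: "(a \<otimes> e') \<otimes> f = \<zero>" using f(5)[of "a \<otimes> e'"] a e' by simp
    show ?thesis using 1 2 a(1) e(1) e' f(1) by (simp add: r_distr m_assoc)
  qed
  have surj: "\<exists>a\<in>carrier R. ?g \<odot>\<^bsub>M\<^esub> l = a \<odot>\<^bsub>M\<^esub> ?z" if l: "l \<in> carrier M" for l
  proof -
    obtain a where a: "a \<in> carrier R" "e \<odot>\<^bsub>M\<^esub> l = a \<odot>\<^bsub>M\<^esub> x" using e(6)[OF l] by blast
    obtain b where b: "b \<in> carrier R" "f \<odot>\<^bsub>M\<^esub> l = b \<odot>\<^bsub>M\<^esub> y" using f(6)[OF l] by blast
    have "?g \<odot>\<^bsub>M\<^esub> l = e \<odot>\<^bsub>M\<^esub> l \<oplus>\<^bsub>M\<^esub> e' \<odot>\<^bsub>M\<^esub> (f \<odot>\<^bsub>M\<^esub> l)"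
      using e(1) e' f(1) l by (simp add: smult_l_distr smult_assoc1)
    also have "\<dots> = a \<odot>\<^bsub>M\<^esub> (e \<odot>\<^bsub>M\<^esub> ?z) \<oplus>\<^bsub>M\<^esub> b \<odot>\<^bsub>M\<^esub> (e' \<odot>\<^bsub>M\<^esub> ?z)"
      unfolding a(2) b(2) ez e'z using b e' f(3) by (simp add: smult_assoc1[symmetric] m_comm)
    also have "\<dots> = (a \<otimes> e \<oplus> b \<otimes> e') \<odot>\<^bsub>M\<^esub> ?z"
      using a(1) b(1) e(1) e' zc by (simp add: smult_l_distr smult_assoc1)
    finally show ?thesis using a(1) b(1) e(1) e' by blast
  qed
  show ?thesis unfolding free_at_def using gc gg zc gz inj surj by blast
qed

lemma free_at_zero: "free_at R M \<zero> \<zero>\<^bsub>M\<^esub>"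
  by (auto simp: free_at_def)

lemma free_at_one_imp_free_generator:
  assumes "free_at R M \<one> x" shows "free_generator R M x"
proof -
  note x = free_atD[OF assms]
  have "inj_on (\<lambda>a. a \<odot>\<^bsub>M\<^esub> x) (carrier R)"
  proof (rule inj_onI)
    fix a b assume ab: "a \<in> carrier R" "b \<in> carrier R" "a \<odot>\<^bsub>M\<^esub> x = b \<odot>\<^bsub>M\<^esub> x"
    then have "(a \<ominus> b) \<odot>\<^bsub>M\<^esub> x = \<zero>\<^bsub>M\<^esub>" using x(3)
      by (simp add: R.minus_eq smult_l_distr smult_l_minus M.r_neg)
    then have "a \<ominus> b = \<zero>" using x(5)[of "a \<ominus> b"] ab by simp
    then show "a = b" using ab by simp
  qed
  moreover have "(\<lambda>a. a \<odot>\<^bsub>M\<^esub> x) ` carrier R = carrier M"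
  proof
    show "carrier M \<subseteq> (\<lambda>a. a \<odot>\<^bsub>M\<^esub> x) ` carrier R"
    proof
      fix l assume l: "l \<in> carrier M"
      then obtain a where "a \<in> carrier R" "\<one> \<odot>\<^bsub>M\<^esub> l = a \<odot>\<^bsub>M\<^esub> x" using x(6) by blast
      then show "l \<in> (\<lambda>a. a \<odot>\<^bsub>M\<^esub> x) ` carrier R" using l by simp
    qed
  qed (use x in auto)
  ultimately show ?thesis using x(3) by (simp add: free_generator_def bij_betw_def)
qed

text \<open>
  A trivialization of \<open>S\<^sup>-\<^sup>1M\<close> is a trivialization of \<open>eM\<close>, where \<open>e\<close> is the idempotent that
  localizes at \<open>S\<close>. Its generator is \<open>e y\<close> if \<open>y/s\<close> corresponds to \<open>1\<close>.
\<close>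

lemma free_at_if_localization_free:
  assumes S: "multiplicative_set R S"
    and iso: "isomorphic_modules (localized_ring R S) (localized_module R S M) (localized_module R S (self_module R))"
    and e: "e \<in> carrier R" "e \<otimes> e = e" "\<And>t. t \<in> S \<Longrightarrow> \<exists>h\<in>carrier R. e = h \<otimes> t"
  shows "\<exists>x. free_at R M e x"
proof -
  interpret N: module R "self_module R" by (rule module_self_module)
  let ?LM = "localized_module R S M" and ?LN = "localized_module R S (self_module R)"
  let ?fr = "fraction R S (self_module R)" and ?fm = "fraction R S M"
  have Sc: "s \<in> carrier R" if "s \<in> S" for s using S that by (auto simp: multiplicative_set_def)
  have S1: "\<one> \<in> S" using S by (simp add: multiplicative_set_def)
  have SS: "s \<otimes> t \<in> S" if "s \<in> S" "t \<in> S" for s t using S that by (simp add: multiplicative_set_def)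
  obtain h where h: "h \<in> module_hom (localized_ring R S) ?LM ?LN" "bij_betw h (carrier ?LM) (carrier ?LN)"
    using iso by (auto simp: isomorphic_modules_def)
  have frc: "?fr a s \<in> carrier ?LN" if "a \<in> carrier R" "s \<in> S" for a s
    using that N.localized_carrier_iff[OF S] by auto
  have fmc: "?fm m s \<in> carrier ?LM" if "m \<in> carrier M" "s \<in> S" for m s
    using that localized_carrier_iff[OF S] by auto
  have hs: "h (?fr a s \<odot>\<^bsub>?LM\<^esub> q) = ?fr a s \<odot>\<^bsub>?LN\<^esub> h q" if "a \<in> carrier R" "s \<in> S" "q \<in> carrier ?LM" for a s q
    using module_hom_smult[OF h(1) _ that(3), of "?fr a s"] frc[OF that(1,2)] by (simp add: localized_ring_simps)
  have "?fr \<one> \<one> \<in> h ` carrier ?LM"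
    unfolding bij_betw_imp_surj_on[OF h(2)] by (rule frc[OF one_closed S1])
  then obtain q where q: "q \<in> carrier ?LM" "h q = ?fr \<one> \<one>" by (metis imageE)
  obtain y s where ys: "q = ?fm y s" "y \<in> carrier M" "s \<in> S"
    using q(1) localized_carrier_iff[OF S] by auto
  have hq: "h (?fm (a \<odot>\<^bsub>M\<^esub> y) (t \<otimes> s)) = ?fr a t" if "a \<in> carrier R" "t \<in> S" for a t
  proof -
    have "?fm (a \<odot>\<^bsub>M\<^esub> y) (t \<otimes> s) = ?fr a t \<odot>\<^bsub>?LM\<^esub> q"
      using localized_smult[OF S] that ys by simp
    then have "h (?fm (a \<odot>\<^bsub>M\<^esub> y) (t \<otimes> s)) = ?fr a t \<odot>\<^bsub>?LN\<^esub> ?fr \<one> \<one>" using hs that q by simp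
    also have "\<dots> = ?fr a t" using N.localized_smult[OF S, of a t \<one> \<one>] that S1 Sc by simp
    finally show ?thesis .
  qed
  have inj: "a \<otimes> e = \<zero>" if a: "a \<in> carrier R" "a \<odot>\<^bsub>M\<^esub> (e \<odot>\<^bsub>M\<^esub> y) = \<zero>\<^bsub>M\<^esub>" for a
  proof -
    have "(a \<otimes> e) \<odot>\<^bsub>M\<^esub> y = \<zero> \<odot>\<^bsub>M\<^esub> y" using a e(1) ys(2) by (simp add: smult_assoc1)
    then have "?fr (a \<otimes> e) \<one> = ?fr \<zero> \<one>"
      using hq[of "a \<otimes> e" \<one>] hq[of \<zero> \<one>] a(1) e(1) S1 by simp
    then obtain u where u: "u \<in> S" "(u \<otimes> \<one>) \<otimes> \<zero> = (u \<otimes> \<one>) \<otimes> (a \<otimes> e)"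
      using N.fraction_eq_iff[OF S, of "a \<otimes> e" \<zero> \<one> \<one>] a(1) e(1) S1 by auto
    then have u0: "u \<otimes> (a \<otimes> e) = \<zero>" using Sc by simp
    obtain g where g: "g \<in> carrier R" "e = g \<otimes> u" using e(3)[OF u(1)] by blast
    have "a \<otimes> e = a \<otimes> e \<otimes> e" using a(1) e(1,2) by (simp add: m_assoc)
    also have "\<dots> = (g \<otimes> u) \<otimes> (a \<otimes> e)" using a(1) e(1) by (subst (2) g(2)) (simp add: m_comm g(1) Sc u(1))
    also have "\<dots> = g \<otimes> (u \<otimes> (a \<otimes> e))" using a(1) e(1) g(1) Sc[OF u(1)] by (simp only: m_assoc m_closed)
    finally show ?thesis using u0 g(1) by simp
  qed
  have surj: "\<exists>a\<in>carrier R. e \<odot>\<^bsub>M\<^esub> l = a \<odot>\<^bsub>M\<^esub> (e \<odot>\<^bsub>M\<^esub> y)" if l: "l \<in> carrier M" for l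
  proof -
    have "h (?fm l \<one>) \<in> carrier ?LN" using module_hom_closed[OF h(1)] fmc[OF l S1] by blast
    then obtain a t where at: "h (?fm l \<one>) = ?fr a t" "a \<in> carrier R" "t \<in> S"
      using N.localized_carrier_iff[OF S] by auto
    have ayc: "a \<odot>\<^bsub>M\<^esub> y \<in> carrier M" "t \<otimes> s \<in> S" using at ys SS by auto
    have "h (?fm l \<one>) = h (?fm (a \<odot>\<^bsub>M\<^esub> y) (t \<otimes> s))" using hq at by simp
    then have "?fm l \<one> = ?fm (a \<odot>\<^bsub>M\<^esub> y) (t \<otimes> s)"
      using h(2) fmc[OF l S1] fmc[OF ayc] unfolding bij_betw_def by (meson inj_onD)
    then obtain u where u: "u \<in> S" "(u \<otimes> \<one>) \<odot>\<^bsub>M\<^esub> (a \<odot>\<^bsub>M\<^esub> y) = (u \<otimes> (t \<otimes> s)) \<odot>\<^bsub>M\<^esub> l"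
      using fraction_eq_iff[OF S l ayc(1) S1 ayc(2)] by blast
    have w: "u \<otimes> (t \<otimes> s) \<in> S" using u(1) ayc(2) SS by simp
    obtain g where g: "g \<in> carrier R" "e = g \<otimes> (u \<otimes> (t \<otimes> s))" using e(3)[OF w] by blast
    have "e \<odot>\<^bsub>M\<^esub> l = g \<odot>\<^bsub>M\<^esub> ((u \<otimes> (t \<otimes> s)) \<odot>\<^bsub>M\<^esub> l)"
      by (subst g(2)) (simp only: smult_assoc1 g(1) Sc[OF w] l)
    then have el: "e \<odot>\<^bsub>M\<^esub> l = g \<odot>\<^bsub>M\<^esub> ((u \<otimes> \<one>) \<odot>\<^bsub>M\<^esub> (a \<odot>\<^bsub>M\<^esub> y))" by (simp only: u(2))
    have "e \<odot>\<^bsub>M\<^esub> l = e \<odot>\<^bsub>M\<^esub> (e \<odot>\<^bsub>M\<^esub> l)" using e(1,2) l by (simp add: smult_assoc1[symmetric])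
    also have "\<dots> = (g \<otimes> u \<otimes> a) \<odot>\<^bsub>M\<^esub> (e \<odot>\<^bsub>M\<^esub> y)"
      unfolding el using g(1) u(1) at(2) ys(2) e(1) Sc by (simp add: smult_assoc1[symmetric] m_ac)
    finally show ?thesis using g(1) Sc[OF u(1)] at(2) by (intro bexI[of _ "g \<otimes> u \<otimes> a"]) auto
  qed
  have "free_at R M e (e \<odot>\<^bsub>M\<^esub> y)"
    unfolding free_at_def using e(1,2) ys(2) inj surj by (simp add: smult_assoc1[symmetric])
  then show ?thesis by blast
qed

end

text \<open>
  Take an idempotent \<open>e\<close> with \<open>eL\<close> free for which \<open>(e)\<close> is as large as possible. If \<open>e \<noteq> 1\<close>, then a
  maximal ideal contains \<open>(e)\<close>, and joining \<open>e\<close> with a trivializing idempotent outside of that ideal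
  enlarges \<open>(e)\<close>.
\<close>

lemma line_bundle_free_generator:
  fixes A (structure)
  assumes d: "length_function A d" and L: "line_bundle A L"
  shows "\<exists>x. free_generator A L x"
proof -
  interpret L: module A L using L by (simp add: line_bundle_def)
  let ?I = "ideal_adjoin A {\<zero>}"
  define Q where "Q e \<longleftrightarrow> (\<exists>x. free_at A L e x)" for e
  have Qc: "e \<in> carrier A" "e \<otimes> e = e" if "Q e" for e using that L.free_atD(1,2) by (auto simp: Q_def)
  note id = L.ideal_adjoin_ideal[OF L.R.zeroideal]
  note up = L.ideal_adjoin_upper(2)[OF L.R.zeroideal]
  have Q0: "Q \<zero>" using L.free_at_zero by (auto simp: Q_def)
  have bound: "d (?I e) \<le> d (carrier A)" if "e \<in> carrier A" for e
    using d id[OF that] L.R.oneideal ideal.Icarr[OF id[OF that]]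
    unfolding length_function_def by (metis less_imp_le order_refl psubsetI subsetI)
  obtain e where e: "Q e" and max: "\<And>f. Q f \<Longrightarrow> d (?I f) \<le> d (?I e)"
    using ex_has_greatest_nat[of Q "\<zero>" "\<lambda>e. d (?I e)" "Suc (d (carrier A))"] Q0 bound Qc(1)
    by (metis le_imp_less_Suc)
  have ec: "e \<in> carrier A" using Qc e by simp
  have "e = \<one>"
  proof (rule ccontr)
    assume ne: "e \<noteq> \<one>"
    have "\<one> \<notin> ?I e"
    proof
      assume "\<one> \<in> ?I e"
      then obtain i y where iy: "\<one> = i \<oplus> y \<otimes> e" "i = \<zero>" "y \<in> carrier A"
        unfolding ideal_adjoin_def by blast
      then have y1: "y \<otimes> e = \<one>" using ec by simp
      have "e = (y \<otimes> e) \<otimes> e" using y1 ec by simp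
      also have "\<dots> = y \<otimes> e" using iy(3) ec Qc(2)[OF e] by (simp add: L.m_assoc)
      finally show False using y1 ne by simp
    qed
    then obtain P where P: "maximalideal P A" "?I e \<subseteq> P"
      using L.exists_maximalideal_above[OF d id[OF ec]] by blast
    interpret P: primeideal P A by (rule L.maximalideal_prime[OF P(1)])
    obtain f where f: "f \<in> carrier A" "f \<notin> P"
      "isomorphic_modules (localized_ring A {f [^] n | n :: nat. True})
         (localized_module A {f [^] n | n :: nat. True} L)
         (localized_module A {f [^] n | n :: nat. True} (self_module A))"
      using L P.primeideal unfolding line_bundle_def Let_def by blast
    define S where "S = {f [^] n | n :: nat. True}"
    have S: "multiplicative_set A S"
      unfolding multiplicative_set_def
    proof (intro conjI ballI subsetI)
      show "x \<in> carrier A" if "x \<in> S" for x using that f by (auto simp: S_def)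
      have "f [^] (0::nat) = \<one>" by simp
      then show "\<one> \<in> S" unfolding S_def by (metis (mono_tags, lifting) mem_Collect_eq)
      show "x \<otimes> y \<in> S" if xy: "x \<in> S" "y \<in> S" for x y
      proof -
        obtain m n :: nat where "x = f [^] m" "y = f [^] n" using xy by (auto simp: S_def)
        then have "x \<otimes> y = f [^] (m + n)" using f(1) by (simp add: L.R.nat_pow_mult)
        then show ?thesis unfolding S_def by blast
      qed
    qed
    have SP: "x \<notin> P" if x: "x \<in> S" for x
    proof -
      have "f [^] n \<notin> P" for n :: nat
      proof (induction n)
        case 0
        show ?case using P.one_imp_carrier P.I_notcarr by auto
      next
        case (Suc n)
        then show ?case using P.I_prime[of "f [^] n" f] f by auto
      qed
      then show ?thesis using x by (auto simp: S_def)
    qed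
    obtain e' s where e': "e' \<in> carrier A" "e' \<otimes> e' = e'" "s \<in> S" "s \<otimes> e' = s"
      "\<And>t. t \<in> S \<Longrightarrow> \<exists>h\<in>carrier A. e' = h \<otimes> t"
      using L.exists_localizing_idempotent[OF d S] by blast
    have e'P: "e' \<notin> P"
    proof
      assume e'P: "e' \<in> P"
      have "s \<in> carrier A" using e'(3) S by (auto simp: multiplicative_set_def)
      then have "s \<otimes> e' \<in> P" using P.I_l_closed[OF e'P] by blast
      then show False using e'(4) SP[OF e'(3)] by simp
    qed
    obtain x' where x': "free_at A L e' x'"
      using L.free_at_if_localization_free[OF S f(3)[folded S_def] e'(1,2,5)] by blast
    obtain x where x: "free_at A L e x" using e by (auto simp: Q_def)
    let ?g = "e \<oplus> (\<one> \<ominus> e) \<otimes> e'"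
    have g: "Q ?g" using L.free_at_join[OF x x'] by (auto simp: Q_def)
    have gc: "?g \<in> carrier A" using g Qc by simp
    have ee: "e \<otimes> e = e" using Qc e by simp
    have "e \<otimes> (\<one> \<ominus> e) = \<zero>"
      using ec ee by (simp add: L.R.minus_eq L.R.r_distr L.R.r_minus L.R.r_neg)
    then have "e \<otimes> ((\<one> \<ominus> e) \<otimes> e') = \<zero>" using ec e'(1) by (simp add: L.R.m_assoc[symmetric])
    then have eg: "e \<otimes> ?g = e" using ec e'(1) ee by (simp add: L.R.r_distr)
    have e'g: "e' \<otimes> ?g = e'"
    proof -
      have "e' \<otimes> ?g = e' \<otimes> e \<oplus> (\<one> \<ominus> e) \<otimes> (e' \<otimes> e')"
        using ec e'(1) by (simp add: L.R.r_distr L.R.m_lcomm)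
      also have "\<dots> = e' \<otimes> e \<oplus> (e' \<ominus> e \<otimes> e')"
        using ec e'(1,2) by (simp add: L.R.minus_eq L.R.l_distr L.R.l_minus)
      also have "\<dots> = e'"
        using ec e'(1) by (simp add: L.R.minus_eq L.R.m_comm[of e' e] L.R.a_lcomm L.R.r_neg)
      finally show ?thesis .
    qed
    have eI: "e \<in> ?I ?g" using ideal.I_l_closed[OF id[OF gc] up[OF gc] ec] eg by simp
    have e'I: "e' \<in> ?I ?g" using ideal.I_l_closed[OF id[OF gc] up[OF gc] e'(1)] e'g by simp
    have "{\<zero>} \<subseteq> ?I ?g" by (rule L.ideal_adjoin_upper(1)[OF L.R.zeroideal gc])
    then have "?I e \<subseteq> ?I ?g" by (rule L.ideal_adjoin_least[OF id[OF gc] _ eI])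
    moreover have "e' \<notin> ?I e" using e'P P(2) by blast
    ultimately have "?I e \<subset> ?I ?g" using e'I by blast
    then have "d (?I e) < d (?I ?g)" using d id[OF ec] id[OF gc] by (simp add: length_function_def)
    then show False using max[OF g] by simp
  qed
  then show ?thesis using e L.free_at_one_imp_free_generator by (auto simp: Q_def)
qed


section \<open>Linear forms on finite-dimensional spaces\<close>

definition linear_form_on ::
  "('k, 'z) ring_scheme \<Rightarrow> ('k, 'v, 'e) module_scheme \<Rightarrow> 'v set \<Rightarrow> ('v \<Rightarrow> 'k) \<Rightarrow> bool" where
  "linear_form_on k V U f \<longleftrightarrow> (\<forall>x\<in>U. f x \<in> carrier k) \<and>
     (\<forall>x\<in>U. \<forall>y\<in>U. f (x \<oplus>\<^bsub>V\<^esub> y) = f x \<oplus>\<^bsub>k\<^esub> f y) \<and>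
     (\<forall>c\<in>carrier k. \<forall>x\<in>U. f (c \<odot>\<^bsub>V\<^esub> x) = c \<otimes>\<^bsub>k\<^esub> f x)"

lemma linear_form_onI:
  assumes "\<And>x. x \<in> U \<Longrightarrow> f x \<in> carrier k"
    and "\<And>x y. \<lbrakk>x \<in> U; y \<in> U\<rbrakk> \<Longrightarrow> f (x \<oplus>\<^bsub>V\<^esub> y) = f x \<oplus>\<^bsub>k\<^esub> f y"
    and "\<And>c x. \<lbrakk>c \<in> carrier k; x \<in> U\<rbrakk> \<Longrightarrow> f (c \<odot>\<^bsub>V\<^esub> x) = c \<otimes>\<^bsub>k\<^esub> f x"
  shows "linear_form_on k V U f"
  using assms by (simp add: linear_form_on_def)

lemma linear_form_onD:
  assumes "linear_form_on k V U f"
  shows "\<And>x. x \<in> U \<Longrightarrow> f x \<in> carrier k"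
    and "\<And>x y. \<lbrakk>x \<in> U; y \<in> U\<rbrakk> \<Longrightarrow> f (x \<oplus>\<^bsub>V\<^esub> y) = f x \<oplus>\<^bsub>k\<^esub> f y"
    and "\<And>c x. \<lbrakk>c \<in> carrier k; x \<in> U\<rbrakk> \<Longrightarrow> f (c \<odot>\<^bsub>V\<^esub> x) = c \<otimes>\<^bsub>k\<^esub> f x"
  using assms by (simp_all add: linear_form_on_def)

lemma submodule_criterion:
  assumes "module R M" "N \<subseteq> carrier M" "\<zero>\<^bsub>M\<^esub> \<in> N"
    and "\<And>x y. \<lbrakk>x \<in> N; y \<in> N\<rbrakk> \<Longrightarrow> x \<oplus>\<^bsub>M\<^esub> y \<in> N"
    and "\<And>c x. \<lbrakk>c \<in> carrier R; x \<in> N\<rbrakk> \<Longrightarrow> c \<odot>\<^bsub>M\<^esub> x \<in> N"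
  shows "submodule R N M"
  using assms by (simp add: submodule_def)

lemma submoduleD:
  assumes "submodule R N M"
  shows "N \<subseteq> carrier M" "\<zero>\<^bsub>M\<^esub> \<in> N"
    and "\<And>x y. \<lbrakk>x \<in> N; y \<in> N\<rbrakk> \<Longrightarrow> x \<oplus>\<^bsub>M\<^esub> y \<in> N"
    and "\<And>c x. \<lbrakk>c \<in> carrier R; x \<in> N\<rbrakk> \<Longrightarrow> c \<odot>\<^bsub>M\<^esub> x \<in> N"
  using assms by (auto simp: submodule_def)

lemma submodule_carrier:
  assumes "module R M" shows "submodule R (carrier M) M"
proof -
  interpret module R M by fact
  show ?thesis by (rule submodule_criterion[OF assms]) auto
qed

context vectorspace
begin

lemma linear_form_on_zero:
  assumes "linear_form_on K V U f" "\<zero>\<^bsub>V\<^esub> \<in> U"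
  shows "f \<zero>\<^bsub>V\<^esub> = \<zero>\<^bsub>K\<^esub>"
  using linear_form_onD(3)[OF assms(1) R.zero_closed assms(2)] linear_form_onD(1)[OF assms] by simp

lemma linear_form_on_minus:
  assumes f: "linear_form_on K V U f" and U: "submodule K U V" and x: "x \<in> U" "y \<in> U"
  shows "x \<ominus>\<^bsub>V\<^esub> y \<in> U" "f (x \<ominus>\<^bsub>V\<^esub> y) = f x \<ominus>\<^bsub>K\<^esub> f y"
proof -
  have c: "x \<in> carrier V" "y \<in> carrier V" using submoduleD(1)[OF U] x by auto
  have eq: "x \<ominus>\<^bsub>V\<^esub> y = x \<oplus>\<^bsub>V\<^esub> (\<ominus>\<^bsub>K\<^esub> \<one>\<^bsub>K\<^esub>) \<odot>\<^bsub>V\<^esub> y" using c by (simp add: M.minus_eq smult_minus_1)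
  have m: "(\<ominus>\<^bsub>K\<^esub> \<one>\<^bsub>K\<^esub>) \<odot>\<^bsub>V\<^esub> y \<in> U" using submoduleD(4)[OF U] x by simp
  show "x \<ominus>\<^bsub>V\<^esub> y \<in> U" unfolding eq by (rule submoduleD(3)[OF U x(1) m])
  show "f (x \<ominus>\<^bsub>V\<^esub> y) = f x \<ominus>\<^bsub>K\<^esub> f y"
    unfolding eq using linear_form_onD[OF f] x m by (simp add: R.minus_eq R.l_minus)
qed

text \<open>If \<open>v\<close> lies outside of \<open>U\<close>, the extension to \<open>U + k v\<close> sends \<open>v\<close> to \<open>0\<close>.\<close>

lemma extend_linear_form_step:
  assumes U: "submodule K U V" and f: "linear_form_on K V U f" and v: "v \<in> carrier V"
  shows "\<exists>U' g. submodule K U' V \<and> U \<subseteq> U' \<and> v \<in> U' \<and> linear_form_on K V U' g \<and> (\<forall>x\<in>U. g x = f x)"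
proof (cases "v \<in> U")
  case True
  then show ?thesis using U f by blast
next
  case False
  have Uc: "x \<in> carrier V" if "x \<in> U" for x using submoduleD(1)[OF U] that by auto
  define U' where "U' = {u \<oplus>\<^bsub>V\<^esub> c \<odot>\<^bsub>V\<^esub> v | u c. u \<in> U \<and> c \<in> carrier K}"
  have in1: "u \<oplus>\<^bsub>V\<^esub> c \<odot>\<^bsub>V\<^esub> v \<in> U'" if "u \<in> U" "c \<in> carrier K" for u c using that by (auto simp: U'_def)
  have ex: "\<exists>u c. w = u \<oplus>\<^bsub>V\<^esub> c \<odot>\<^bsub>V\<^esub> v \<and> u \<in> U \<and> c \<in> carrier K" if "w \<in> U'" for w
    using that unfolding U'_def by blast
  have uniq: "u = u'" if eq: "u \<oplus>\<^bsub>V\<^esub> c \<odot>\<^bsub>V\<^esub> v = u' \<oplus>\<^bsub>V\<^esub> c' \<odot>\<^bsub>V\<^esub> v"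
    and m: "u \<in> U" "u' \<in> U" "c \<in> carrier K" "c' \<in> carrier K" for u u' c c'
  proof -
    have "(c \<ominus>\<^bsub>K\<^esub> c') \<odot>\<^bsub>V\<^esub> v = (u \<oplus>\<^bsub>V\<^esub> c \<odot>\<^bsub>V\<^esub> v) \<ominus>\<^bsub>V\<^esub> (u \<oplus>\<^bsub>V\<^esub> c' \<odot>\<^bsub>V\<^esub> v)"
      using m v Uc by (simp add: R.minus_eq M.minus_eq smult_l_distr smult_l_minus M.minus_add M.a_ac M.r_neg1 M.r_neg2)
    also have "\<dots> = u' \<ominus>\<^bsub>V\<^esub> u"
      unfolding eq using m v Uc by (simp add: M.minus_eq M.minus_add M.a_ac M.r_neg1 M.r_neg2 M.r_neg)
    finally have d: "(c \<ominus>\<^bsub>K\<^esub> c') \<odot>\<^bsub>V\<^esub> v = u' \<ominus>\<^bsub>V\<^esub> u" .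
    have dU: "u' \<ominus>\<^bsub>V\<^esub> u \<in> U" using linear_form_on_minus(1)[OF f U] m by simp
    have "c \<ominus>\<^bsub>K\<^esub> c' = \<zero>\<^bsub>K\<^esub>"
    proof (rule ccontr)
      assume nz: "c \<ominus>\<^bsub>K\<^esub> c' \<noteq> \<zero>\<^bsub>K\<^esub>"
      have cc: "c \<ominus>\<^bsub>K\<^esub> c' \<in> carrier K" using m by simp
      have "v = inv\<^bsub>K\<^esub> (c \<ominus>\<^bsub>K\<^esub> c') \<odot>\<^bsub>V\<^esub> (u' \<ominus>\<^bsub>V\<^esub> u)" by (rule mult_inverse[OF cc v d nz])
      also have "\<dots> \<in> U" using submoduleD(4)[OF U inverse_exists[OF cc nz] dU] .
      finally show False using False by simp
    qed
    then have "c = c'" using m by simp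
    then show ?thesis using eq m v Uc by simp
  qed
  define g where "g w = f (SOME u. u \<in> U \<and> (\<exists>c\<in>carrier K. w = u \<oplus>\<^bsub>V\<^esub> c \<odot>\<^bsub>V\<^esub> v))" for w
  have g: "g (u \<oplus>\<^bsub>V\<^esub> c \<odot>\<^bsub>V\<^esub> v) = f u" if uc: "u \<in> U" "c \<in> carrier K" for u c
  proof -
    define u' where "u' = (SOME u'. u' \<in> U \<and> (\<exists>c'\<in>carrier K. u \<oplus>\<^bsub>V\<^esub> c \<odot>\<^bsub>V\<^esub> v = u' \<oplus>\<^bsub>V\<^esub> c' \<odot>\<^bsub>V\<^esub> v))"
    have "\<exists>u'. u' \<in> U \<and> (\<exists>c'\<in>carrier K. u \<oplus>\<^bsub>V\<^esub> c \<odot>\<^bsub>V\<^esub> v = u' \<oplus>\<^bsub>V\<^esub> c' \<odot>\<^bsub>V\<^esub> v)" using uc by blast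
    from someI_ex[OF this] obtain c' where "u' \<in> U" "c' \<in> carrier K" "u \<oplus>\<^bsub>V\<^esub> c \<odot>\<^bsub>V\<^esub> v = u' \<oplus>\<^bsub>V\<^esub> c' \<odot>\<^bsub>V\<^esub> v"
      unfolding u'_def by blast
    then have "u = u'" using uniq uc by blast
    then show ?thesis unfolding g_def u'_def[symmetric] by simp
  qed
  have addU: "(u \<oplus>\<^bsub>V\<^esub> c \<odot>\<^bsub>V\<^esub> v) \<oplus>\<^bsub>V\<^esub> (u' \<oplus>\<^bsub>V\<^esub> c' \<odot>\<^bsub>V\<^esub> v) = (u \<oplus>\<^bsub>V\<^esub> u') \<oplus>\<^bsub>V\<^esub> (c \<oplus>\<^bsub>K\<^esub> c') \<odot>\<^bsub>V\<^esub> v"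
    if "u \<in> U" "c \<in> carrier K" "u' \<in> U" "c' \<in> carrier K" for u u' c c'
    using that v Uc by (simp add: smult_l_distr M.a_ac)
  have smU: "t \<odot>\<^bsub>V\<^esub> (u \<oplus>\<^bsub>V\<^esub> c \<odot>\<^bsub>V\<^esub> v) = (t \<odot>\<^bsub>V\<^esub> u) \<oplus>\<^bsub>V\<^esub> (t \<otimes>\<^bsub>K\<^esub> c) \<odot>\<^bsub>V\<^esub> v"
    if "u \<in> U" "c \<in> carrier K" "t \<in> carrier K" for u c t
    using that v Uc by (simp add: smult_r_distr smult_assoc1)
  have zv: "u \<oplus>\<^bsub>V\<^esub> \<zero>\<^bsub>K\<^esub> \<odot>\<^bsub>V\<^esub> v = u" if "u \<in> U" for u using that v Uc by simp
  have sub: "U \<subseteq> U'" using in1 zv by (metis R.zero_closed subsetI)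
  have vU: "v \<in> U'" using in1[OF submoduleD(2)[OF U] R.one_closed] v by simp
  have U': "submodule K U' V"
  proof (rule submodule_criterion[OF module_axioms])
    show "U' \<subseteq> carrier V" using v Uc by (auto simp: U'_def)
    show "\<zero>\<^bsub>V\<^esub> \<in> U'" using sub submoduleD(2)[OF U] by blast
    fix x assume x: "x \<in> U'"
    obtain u c where 1: "x = u \<oplus>\<^bsub>V\<^esub> c \<odot>\<^bsub>V\<^esub> v" "u \<in> U" "c \<in> carrier K" using ex[OF x] by blast
    show "t \<odot>\<^bsub>V\<^esub> x \<in> U'" if "t \<in> carrier K" for t
      unfolding 1(1) smU[OF 1(2,3) that] using 1 that submoduleD(4)[OF U] by (intro in1) auto
    fix y assume y: "y \<in> U'"
    obtain u' c' where 2: "y = u' \<oplus>\<^bsub>V\<^esub> c' \<odot>\<^bsub>V\<^esub> v" "u' \<in> U" "c' \<in> carrier K" using ex[OF y] by blast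
    show "x \<oplus>\<^bsub>V\<^esub> y \<in> U'"
      unfolding 1(1) 2(1) addU[OF 1(2,3) 2(2,3)] using 1 2 submoduleD(3)[OF U] by (intro in1) auto
  qed
  have "linear_form_on K V U' g"
  proof (rule linear_form_onI)
    fix x assume x: "x \<in> U'"
    obtain u c where 1: "x = u \<oplus>\<^bsub>V\<^esub> c \<odot>\<^bsub>V\<^esub> v" "u \<in> U" "c \<in> carrier K" using ex[OF x] by blast
    show "g x \<in> carrier K" unfolding 1(1) g[OF 1(2,3)] using linear_form_onD(1)[OF f 1(2)] .
    show "g (t \<odot>\<^bsub>V\<^esub> x) = t \<otimes>\<^bsub>K\<^esub> g x" if t: "t \<in> carrier K" for t
      unfolding 1(1) smU[OF 1(2,3) t] g[OF 1(2,3)]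
      using g[OF submoduleD(4)[OF U t 1(2)] R.m_closed[OF t 1(3)]] linear_form_onD(3)[OF f t 1(2)] by simp
    fix y assume y: "y \<in> U'"
    obtain u' c' where 2: "y = u' \<oplus>\<^bsub>V\<^esub> c' \<odot>\<^bsub>V\<^esub> v" "u' \<in> U" "c' \<in> carrier K" using ex[OF y] by blast
    show "g (x \<oplus>\<^bsub>V\<^esub> y) = g x \<oplus>\<^bsub>K\<^esub> g y"
      unfolding 1(1) 2(1) addU[OF 1(2,3) 2(2,3)] g[OF 1(2,3)] g[OF 2(2,3)]
      using g[OF submoduleD(3)[OF U 1(2) 2(2)] R.a_closed[OF 1(3) 2(3)]] linear_form_onD(2)[OF f 1(2) 2(2)] by simp
  qed
  moreover have "\<forall>x\<in>U. g x = f x" using g zv by (metis R.zero_closed)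
  ultimately show ?thesis using U' sub vU by blast
qed

lemma extend_linear_form:
  assumes fin: "fin_dim" and U: "submodule K U V" and f: "linear_form_on K V U f"
  obtains g where "linear_form_on K V (carrier V) g" "\<And>x. x \<in> U \<Longrightarrow> g x = f x"
proof -
  obtain B where B: "finite B" "B \<subseteq> carrier V" "span B = carrier V"
    using fin by (auto simp: fin_dim_def)
  have "\<exists>U' g. submodule K U' V \<and> U \<subseteq> U' \<and> B \<subseteq> U' \<and> linear_form_on K V U' g \<and> (\<forall>x\<in>U. g x = f x)"
    using B(1,2)
  proof (induction B rule: finite_induct)
    case empty
    then show ?case using U f by blast
  next
    case (insert v B)
    then obtain U' g where 1: "submodule K U' V" "U \<subseteq> U'" "B \<subseteq> U'" "linear_form_on K V U' g" "\<forall>x\<in>U. g x = f x"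
      by auto
    obtain U'' h where 2: "submodule K U'' V" "U' \<subseteq> U''" "v \<in> U''" "linear_form_on K V U'' h" "\<forall>x\<in>U'. h x = g x"
      using extend_linear_form_step[OF 1(1,4), of v] insert.prems by blast
    have "U \<subseteq> U''" "insert v B \<subseteq> U''" "\<forall>x\<in>U. h x = f x" using 1 2 by auto
    then show ?case using 2(1,4) by blast
  qed
  then obtain U' g where 1: "submodule K U' V" "B \<subseteq> U'" "linear_form_on K V U' g" "\<forall>x\<in>U. g x = f x"
    by auto
  have "U' = carrier V" using span_is_subset[OF 1(2,1)] submoduleD(1)[OF 1(1)] B(3) by auto
  then show thesis using that 1 by blast
qed

text \<open>
  The dimension of a subspace \<open>W\<close>, expressed by linear independence in the ambient space.
\<close>

definition max_indpt :: "'c set \<Rightarrow> nat" where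
  "max_indpt W = Max (card ` {S. S \<subseteq> W \<and> lin_indpt S})"

lemma max_indpt_image:
  assumes fin: "fin_dim" and W: "submodule K W V"
  shows "finite (card ` {S. S \<subseteq> W \<and> lin_indpt S})" "card ` {S. S \<subseteq> W \<and> lin_indpt S} \<noteq> {}"
proof -
  let ?A = "{S. S \<subseteq> W \<and> lin_indpt S}"
  have Wc: "W \<subseteq> carrier V" by (rule submoduleD(1)[OF W])
  have "card ` ?A \<subseteq> {..dim}" using li_le_dim(2)[OF fin] Wc by auto
  then show "finite (card ` ?A)" by (rule finite_subset) simp
  have "{} \<in> ?A" by (simp add: lin_dep_def)
  then show "card ` ?A \<noteq> {}" by blast
qed

lemma card_le_max_indpt:
  assumes "fin_dim" "submodule K W V" "T \<subseteq> W" "lin_indpt T"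
  shows "card T \<le> max_indpt W"
  unfolding max_indpt_def using assms by (intro Max_ge[OF max_indpt_image(1)]) auto

lemma max_indpt_attained:
  assumes fin: "fin_dim" and W: "submodule K W V"
  obtains S where "finite S" "S \<subseteq> W" "lin_indpt S" "span S = W" "card S = max_indpt W"
proof -
  let ?A = "{S. S \<subseteq> W \<and> lin_indpt S}"
  have Wc: "W \<subseteq> carrier V" by (rule submoduleD(1)[OF W])
  have "max_indpt W \<in> card ` ?A" unfolding max_indpt_def by (rule Max_in[OF max_indpt_image[OF fin W]])
  then obtain S where S: "S \<subseteq> W" "lin_indpt S" "card S = max_indpt W" by auto
  have fS: "finite S" using li_le_dim(1)[OF fin] S Wc by auto
  have "W \<subseteq> span S"
  proof
    fix v assume v: "v \<in> W"
    show "v \<in> span S"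
    proof (rule ccontr)
      assume nv: "v \<notin> span S"
      have Sc: "S \<subseteq> carrier V" using S Wc by auto
      then have vS: "v \<notin> S" using nv span_mem by auto
      have "lin_indpt (S \<union> {v})" using lin_dep_iff_in_span[OF Sc S(2) _ vS] nv v Wc by auto
      then have "card (S \<union> {v}) \<le> max_indpt W" using S(1) v by (intro card_le_max_indpt[OF fin W]) auto
      then show False using fS vS S(3) by simp
    qed
  qed
  moreover have "span S \<subseteq> W" by (rule span_is_subset[OF S(1) W])
  ultimately show thesis using that[OF fS S(1,2) _ S(3)] by blast
qed

lemma max_indpt_strict_mono:
  assumes fin: "fin_dim" and W: "submodule K W V" and W': "submodule K W' V" and sub: "W \<subset> W'"
  shows "max_indpt W < max_indpt W'"
proof -
  obtain S where S: "finite S" "S \<subseteq> W" "lin_indpt S" "span S = W" "card S = max_indpt W"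
    using max_indpt_attained[OF fin W] by blast
  obtain v where v: "v \<in> W'" "v \<notin> W" using sub by blast
  have Sc: "S \<subseteq> carrier V" using S submoduleD(1)[OF W] by auto
  have vS: "v \<notin> S" using v S by auto
  have vc: "v \<in> carrier V" using v submoduleD(1)[OF W'] by auto
  have "lin_indpt (S \<union> {v})" using lin_dep_iff_in_span[OF Sc S(3) vc vS] v S(4) by auto
  moreover have "S \<union> {v} \<subseteq> W'" using S v sub by auto
  ultimately have "card (S \<union> {v}) \<le> max_indpt W'"
    by (intro card_le_max_indpt[OF fin W'])
  then show ?thesis using S vS by simp
qed

text \<open>
  Induction on \<open>F\<close>: the kernel of one form \<open>f\<close> on \<open>N\<close> has codimension at most one in \<open>N\<close>, and its points
  are separated by the other forms.
\<close>

lemma separating_forms_span: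
  assumes "finite F" "\<And>f. f \<in> F \<Longrightarrow> linear_form_on K V (carrier V) f"
    and "submodule K N V" "\<And>x. \<lbrakk>x \<in> N; \<And>f. f \<in> F \<Longrightarrow> f x = \<zero>\<^bsub>K\<^esub>\<rbrakk> \<Longrightarrow> x = \<zero>\<^bsub>V\<^esub>"
  shows "\<exists>B. finite B \<and> card B \<le> card F \<and> B \<subseteq> N \<and> N \<subseteq> span B"
  using assms
proof (induction F arbitrary: N rule: finite_induct)
  case empty
  then have "N \<subseteq> span {}" using span_zero by (metis empty_iff subsetI)
  then show ?case by (intro exI[of _ "{}"]) auto
next
  case (insert f F)
  have f: "linear_form_on K V (carrier V) f" using insert.prems(1) by simp
  note N = insert.prems(2)
  have Nc: "x \<in> carrier V" if "x \<in> N" for x using submoduleD(1)[OF N] that by auto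
  define N' where "N' = {x \<in> N. f x = \<zero>\<^bsub>K\<^esub>}"
  have N': "submodule K N' V"
  proof (rule submodule_criterion[OF module_axioms])
    show "N' \<subseteq> carrier V" using Nc by (auto simp: N'_def)
    show "\<zero>\<^bsub>V\<^esub> \<in> N'" using submoduleD(2)[OF N] linear_form_on_zero[OF f] by (simp add: N'_def)
    show "x \<oplus>\<^bsub>V\<^esub> y \<in> N'" if "x \<in> N'" "y \<in> N'" for x y
      using that submoduleD(3)[OF N] linear_form_onD(2)[OF f] Nc by (simp add: N'_def)
    show "c \<odot>\<^bsub>V\<^esub> x \<in> N'" if "c \<in> carrier K" "x \<in> N'" for c x
      using that submoduleD(4)[OF N] linear_form_onD(3)[OF f] Nc by (simp add: N'_def)
  qed
  have "\<exists>B. finite B \<and> card B \<le> card F \<and> B \<subseteq> N' \<and> N' \<subseteq> span B"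
  proof (rule insert.IH[OF _ N'])
    show "linear_form_on K V (carrier V) g" if "g \<in> F" for g using insert.prems(1) that by simp
    show "x = \<zero>\<^bsub>V\<^esub>" if "x \<in> N'" "\<And>g. g \<in> F \<Longrightarrow> g x = \<zero>\<^bsub>K\<^esub>" for x
      using insert.prems(3)[of x] that by (auto simp: N'_def)
  qed
  then obtain B where B: "finite B" "card B \<le> card F" "B \<subseteq> N'" "N' \<subseteq> span B" by blast
  have cF: "card (insert f F) = Suc (card F)" using insert.hyps by simp
  show ?case
  proof (cases "N' = N")
    case True
    then show ?thesis using B cF by (intro exI[of _ B]) auto
  next
    case False
    then obtain v where v: "v \<in> N" "f v \<noteq> \<zero>\<^bsub>K\<^esub>" by (auto simp: N'_def)
    have vc: "v \<in> carrier V" "f v \<in> carrier K" using Nc v linear_form_onD(1)[OF f] by auto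
    have Bc: "insert v B \<subseteq> carrier V" using B(3) vc Nc by (auto simp: N'_def)
    have iv: "inv\<^bsub>K\<^esub> f v \<in> carrier K" "inv\<^bsub>K\<^esub> f v \<otimes>\<^bsub>K\<^esub> f v = \<one>\<^bsub>K\<^esub>"
      using vc v field_Units by (auto intro: Units_l_inv)
    have sp: "submodule K (span (insert v B)) V" by (rule span_is_submodule[OF Bc])
    have "N \<subseteq> span (insert v B)"
    proof
      fix x assume x: "x \<in> N"
      let ?c = "f x \<otimes>\<^bsub>K\<^esub> inv\<^bsub>K\<^esub> f v"
      have xc: "x \<in> carrier V" "f x \<in> carrier K" using Nc x linear_form_onD(1)[OF f] by auto
      have c: "?c \<in> carrier K" using xc iv by simp
      have cv: "?c \<odot>\<^bsub>V\<^esub> v \<in> N" using submoduleD(4)[OF N c v(1)] .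
      have "f (?c \<odot>\<^bsub>V\<^esub> v) = f x" using linear_form_onD(3)[OF f c vc(1)] iv xc vc by (simp add: R.m_assoc)
      then have "f (x \<ominus>\<^bsub>V\<^esub> ?c \<odot>\<^bsub>V\<^esub> v) = \<zero>\<^bsub>K\<^esub>"
        using linear_form_on_minus(2)[OF f submodule_carrier[OF module_axioms] xc(1)] Nc[OF cv] xc
        by (simp add: R.r_neg R.minus_eq)
      moreover have "x \<ominus>\<^bsub>V\<^esub> ?c \<odot>\<^bsub>V\<^esub> v \<in> N"
      proof -
        have "x \<ominus>\<^bsub>V\<^esub> ?c \<odot>\<^bsub>V\<^esub> v = x \<oplus>\<^bsub>V\<^esub> (\<ominus>\<^bsub>K\<^esub> \<one>\<^bsub>K\<^esub>) \<odot>\<^bsub>V\<^esub> (?c \<odot>\<^bsub>V\<^esub> v)"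
          using Nc[OF cv] xc by (simp only: M.minus_eq smult_minus_1)
        then show ?thesis using submoduleD(3,4)[OF N] x cv by simp
      qed
      ultimately have 1: "x \<ominus>\<^bsub>V\<^esub> ?c \<odot>\<^bsub>V\<^esub> v \<in> span (insert v B)"
        using B(4) span_is_monotone[of B "insert v B"] by (auto simp: N'_def)
      have 2: "?c \<odot>\<^bsub>V\<^esub> v \<in> span (insert v B)"
        using submoduleD(4)[OF sp c] span_mem[OF Bc, of v] by simp
      have "x = (x \<ominus>\<^bsub>V\<^esub> ?c \<odot>\<^bsub>V\<^esub> v) \<oplus>\<^bsub>V\<^esub> ?c \<odot>\<^bsub>V\<^esub> v"
        using xc(1) Nc[OF cv] by (simp add: M.minus_eq M.a_assoc M.l_neg)
      then show "x \<in> span (insert v B)" using submoduleD(3)[OF sp 1 2] by simp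
    qed
    moreover have "card (insert v B) \<le> card (insert f F)" using B cF by (simp add: card_insert_if)
    moreover have "insert v B \<subseteq> N" using B v by (auto simp: N'_def)
    ultimately show ?thesis using B(1) by (intro exI[of _ "insert v B"]) simp
  qed
qed

end

text \<open>
  A basis of \<open>Q\<close> provides linear forms on \<open>P\<close> that separate points.
\<close>

lemma pairing_dim_le:
  assumes P: "vectorspace k P" and Q: "vectorspace k Q" "vectorspace.fin_dim k Q"
    and p: "\<And>q. q \<in> carrier Q \<Longrightarrow> linear_form_on k P (carrier P) (\<lambda>p. \<beta> p q)"
    and q: "\<And>p. p \<in> carrier P \<Longrightarrow> linear_form_on k Q (carrier Q) (\<beta> p)"
    and nondeg: "\<And>p. \<lbrakk>p \<in> carrier P; \<And>q. q \<in> carrier Q \<Longrightarrow> \<beta> p q = \<zero>\<^bsub>k\<^esub>\<rbrakk> \<Longrightarrow> p = \<zero>\<^bsub>P\<^esub>"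
  shows "vectorspace.fin_dim k P" "vectorspace.dim k P \<le> vectorspace.dim k Q"
proof -
  interpret P: vectorspace k P by fact
  interpret Q: vectorspace k Q by fact
  obtain b where b: "finite b" "Q.basis b" using Q.finite_basis_exists[OF Q(2)] by blast
  have bc: "b \<subseteq> carrier Q" and bspan: "Q.span b = carrier Q" using b(2) by (auto simp: Q.basis_def)
  let ?F = "(\<lambda>q p. \<beta> p q) ` b"
  have "\<exists>B. finite B \<and> card B \<le> card ?F \<and> B \<subseteq> carrier P \<and> carrier P \<subseteq> P.span B"
  proof (rule P.separating_forms_span)
    show "finite ?F" using b by simp
    show "linear_form_on k P (carrier P) f" if "f \<in> ?F" for f using that p bc by auto
    show "submodule k (carrier P) P" by (rule submodule_carrier[OF P.module_axioms])
    show "x = \<zero>\<^bsub>P\<^esub>" if x: "x \<in> carrier P" "\<And>f. f \<in> ?F \<Longrightarrow> f x = \<zero>\<^bsub>k\<^esub>" for x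
    proof (rule nondeg[OF x(1)])
      note fx = q[OF x(1)]
      have "submodule k {q \<in> carrier Q. \<beta> x q = \<zero>\<^bsub>k\<^esub>} Q"
        by (rule submodule_criterion[OF Q.module_axioms])
          (auto simp: linear_form_onD[OF fx] Q.linear_form_on_zero[OF fx])
      moreover have "b \<subseteq> {q \<in> carrier Q. \<beta> x q = \<zero>\<^bsub>k\<^esub>}" using x(2) bc by auto
      ultimately have "Q.span b \<subseteq> {q \<in> carrier Q. \<beta> x q = \<zero>\<^bsub>k\<^esub>}" by (rule Q.span_is_subset[rotated])
      then show "\<beta> x y = \<zero>\<^bsub>k\<^esub>" if "y \<in> carrier Q" for y using that bspan by auto
    qed
  qed
  then obtain B where B: "finite B" "card B \<le> card ?F" "B \<subseteq> carrier P" "carrier P \<subseteq> P.span B" by blast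
  have gen: "P.span B = carrier P" using B P.span_is_subset2[OF B(3)] by auto
  show "P.fin_dim" using B gen by (auto simp: P.fin_dim_def)
  have "P.dim \<le> card B" by (rule P.gen_ge_dim[OF B(1,3) gen])
  also have "\<dots> \<le> card b" using B(2) card_image_le[OF b(1), of "\<lambda>q p. \<beta> p q"] by simp
  also have "\<dots> = Q.dim" using Q.dim_basis[OF b] by simp
  finally show "P.dim \<le> Q.dim" .
qed

text \<open>
  The pairing descends to a pairing of \<open>P\<close> and \<open>Q\<close> that is nondegenerate on both sides. It is given on a
  space \<open>G\<close> that maps onto \<open>Q\<close>, because in the application the elements of \<open>Q\<close> are cosets of cosets.
\<close>

lemma pairing_dim_eq:
  assumes P: "vectorspace k P" "vectorspace.fin_dim k P" and Q: "vectorspace k Q"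
    and G: "vectorspace k G" and T: "T \<in> module_hom k G Q" "T ` carrier G = carrier Q"
    and p: "\<And>g. g \<in> carrier G \<Longrightarrow> linear_form_on k P (carrier P) (\<lambda>p. \<beta> p g)"
    and g: "\<And>p. p \<in> carrier P \<Longrightarrow> linear_form_on k G (carrier G) (\<beta> p)"
    and left: "\<And>p. \<lbrakk>p \<in> carrier P; \<And>g. g \<in> carrier G \<Longrightarrow> \<beta> p g = \<zero>\<^bsub>k\<^esub>\<rbrakk> \<Longrightarrow> p = \<zero>\<^bsub>P\<^esub>"
    and right: "\<And>g. g \<in> carrier G \<Longrightarrow> T g = \<zero>\<^bsub>Q\<^esub> \<longleftrightarrow> (\<forall>p\<in>carrier P. \<beta> p g = \<zero>\<^bsub>k\<^esub>)"
  shows "vectorspace.dim k P = vectorspace.dim k Q"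
proof -
  interpret P: vectorspace k P by fact
  interpret Q: vectorspace k Q by fact
  interpret G: vectorspace k G by fact
  interpret T: mod_hom k G Q T by unfold_locales (rule T)
  define s where "s = inv_into (carrier G) T"
  have s: "s y \<in> carrier G" "T (s y) = y" if "y \<in> carrier Q" for y
    using that T(2) unfolding s_def by (metis inv_into_into, metis f_inv_into_f)
  have eq: "\<beta> x g = \<beta> x g'" if "x \<in> carrier P" "g \<in> carrier G" "g' \<in> carrier G" "T g = T g'" for x g g'
  proof -
    have "T (g \<ominus>\<^bsub>G\<^esub> g') = \<zero>\<^bsub>Q\<^esub>" using that T.f_im by simp
    then have "\<beta> x (g \<ominus>\<^bsub>G\<^esub> g') = \<zero>\<^bsub>k\<^esub>" using right[of "g \<ominus>\<^bsub>G\<^esub> g'"] that by simp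
    then have "\<beta> x g \<ominus>\<^bsub>k\<^esub> \<beta> x g' = \<zero>\<^bsub>k\<^esub>"
      using G.linear_form_on_minus(2)[OF g[OF that(1)] submodule_carrier[OF G.module_axioms] that(2,3)] by simp
    then show ?thesis using linear_form_onD(1)[OF g[OF that(1)]] that by simp
  qed
  have q1: "linear_form_on k P (carrier P) (\<lambda>x. \<beta> x (s y))" if "y \<in> carrier Q" for y
    using p s that by blast
  have q2: "linear_form_on k Q (carrier Q) (\<lambda>y. \<beta> x (s y))" if x: "x \<in> carrier P" for x
  proof (rule linear_form_onI)
    note gx = linear_form_onD[OF g[OF x]]
    show "\<beta> x (s y) \<in> carrier k" if "y \<in> carrier Q" for y using gx(1) s that by simp
    show "\<beta> x (s (y \<oplus>\<^bsub>Q\<^esub> z)) = \<beta> x (s y) \<oplus>\<^bsub>k\<^esub> \<beta> x (s z)" if "y \<in> carrier Q" "z \<in> carrier Q" for y z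
      using eq[OF x, of "s (y \<oplus>\<^bsub>Q\<^esub> z)" "s y \<oplus>\<^bsub>G\<^esub> s z"] gx(2) s that by simp
    show "\<beta> x (s (c \<odot>\<^bsub>Q\<^esub> y)) = c \<otimes>\<^bsub>k\<^esub> \<beta> x (s y)" if "c \<in> carrier k" "y \<in> carrier Q" for c y
      using eq[OF x, of "s (c \<odot>\<^bsub>Q\<^esub> y)" "c \<odot>\<^bsub>G\<^esub> s y"] gx(3) s that by simp
  qed
  have nP: "x = \<zero>\<^bsub>P\<^esub>" if x: "x \<in> carrier P" "\<And>y. y \<in> carrier Q \<Longrightarrow> \<beta> x (s y) = \<zero>\<^bsub>k\<^esub>" for x
  proof (rule left[OF x(1)])
    fix h assume h: "h \<in> carrier G"
    show "\<beta> x h = \<zero>\<^bsub>k\<^esub>" using eq[OF x(1) h, of "s (T h)"] s[of "T h"] x(2)[of "T h"] T.f_im[OF h] by simp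
  qed
  have nQ: "y = \<zero>\<^bsub>Q\<^esub>" if y: "y \<in> carrier Q" "\<And>x. x \<in> carrier P \<Longrightarrow> \<beta> x (s y) = \<zero>\<^bsub>k\<^esub>" for y
    using right[of "s y"] s[OF y(1)] y(2) by simp
  have 1: "Q.fin_dim" "Q.dim \<le> P.dim"
    by (rule pairing_dim_le[OF Q P q2 q1 nQ]; assumption)+
  have 2: "P.dim \<le> Q.dim"
    by (rule pairing_dim_le(2)[OF P(1) Q 1(1) q1 q2 nP]; assumption)
  show ?thesis using 1 2 by simp
qed


section \<open>Constructions with modules\<close>

text \<open>
  The module axioms are equations, up to the existence of negatives, and so they pass from \<open>M\<close> to \<open>N\<close>.
  Quotients, the inverse of a line bundle and tensor products are recognized as modules in this way.
\<close>

lemma module_surj_image: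
  fixes N :: "('a, 'n, 'f) module_scheme"
  assumes M: "module R M" and onto: "T ` carrier M = carrier N"
    and add: "\<And>x y. \<lbrakk>x \<in> carrier M; y \<in> carrier M\<rbrakk> \<Longrightarrow> T (x \<oplus>\<^bsub>M\<^esub> y) = T x \<oplus>\<^bsub>N\<^esub> T y"
    and smult: "\<And>r x. \<lbrakk>r \<in> carrier R; x \<in> carrier M\<rbrakk> \<Longrightarrow> T (r \<odot>\<^bsub>M\<^esub> x) = r \<odot>\<^bsub>N\<^esub> T x"
    and zero: "T \<zero>\<^bsub>M\<^esub> = \<zero>\<^bsub>N\<^esub>"
  shows "module R N" "T \<in> module_hom R M N"
proof -
  interpret M: module R M by fact
  have TN: "T x \<in> carrier N" if "x \<in> carrier M" for x using that onto by auto
  have ex: "\<exists>x. x \<in> carrier M \<and> y = T x" if "y \<in> carrier N" for y using that onto by auto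
  have ab: "abelian_group N"
  proof (rule abelian_groupI)
    show "\<zero>\<^bsub>N\<^esub> \<in> carrier N" using TN[of "\<zero>\<^bsub>M\<^esub>"] zero by simp
    fix u assume u: "u \<in> carrier N"
    obtain x where x: "x \<in> carrier M" "u = T x" using ex[OF u] by blast
    show "\<zero>\<^bsub>N\<^esub> \<oplus>\<^bsub>N\<^esub> u = u" using add[OF M.M.zero_closed x(1)] zero x by simp
    have "T (\<ominus>\<^bsub>M\<^esub> x) \<oplus>\<^bsub>N\<^esub> u = \<zero>\<^bsub>N\<^esub>" using add[of "\<ominus>\<^bsub>M\<^esub> x" x] x zero by (simp add: M.M.l_neg)
    then show "\<exists>v\<in>carrier N. v \<oplus>\<^bsub>N\<^esub> u = \<zero>\<^bsub>N\<^esub>" using TN[of "\<ominus>\<^bsub>M\<^esub> x"] x(1) by blast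
    fix v assume v: "v \<in> carrier N"
    obtain y where y: "y \<in> carrier M" "v = T y" using ex[OF v] by blast
    show "u \<oplus>\<^bsub>N\<^esub> v \<in> carrier N" using TN[of "x \<oplus>\<^bsub>M\<^esub> y"] add x y by simp
    show "u \<oplus>\<^bsub>N\<^esub> v = v \<oplus>\<^bsub>N\<^esub> u" using add[OF x(1) y(1)] add[OF y(1) x(1)] x y M.M.a_comm[of x y] by simp
    fix w assume w: "w \<in> carrier N"
    obtain z where z: "z \<in> carrier M" "w = T z" using ex[OF w] by blast
    show "u \<oplus>\<^bsub>N\<^esub> v \<oplus>\<^bsub>N\<^esub> w = u \<oplus>\<^bsub>N\<^esub> (v \<oplus>\<^bsub>N\<^esub> w)"
      unfolding x(2) y(2) z(2) using x(1) y(1) z(1) by (simp add: add[symmetric] M.M.a_assoc)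
  qed
  show "module R N"
  proof (rule moduleI[OF M.R.is_cring ab])
    fix a u assume a: "a \<in> carrier R" and u: "u \<in> carrier N"
    obtain x where x: "x \<in> carrier M" "u = T x" using ex[OF u] by blast
    show "a \<odot>\<^bsub>N\<^esub> u \<in> carrier N" using TN[of "a \<odot>\<^bsub>M\<^esub> x"] smult a x by simp
    show "(a \<oplus>\<^bsub>R\<^esub> b) \<odot>\<^bsub>N\<^esub> u = a \<odot>\<^bsub>N\<^esub> u \<oplus>\<^bsub>N\<^esub> b \<odot>\<^bsub>N\<^esub> u" if b: "b \<in> carrier R" for b
      unfolding x(2) using a b x(1) by (simp add: smult[symmetric] add[symmetric] M.smult_l_distr)
    show "(a \<otimes>\<^bsub>R\<^esub> b) \<odot>\<^bsub>N\<^esub> u = a \<odot>\<^bsub>N\<^esub> (b \<odot>\<^bsub>N\<^esub> u)" if b: "b \<in> carrier R" for b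
      unfolding x(2) using a b x(1) by (simp add: smult[symmetric] M.smult_assoc1)
    show "a \<odot>\<^bsub>N\<^esub> (u \<oplus>\<^bsub>N\<^esub> v) = a \<odot>\<^bsub>N\<^esub> u \<oplus>\<^bsub>N\<^esub> a \<odot>\<^bsub>N\<^esub> v" if v: "v \<in> carrier N" for v
    proof -
      obtain y where y: "y \<in> carrier M" "v = T y" using ex[OF v] by blast
      show ?thesis unfolding x(2) y(2) using a x(1) y(1)
        by (simp add: smult[symmetric] add[symmetric] M.smult_r_distr)
    qed
  next
    fix u assume u: "u \<in> carrier N"
    obtain x where x: "x \<in> carrier M" "u = T x" using ex[OF u] by blast
    show "\<one>\<^bsub>R\<^esub> \<odot>\<^bsub>N\<^esub> u = u" unfolding x(2) using x(1) by (simp add: smult[symmetric])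
  qed
  show "T \<in> module_hom R M N" using TN add smult by (rule module_homI)
qed

lemma restrict_scalars_simps [simp]:
  "carrier (restrict_scalars A M) = carrier M" "ring.add (restrict_scalars A M) = ring.add M"
  "ring.zero (restrict_scalars A M) = ring.zero M"
  "smult (restrict_scalars A M) c x = (c \<odot>\<^bsub>A\<^esub> \<one>\<^bsub>A\<^esub>) \<odot>\<^bsub>M\<^esub> x"
  by (simp_all add: restrict_scalars_def)

lemma module_restrict_scalars:
  assumes A: "algebra k A" and M: "module A M"
  shows "module k (restrict_scalars A M)"
proof -
  interpret A: algebra k A by fact
  interpret M: module A M by fact
  interpret Ak: module k A by (rule A.module)
  have mult: "((c \<otimes>\<^bsub>k\<^esub> d) \<odot>\<^bsub>A\<^esub> \<one>\<^bsub>A\<^esub>) = (c \<odot>\<^bsub>A\<^esub> \<one>\<^bsub>A\<^esub>) \<otimes>\<^bsub>A\<^esub> (d \<odot>\<^bsub>A\<^esub> \<one>\<^bsub>A\<^esub>)" if "c \<in> carrier k" "d \<in> carrier k" for c d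
    using that by (simp add: A.smult_assoc1 A.smult_assoc2)
  show ?thesis
  proof (rule moduleI)
    show "cring k" by (rule A.R_cring)
    show "abelian_group (restrict_scalars A M)"
    proof (rule abelian_groupI)
      fix x assume "x \<in> carrier (restrict_scalars A M)"
      then show "\<exists>y\<in>carrier (restrict_scalars A M). y \<oplus>\<^bsub>restrict_scalars A M\<^esub> x = \<zero>\<^bsub>restrict_scalars A M\<^esub>"
        using M.M.l_neg[of x] by auto
    qed (simp_all add: M.M.a_ac)
    show "(c \<otimes>\<^bsub>k\<^esub> d) \<odot>\<^bsub>restrict_scalars A M\<^esub> x = c \<odot>\<^bsub>restrict_scalars A M\<^esub> (d \<odot>\<^bsub>restrict_scalars A M\<^esub> x)"
      if "c \<in> carrier k" "d \<in> carrier k" "x \<in> carrier (restrict_scalars A M)" for c d x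
      using that by (simp add: mult M.smult_assoc1)
  qed (simp_all add: A.smult_l_distr M.smult_l_distr M.smult_r_distr)
qed

lemma quotient_module_projection:
  fixes M :: "('a, 'm, 'e) module_scheme"
  assumes M: "module R M" and N: "submodule R N M"
  defines "T \<equiv> \<lambda>x. N +>\<^bsub>M\<^esub> x"
  shows "module R (quotient_module M N)" "T \<in> module_hom R M (quotient_module M N)"
    "T ` carrier M = carrier (quotient_module M N)"
    "\<And>x. x \<in> carrier M \<Longrightarrow> T x = \<zero>\<^bsub>quotient_module M N\<^esub> \<longleftrightarrow> x \<in> N"
proof -
  interpret M: module R M by fact
  note Nc = submoduleD(1)[OF N]
  have neg: "\<ominus>\<^bsub>M\<^esub> x \<in> N" if "x \<in> N" for x
  proof -
    have "\<ominus>\<^bsub>M\<^esub> x = (\<ominus>\<^bsub>R\<^esub> \<one>\<^bsub>R\<^esub>) \<odot>\<^bsub>M\<^esub> x" using Nc that by (simp add: M.smult_minus_1 subset_iff)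
    then show ?thesis using submoduleD(4)[OF N _ that, of "\<ominus>\<^bsub>R\<^esub> \<one>\<^bsub>R\<^esub>"] by simp
  qed
  have sg: "subgroup N (add_monoid M)"
    by (rule M.add.subgroupI) (use submoduleD[OF N] neg in auto)
  have as: "abelian_subgroup N M"
    by (rule abelian_subgroupI3[OF additive_subgroupI[OF sg] M.abelian_group_axioms])
  interpret N: abelian_subgroup N M by fact
  show 1: "T ` carrier M = carrier (quotient_module M N)"
    by (auto simp: T_def quotient_module_def A_RCOSETS_def')
  have coset: "N +>\<^bsub>M\<^esub> y = N +>\<^bsub>M\<^esub> x" if "y \<in> N +>\<^bsub>M\<^esub> x" "x \<in> carrier M" for x y
    using N.a_repr_independence'[OF that] by simp
  have smult: "T (r \<odot>\<^bsub>M\<^esub> x) = r \<odot>\<^bsub>quotient_module M N\<^esub> T x" if "r \<in> carrier R" "x \<in> carrier M" for r x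
  proof -
    have "r \<odot>\<^bsub>quotient_module M N\<^esub> T x = (\<Union>y\<in>N +>\<^bsub>M\<^esub> x. N +>\<^bsub>M\<^esub> (r \<odot>\<^bsub>M\<^esub> y))"
      by (simp add: quotient_module_def T_def)
    also have "\<dots> = (\<Union>y\<in>N +>\<^bsub>M\<^esub> x. N +>\<^bsub>M\<^esub> (r \<odot>\<^bsub>M\<^esub> x))"
    proof (intro SUP_cong refl coset)
      fix y assume "y \<in> N +>\<^bsub>M\<^esub> x"
      then obtain n where n: "n \<in> N" "y = n \<oplus>\<^bsub>M\<^esub> x" unfolding a_r_coset_def' by blast
      have "r \<odot>\<^bsub>M\<^esub> y = r \<odot>\<^bsub>M\<^esub> n \<oplus>\<^bsub>M\<^esub> r \<odot>\<^bsub>M\<^esub> x" using n that Nc by (auto simp: M.smult_r_distr)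
      moreover have "r \<odot>\<^bsub>M\<^esub> n \<in> N" using submoduleD(4)[OF N that(1) n(1)] .
      ultimately show "r \<odot>\<^bsub>M\<^esub> y \<in> N +>\<^bsub>M\<^esub> (r \<odot>\<^bsub>M\<^esub> x)" unfolding a_r_coset_def' by blast
    qed (use that in simp)
    also have "\<dots> = N +>\<^bsub>M\<^esub> (r \<odot>\<^bsub>M\<^esub> x)" using N.a_rcos_self[OF that(2)] by blast
    finally show ?thesis by (simp add: T_def)
  qed
  have add: "T (x \<oplus>\<^bsub>M\<^esub> y) = T x \<oplus>\<^bsub>quotient_module M N\<^esub> T y" if "x \<in> carrier M" "y \<in> carrier M" for x y
    using N.a_rcos_sum[OF that] by (simp add: T_def quotient_module_def)
  have zero: "T \<zero>\<^bsub>M\<^esub> = \<zero>\<^bsub>quotient_module M N\<^esub>"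
    using N.a_rcos_const[OF submoduleD(2)[OF N]] by (simp add: T_def quotient_module_def)
  show "module R (quotient_module M N)" "T \<in> module_hom R M (quotient_module M N)"
    by (rule module_surj_image[OF M 1 add smult zero]; assumption)+
  show "T x = \<zero>\<^bsub>quotient_module M N\<^esub> \<longleftrightarrow> x \<in> N" if "x \<in> carrier M" for x
    using N.a_rcos_const[of x] N.a_rcos_self[OF that] by (auto simp: T_def quotient_module_def)
qed

subsection \<open>The dual of a free module of rank one\<close>

definition coordinate :: "('a, 'r) ring_scheme \<Rightarrow> ('a, 'm, 'e) module_scheme \<Rightarrow> 'm \<Rightarrow> 'm \<Rightarrow> 'a" where
  "coordinate R M x = inv_into (carrier R) (\<lambda>a. a \<odot>\<^bsub>M\<^esub> x)"

lemma (in module) coordinate: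
  assumes x: "free_generator R M x"
  shows "l \<in> carrier M \<Longrightarrow> coordinate R M x l \<in> carrier R"
    and "l \<in> carrier M \<Longrightarrow> coordinate R M x l \<odot>\<^bsub>M\<^esub> x = l"
    and "a \<in> carrier R \<Longrightarrow> coordinate R M x (a \<odot>\<^bsub>M\<^esub> x) = a"
    and "\<lbrakk>l \<in> carrier M; l' \<in> carrier M\<rbrakk> \<Longrightarrow>
      coordinate R M x (l \<oplus>\<^bsub>M\<^esub> l') = coordinate R M x l \<oplus> coordinate R M x l'"
    and "\<lbrakk>a \<in> carrier R; l \<in> carrier M\<rbrakk> \<Longrightarrow> coordinate R M x (a \<odot>\<^bsub>M\<^esub> l) = a \<otimes> coordinate R M x l"
    and "coordinate R M x x = \<one>"
proof -
  have b: "bij_betw (\<lambda>a. a \<odot>\<^bsub>M\<^esub> x) (carrier R) (carrier M)" and xc: "x \<in> carrier M"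
    using x by (auto simp: free_generator_def)
  note inj = bij_betw_imp_inj_on[OF b] and surj = bij_betw_imp_surj_on[OF b]
  have 1: "coordinate R M x l \<in> carrier R" if "l \<in> carrier M" for l
    unfolding coordinate_def using that surj by (intro inv_into_into) simp
  have 2: "coordinate R M x l \<odot>\<^bsub>M\<^esub> x = l" if "l \<in> carrier M" for l
    unfolding coordinate_def using f_inv_into_f[of l "\<lambda>a. a \<odot>\<^bsub>M\<^esub> x" "carrier R"] that surj by simp
  have 3: "coordinate R M x (a \<odot>\<^bsub>M\<^esub> x) = a" if "a \<in> carrier R" for a
    unfolding coordinate_def using inv_into_f_f[OF inj that] by simp
  show "l \<in> carrier M \<Longrightarrow> coordinate R M x l \<in> carrier R" by (rule 1)
  show "l \<in> carrier M \<Longrightarrow> coordinate R M x l \<odot>\<^bsub>M\<^esub> x = l" by (rule 2)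
  show "a \<in> carrier R \<Longrightarrow> coordinate R M x (a \<odot>\<^bsub>M\<^esub> x) = a" by (rule 3)
  show "coordinate R M x (l \<oplus>\<^bsub>M\<^esub> l') = coordinate R M x l \<oplus> coordinate R M x l'"
    if l: "l \<in> carrier M" "l' \<in> carrier M"
  proof -
    have "(coordinate R M x l \<oplus> coordinate R M x l') \<odot>\<^bsub>M\<^esub> x = l \<oplus>\<^bsub>M\<^esub> l'"
      using 1 2 l xc by (simp add: smult_l_distr)
    then show ?thesis using 3[of "coordinate R M x l \<oplus> coordinate R M x l'"] 1 l by simp
  qed
  show "coordinate R M x (a \<odot>\<^bsub>M\<^esub> l) = a \<otimes> coordinate R M x l" if l: "a \<in> carrier R" "l \<in> carrier M"
  proof -
    have "(a \<otimes> coordinate R M x l) \<odot>\<^bsub>M\<^esub> x = a \<odot>\<^bsub>M\<^esub> l" using 1 2 l xc by (simp add: smult_assoc1)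
    then show ?thesis using 3[of "a \<otimes> coordinate R M x l"] 1 l by simp
  qed
  show "coordinate R M x x = \<one>" using 3[OF one_closed] xc by simp
qed

text \<open>A homomorphism \<open>\<phi>\<close> is determined by \<open>\<phi>(x)\<close>, namely \<open>\<phi> = \<phi>(x) \<psi>\<close>.\<close>

lemma inverse_bundle_free:
  assumes L: "module A L" and x: "free_generator A L x"
  defines "\<psi> \<equiv> restrict (coordinate A L x) (carrier L)"
  shows "module A (inverse_bundle A L)" "free_generator A (inverse_bundle A L) \<psi>"
    "\<And>a l. \<lbrakk>a \<in> carrier A; l \<in> carrier L\<rbrakk> \<Longrightarrow> (a \<odot>\<^bsub>inverse_bundle A L\<^esub> \<psi>) l = a \<otimes>\<^bsub>A\<^esub> coordinate A L x l"
proof -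
  interpret L: module A L by fact
  let ?D = "inverse_bundle A L"
  note c = L.coordinate[OF x]
  have xc: "x \<in> carrier L" using x by (simp add: free_generator_def)
  define T where "T a = (\<lambda>l\<in>carrier L. a \<otimes>\<^bsub>A\<^esub> coordinate A L x l)" for a
  have car: "carrier ?D = module_hom A L (self_module A) \<inter> extensional (carrier L)"
    by (simp add: inverse_bundle_def hom_module_def)
  have TD: "T a \<in> carrier ?D" if "a \<in> carrier A" for a
    unfolding car using that c
    by (auto intro!: module_homI simp: T_def L.R.r_distr L.R.m_lcomm)
  have Tx: "T (\<phi> x) = \<phi>" if \<phi>: "\<phi> \<in> carrier ?D" for \<phi>
  proof
    fix l
    show "T (\<phi> x) l = \<phi> l"
    proof (cases "l \<in> carrier L")
      case True
      have "\<phi> (coordinate A L x l \<odot>\<^bsub>L\<^esub> x) = coordinate A L x l \<otimes>\<^bsub>A\<^esub> \<phi> x"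
        using \<phi> module_hom_smult[of \<phi> A L "self_module A"] c(1)[OF True] xc unfolding car by simp
      moreover have "\<phi> x \<in> carrier A" using \<phi> xc module_hom_closed[of \<phi> A L "self_module A"] unfolding car by auto
      ultimately show ?thesis using True c(1,2)[OF True] by (simp add: T_def L.R.m_comm)
    next
      case False
      then show ?thesis using \<phi> unfolding car by (auto simp: T_def extensional_def)
    qed
  qed
  have onto: "T ` carrier (self_module A) = carrier ?D"
  proof
    show "T ` carrier (self_module A) \<subseteq> carrier ?D" using TD by auto
    show "carrier ?D \<subseteq> T ` carrier (self_module A)"
    proof
      fix \<phi> assume \<phi>: "\<phi> \<in> carrier ?D"
      have "\<phi> x \<in> carrier A" using \<phi> xc module_hom_closed[of \<phi> A L "self_module A"] unfolding car by auto
      then show "\<phi> \<in> T ` carrier (self_module A)" using Tx[OF \<phi>] by (intro image_eqI[of _ _ "\<phi> x"]) auto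
    qed
  qed
  have add: "T (a \<oplus>\<^bsub>self_module A\<^esub> b) = T a \<oplus>\<^bsub>?D\<^esub> T b" if "a \<in> carrier (self_module A)" "b \<in> carrier (self_module A)" for a b
    using that c(1) by (auto simp: inverse_bundle_def hom_module_def T_def L.R.l_distr)
  have smult: "T (a \<odot>\<^bsub>self_module A\<^esub> b) = a \<odot>\<^bsub>?D\<^esub> T b" if "a \<in> carrier A" "b \<in> carrier (self_module A)" for a b
    using that c(1) by (auto simp: inverse_bundle_def hom_module_def T_def L.R.m_assoc)
  have zero: "T \<zero>\<^bsub>self_module A\<^esub> = \<zero>\<^bsub>?D\<^esub>"
    using c(1) by (auto simp: inverse_bundle_def hom_module_def T_def)
  show "module A ?D" by (rule module_surj_image(1)[OF L.R.module_self_module onto add smult zero])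
  have T\<psi>: "a \<odot>\<^bsub>?D\<^esub> \<psi> = T a" if "a \<in> carrier A" for a
    using that by (auto simp: inverse_bundle_def hom_module_def T_def \<psi>_def)
  show "(a \<odot>\<^bsub>?D\<^esub> \<psi>) l = a \<otimes>\<^bsub>A\<^esub> coordinate A L x l" if "a \<in> carrier A" "l \<in> carrier L" for a l
    using that by (simp add: T\<psi> T_def)
  have inj: "inj_on T (carrier A)"
  proof (rule inj_onI)
    fix a b assume ab: "a \<in> carrier A" "b \<in> carrier A" "T a = T b"
    then have "T a x = T b x" by simp
    then show "a = b" using ab(1,2) xc c(6) by (simp add: T_def)
  qed
  have "T \<one>\<^bsub>A\<^esub> = \<psi>" using c(1) by (auto simp: T_def \<psi>_def)
  then have "\<psi> \<in> carrier ?D" using TD[OF L.R.one_closed] by simp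
  moreover have "bij_betw (\<lambda>a. a \<odot>\<^bsub>?D\<^esub> \<psi>) (carrier A) (carrier ?D)"
    using inj onto T\<psi> by (subst bij_betw_cong[OF T\<psi>]) (auto simp: bij_betw_def)
  ultimately show "free_generator A ?D \<psi>" by (simp add: free_generator_def)
qed

subsection \<open>Tensor product with a free module of rank one\<close>

text \<open>
  Every tensor is of the form \<open>m \<otimes> n\<close>, because \<open>m \<otimes> an = am \<otimes> n\<close>. The map \<open>m \<mapsto> m \<otimes> n\<close> is injective,
  because the bilinear map \<open>(m, an) \<mapsto> am\<close> induces a left inverse.
\<close>

lemma tensor_free_right:
  fixes R :: "('a, 'r) ring_scheme" and M :: "('a, 'm, 'e) module_scheme" and N :: "('a, 'n, 'f) module_scheme"
  assumes M: "module R M" and N: "module R N" and n: "free_generator R N n"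
  defines "T \<equiv> tensor_module R M N" and "\<nu> \<equiv> \<lambda>m. pure_tensor R M N m n"
  shows "module R T" "\<nu> \<in> module_hom R M T" "bij_betw \<nu> (carrier M) (carrier T)"
    "\<And>m a. \<lbrakk>m \<in> carrier M; a \<in> carrier R\<rbrakk> \<Longrightarrow> pure_tensor R M N m (a \<odot>\<^bsub>N\<^esub> n) = \<nu> (a \<odot>\<^bsub>M\<^esub> m)"
proof -
  interpret M: module R M by fact
  interpret N: module R N by fact
  note cn = N.coordinate[OF n]
  have nc: "n \<in> carrier N" using n by (simp add: free_generator_def)
  let ?F = "free_Abelian_group (carrier M \<times> carrier N)"
  let ?H = "tensor_kernel R M N" and ?rel = "tensor_relations R M N"
  interpret F: comm_group ?F by (rule abelian_free_Abelian_group)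
  have fragF: "frag_of (m, y) \<in> carrier ?F" if "m \<in> carrier M" "y \<in> carrier N" for m y
    using that by simp
  have diffF: "c - c' \<in> carrier ?F" if "c \<in> carrier ?F" "c' \<in> carrier ?F" for c c' :: "('m \<times> 'n) \<Rightarrow>\<^sub>0 int"
    using that keys_diff[of c c'] by auto
  have rel_cases: "P c" if "c \<in> ?rel"
    "\<And>m m' y. \<lbrakk>m \<in> carrier M; m' \<in> carrier M; y \<in> carrier N\<rbrakk> \<Longrightarrow> P (frag_of (m \<oplus>\<^bsub>M\<^esub> m', y) - frag_of (m, y) - frag_of (m', y))"
    "\<And>m y y'. \<lbrakk>m \<in> carrier M; y \<in> carrier N; y' \<in> carrier N\<rbrakk> \<Longrightarrow> P (frag_of (m, y \<oplus>\<^bsub>N\<^esub> y') - frag_of (m, y) - frag_of (m, y'))"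
    "\<And>a m y. \<lbrakk>a \<in> carrier R; m \<in> carrier M; y \<in> carrier N\<rbrakk> \<Longrightarrow> P (frag_of (a \<odot>\<^bsub>M\<^esub> m, y) - frag_of (m, a \<odot>\<^bsub>N\<^esub> y))"
    for P c
  proof -
    from that(1) show ?thesis
      unfolding tensor_relations_def
    proof (elim UnE CollectE exE conjE)
      fix m m' y assume c: "c = frag_of (m \<oplus>\<^bsub>M\<^esub> m', y) - frag_of (m, y) - frag_of (m', y)"
        and m: "m \<in> carrier M" "m' \<in> carrier M" "y \<in> carrier N"
      show "P c" unfolding c by (rule that(2)[OF m])
    next
      fix m y y' assume c: "c = frag_of (m, y \<oplus>\<^bsub>N\<^esub> y') - frag_of (m, y) - frag_of (m, y')"
        and m: "m \<in> carrier M" "y \<in> carrier N" "y' \<in> carrier N"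
      show "P c" unfolding c by (rule that(3)[OF m])
    next
      fix a m y assume c: "c = frag_of (a \<odot>\<^bsub>M\<^esub> m, y) - frag_of (m, a \<odot>\<^bsub>N\<^esub> y)"
        and m: "a \<in> carrier R" "m \<in> carrier M" "y \<in> carrier N"
      show "P c" unfolding c by (rule that(4)[OF m])
    qed
  qed
  have relF: "?rel \<subseteq> carrier ?F"
  proof
    fix c assume c: "c \<in> ?rel"
    show "c \<in> carrier ?F"
      by (rule rel_cases[OF c, of "\<lambda>c. c \<in> carrier ?F"]; intro diffF fragF) auto
  qed
  have Hs: "subgroup ?H ?F" unfolding tensor_kernel_def by (rule F.generate_is_subgroup[OF relF])
  have HF: "c \<in> carrier ?F" if "c \<in> ?H" for c using subgroup.subset[OF Hs] that by blast
  have H0: "0 \<in> ?H" using subgroup.one_closed[OF Hs] by simp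
  have Hadd: "c + c' \<in> ?H" if "c \<in> ?H" "c' \<in> ?H" for c c' using subgroup.m_closed[OF Hs that] by simp
  have Hneg: "- c \<in> ?H" if "c \<in> ?H" for c
    using subgroup.m_inv_closed[OF Hs that] HF[OF that] by simp
  have relH: "c \<in> ?H" if "c \<in> ?rel" for c unfolding tensor_kernel_def using that by (rule generate.incl)
  have Hmin: "?H \<subseteq> U" if "?rel \<subseteq> U" "subgroup U ?F" for U
    unfolding tensor_kernel_def using that by (rule F.generate_subgroup_incl)
  interpret H: normal ?H ?F by (rule F.subgroup_imp_normal[OF Hs])
  define q where "q c = ?H #>\<^bsub>?F\<^esub> c" for c
  have qdef: "q c = (\<lambda>h. h + c) ` ?H" for c by (auto simp: q_def r_coset_def)
  have q_eq: "q c = q c' \<longleftrightarrow> c - c' \<in> ?H" for c c'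
  proof
    assume "q c = q c'"
    moreover have "c \<in> q c" using H0 by (auto simp: qdef image_iff intro!: bexI[of _ 0])
    ultimately obtain h where "h \<in> ?H" "c = h + c'" by (auto simp: qdef)
    then show "c - c' \<in> ?H" by simp
  next
    have *: "q c \<subseteq> q c'" if d: "c - c' \<in> ?H" for c c'
    proof
      fix z assume "z \<in> q c"
      then obtain h where h: "h \<in> ?H" "z = h + c" by (auto simp: qdef)
      then have "z = (h + (c - c')) + c'" by simp
      then show "z \<in> q c'" using Hadd[OF h(1) d] unfolding qdef by blast
    qed
    assume d: "c - c' \<in> ?H"
    moreover from Hneg[OF this] have "c' - c \<in> ?H" by simp
    ultimately show "q c = q c'" using * by blast
  qed
  have carT: "carrier T = q ` carrier ?F"
    by (simp add: T_def tensor_module_def Let_def carrier_FactGroup q_def)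
  have addT: "q c \<oplus>\<^bsub>T\<^esub> q c' = q (c + c')" if "c \<in> carrier ?F" "c' \<in> carrier ?F" for c c'
    using H.rcos_sum[OF that] by (simp add: T_def tensor_module_def Let_def q_def)
  have zeroT: "\<zero>\<^bsub>T\<^esub> = q 0" 
    by (simp add: T_def tensor_module_def Let_def qdef)
  have \<nu>: "\<nu> m = q (frag_of (m, n))" for m by (simp add: \<nu>_def pure_tensor_def q_def)
  have pure: "pure_tensor R M N m y = q (frag_of (m, y))" for m y by (simp add: pure_tensor_def q_def)
  have rel1: "frag_of (m \<oplus>\<^bsub>M\<^esub> m', y) - frag_of (m, y) - frag_of (m', y) \<in> ?rel"
    if "m \<in> carrier M" "m' \<in> carrier M" "y \<in> carrier N" for m m' y
    using that unfolding tensor_relations_def by blast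
  have rel2: "frag_of (m, y \<oplus>\<^bsub>N\<^esub> y') - frag_of (m, y) - frag_of (m, y') \<in> ?rel"
    if "m \<in> carrier M" "y \<in> carrier N" "y' \<in> carrier N" for m y y'
    using that unfolding tensor_relations_def by blast
  have rel3: "frag_of (a \<odot>\<^bsub>M\<^esub> m, y) - frag_of (m, a \<odot>\<^bsub>N\<^esub> y) \<in> ?rel"
    if "a \<in> carrier R" "m \<in> carrier M" "y \<in> carrier N" for a m y
    using that unfolding tensor_relations_def by blast
  show pure_mult: "pure_tensor R M N m (a \<odot>\<^bsub>N\<^esub> n) = \<nu> (a \<odot>\<^bsub>M\<^esub> m)" if "m \<in> carrier M" "a \<in> carrier R" for m a
    unfolding pure \<nu> using q_eq[of "frag_of (a \<odot>\<^bsub>M\<^esub> m, n)" "frag_of (m, a \<odot>\<^bsub>N\<^esub> n)"] relH[OF rel3[OF that(2,1) nc]] by simp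
  have \<nu>_add: "\<nu> (m \<oplus>\<^bsub>M\<^esub> m') = \<nu> m \<oplus>\<^bsub>T\<^esub> \<nu> m'" if "m \<in> carrier M" "m' \<in> carrier M" for m m'
  proof -
    have "\<nu> m \<oplus>\<^bsub>T\<^esub> \<nu> m' = q (frag_of (m, n) + frag_of (m', n))"
      unfolding \<nu> by (rule addT[OF fragF fragF]) (use that nc in auto)
    moreover have "frag_of (m \<oplus>\<^bsub>M\<^esub> m', n) - (frag_of (m, n) + frag_of (m', n)) \<in> ?H"
      using relH[OF rel1[OF that nc]] by (simp add: diff_diff_eq)
    ultimately show ?thesis unfolding \<nu> using q_eq by metis
  qed
  have \<nu>_zero: "\<nu> \<zero>\<^bsub>M\<^esub> = \<zero>\<^bsub>T\<^esub>"
  proof -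
    have "frag_of (\<zero>\<^bsub>M\<^esub>, n) - 0 \<in> ?H"
      using Hneg[OF relH[OF rel1[OF M.M.zero_closed M.M.zero_closed nc]]] by simp
    then show ?thesis unfolding \<nu> zeroT using q_eq by metis
  qed
  have \<nu>_smult: "\<nu> (a \<odot>\<^bsub>M\<^esub> m) = a \<odot>\<^bsub>T\<^esub> \<nu> m" if a: "a \<in> carrier R" and m: "m \<in> carrier M" for a m
  proof -
    define E where "E = frag_extend (\<lambda>(m, y :: 'n). frag_of (a \<odot>\<^bsub>M\<^esub> m, y))"
    have Eof: "E (frag_of (m, y)) = frag_of (a \<odot>\<^bsub>M\<^esub> m, y)" for m y by (simp add: E_def)
    have Ediff: "E (c - c') = E c - E c'" and Eadd: "E (c + c') = E c + E c'" and E0: "E 0 = 0" for c c'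
      by (simp_all add: E_def frag_extend_diff frag_extend_add)
    have Eneg: "E (- c) = - E c" for c by (simp add: E_def frag_extend_minus)
    have "subgroup {c \<in> carrier ?F. E c \<in> ?H} ?F"
    proof (rule F.subgroupI)
      show "{c \<in> carrier ?F. E c \<in> ?H} \<noteq> {}" using E0 H0 F.one_closed by force
      show "inv\<^bsub>?F\<^esub> c \<in> {c \<in> carrier ?F. E c \<in> ?H}" if "c \<in> {c \<in> carrier ?F. E c \<in> ?H}" for c
        using that Hneg Eneg by (simp add: keys_minus)
      show "c \<otimes>\<^bsub>?F\<^esub> c' \<in> {c \<in> carrier ?F. E c \<in> ?H}"
        if c: "c \<in> {c \<in> carrier ?F. E c \<in> ?H}" "c' \<in> {c \<in> carrier ?F. E c \<in> ?H}" for c c'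
        using F.m_closed[of c c'] Hadd[of "E c" "E c'"] c unfolding mem_Collect_eq mult_free_Abelian_group Eadd by blast
    qed blast
    moreover have "?rel \<subseteq> {c \<in> carrier ?F. E c \<in> ?H}"
    proof
      fix c assume c: "c \<in> ?rel"
      have "E c \<in> ?rel"
      proof (rule rel_cases[OF c, of "\<lambda>c. E c \<in> ?rel"])
        show "E (frag_of (m \<oplus>\<^bsub>M\<^esub> m', y) - frag_of (m, y) - frag_of (m', y)) \<in> ?rel"
          if "m \<in> carrier M" "m' \<in> carrier M" "y \<in> carrier N" for m m' y
          using rel1[of "a \<odot>\<^bsub>M\<^esub> m" "a \<odot>\<^bsub>M\<^esub> m'" y] that a by (simp add: Ediff Eof M.smult_r_distr)
        show "E (frag_of (m, y \<oplus>\<^bsub>N\<^esub> y') - frag_of (m, y) - frag_of (m, y')) \<in> ?rel"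
          if "m \<in> carrier M" "y \<in> carrier N" "y' \<in> carrier N" for m y y'
          using rel2[of "a \<odot>\<^bsub>M\<^esub> m" y y'] that a by (simp add: Ediff Eof)
        show "E (frag_of (b \<odot>\<^bsub>M\<^esub> m, y) - frag_of (m, b \<odot>\<^bsub>N\<^esub> y)) \<in> ?rel"
          if "b \<in> carrier R" "m \<in> carrier M" "y \<in> carrier N" for b m y
          using rel3[of b "a \<odot>\<^bsub>M\<^esub> m" y] that a by (simp add: Ediff Eof M.smult_assoc1[symmetric] M.R.m_comm)
      qed
      then show "c \<in> {c \<in> carrier ?F. E c \<in> ?H}" using relH relF c by blast
    qed
    ultimately have EH: "E c \<in> ?H" if "c \<in> ?H" for c using Hmin that by blast
    have "a \<odot>\<^bsub>T\<^esub> \<nu> m = (\<Union>c\<in>q (frag_of (m, n)). q (E c))"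
      by (simp add: T_def tensor_module_def Let_def \<nu> q_def E_def)
    also have "\<dots> = (\<Union>c\<in>q (frag_of (m, n)). q (frag_of (a \<odot>\<^bsub>M\<^esub> m, n)))"
    proof (intro SUP_cong refl)
      fix c assume "c \<in> q (frag_of (m, n))"
      then obtain h where h: "h \<in> ?H" "c = h + frag_of (m, n)" by (auto simp: qdef)
      then have "E c - frag_of (a \<odot>\<^bsub>M\<^esub> m, n) = E h" by (simp add: Eadd Eof)
      then show "q (E c) = q (frag_of (a \<odot>\<^bsub>M\<^esub> m, n))" using q_eq EH[OF h(1)] by metis
    qed
    also have "\<dots> = \<nu> (a \<odot>\<^bsub>M\<^esub> m)" unfolding \<nu> using H0 by (simp add: qdef)
    finally show ?thesis by simp
  qed
  have surj: "\<exists>m. m \<in> carrier M \<and> q c = \<nu> m" if c: "Poly_Mapping.keys c \<subseteq> carrier M \<times> carrier N" for c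
  proof (rule free_Abelian_group_induct[OF c, of "\<lambda>c. \<exists>m. m \<in> carrier M \<and> q c = \<nu> m"])
    show "\<exists>m. m \<in> carrier M \<and> q 0 = \<nu> m" using \<nu>_zero zeroT M.M.zero_closed by metis
  next
    fix c c' :: "('m \<times> 'n) \<Rightarrow>\<^sub>0 int"
    assume 2: "Poly_Mapping.keys c \<subseteq> carrier M \<times> carrier N" "Poly_Mapping.keys c' \<subseteq> carrier M \<times> carrier N"
      and "\<exists>m. m \<in> carrier M \<and> q c = \<nu> m" "\<exists>m. m \<in> carrier M \<and> q c' = \<nu> m"
    then obtain m m' where m: "m \<in> carrier M" "q c = \<nu> m" "m' \<in> carrier M" "q c' = \<nu> m'" by blast
    have mm: "m \<ominus>\<^bsub>M\<^esub> m' \<in> carrier M" using m by simp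
    have cF: "c - c' \<in> carrier ?F" "c' \<in> carrier ?F" using diffF[of c c'] 2 by simp_all
    have "q (c - c') \<oplus>\<^bsub>T\<^esub> \<nu> m' = q c" using addT[OF cF] m by simp
    also have "\<dots> = \<nu> (m \<ominus>\<^bsub>M\<^esub> m') \<oplus>\<^bsub>T\<^esub> \<nu> m'"
      using \<nu>_add[OF mm m(3)] m by (simp add: M.M.minus_eq M.M.a_assoc M.M.l_neg)
    finally have "q ((c - c') + frag_of (m', n)) = q (frag_of (m \<ominus>\<^bsub>M\<^esub> m', n) + frag_of (m', n))"
      unfolding \<nu> addT[OF cF(1) fragF[OF m(3) nc]] addT[OF fragF[OF mm nc] fragF[OF m(3) nc]] .
    then have "q (c - c') = \<nu> (m \<ominus>\<^bsub>M\<^esub> m')" unfolding \<nu> q_eq by simp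
    then show "\<exists>m. m \<in> carrier M \<and> q (c - c') = \<nu> m" using mm by blast
  next
    fix p assume "p \<in> carrier M \<times> carrier N"
    then obtain m y where my: "p = (m, y)" "m \<in> carrier M" "y \<in> carrier N" by blast
    obtain a where a: "a \<in> carrier R" "y = a \<odot>\<^bsub>N\<^esub> n" using cn(1,2)[OF my(3)] by metis
    then have "q (frag_of p) = \<nu> (a \<odot>\<^bsub>M\<^esub> m)" using pure_mult[OF my(2) a(1)] my(1) by (simp add: pure)
    then show "\<exists>m. m \<in> carrier M \<and> q (frag_of p) = \<nu> m" using my(2) a(1) by blast
  qed
  have onto: "\<nu> ` carrier M = carrier T"
  proof
    show "\<nu> ` carrier M \<subseteq> carrier T" unfolding carT \<nu> using nc by auto
    show "carrier T \<subseteq> \<nu> ` carrier M"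
    proof
      fix t assume "t \<in> carrier T"
      then obtain c where c: "c \<in> carrier ?F" "t = q c" unfolding carT by blast
      obtain m where "m \<in> carrier M" "q c = \<nu> m" using surj[OF c(1)[unfolded carrier_free_Abelian_group_iff]] by blast
      then show "t \<in> \<nu> ` carrier M" unfolding c(2) by simp
    qed
  qed
  show "module R T" "\<nu> \<in> module_hom R M T"
    by (rule module_surj_image[OF M onto \<nu>_add \<nu>_smult \<nu>_zero]; assumption)+
  have inj: "inj_on \<nu> (carrier M)"
  proof -
    let ?f = "\<lambda>(m, y). coordinate R N n y \<odot>\<^bsub>M\<^esub> m"
    have "?f ` (carrier M \<times> carrier N) \<subseteq> carrier (add_monoid M)" using cn(1) by auto
    then obtain h where h: "h \<in> hom ?F (add_monoid M)"
      "\<And>p. p \<in> carrier M \<times> carrier N \<Longrightarrow> h (frag_of p) = ?f p"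
      by (rule comm_group.free_Abelian_group_universal[OF M.M.a_comm_group]) (rule that; assumption)
    have hc: "h c \<in> carrier M" if "c \<in> carrier ?F" for c using hom_in_carrier[OF h(1) that] by simp
    have hadd: "h (c + c') = h c \<oplus>\<^bsub>M\<^esub> h c'" if "c \<in> carrier ?F" "c' \<in> carrier ?F" for c c'
      using hom_mult[OF h(1) that] by simp
    have hdiff: "h (c - c') = h c \<ominus>\<^bsub>M\<^esub> h c'" if "c \<in> carrier ?F" "c' \<in> carrier ?F" for c c'
    proof -
      have "h c = h (c - c') \<oplus>\<^bsub>M\<^esub> h c'" using hadd[OF diffF[OF that] that(2)] by simp
      then show ?thesis using hc[OF diffF[OF that]] hc[OF that(2)]
        by (simp add: M.M.minus_eq M.M.a_assoc M.M.r_neg)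
    qed
    have hfrag: "h (frag_of (m, y)) = coordinate R N n y \<odot>\<^bsub>M\<^esub> m" if "m \<in> carrier M" "y \<in> carrier N" for m y
      using h(2)[of "(m, y)"] that by simp
    interpret h: group_hom ?F "add_monoid M" h by unfold_locales (rule h(1))
    have "?rel \<subseteq> kernel ?F (add_monoid M) h"
    proof
      fix c assume c: "c \<in> ?rel"
      have "h c = \<zero>\<^bsub>M\<^esub>"
      proof (rule rel_cases[OF c, of "\<lambda>c. h c = \<zero>\<^bsub>M\<^esub>"])
        show "h (frag_of (m \<oplus>\<^bsub>M\<^esub> m', y) - frag_of (m, y) - frag_of (m', y)) = \<zero>\<^bsub>M\<^esub>"
          if "m \<in> carrier M" "m' \<in> carrier M" "y \<in> carrier N" for m m' y
          using that cn(1)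
          by (simp only: hdiff[OF diffF[OF fragF fragF] fragF] hdiff[OF fragF fragF] hfrag M.M.a_closed)
            (simp add: M.smult_r_distr M.M.minus_eq M.M.a_ac M.M.r_neg M.M.r_neg1 M.M.r_neg2)
        show "h (frag_of (m, y \<oplus>\<^bsub>N\<^esub> y') - frag_of (m, y) - frag_of (m, y')) = \<zero>\<^bsub>M\<^esub>"
          if "m \<in> carrier M" "y \<in> carrier N" "y' \<in> carrier N" for m y y'
          using that cn(1)
          by (simp only: hdiff[OF diffF[OF fragF fragF] fragF] hdiff[OF fragF fragF] hfrag N.M.a_closed cn(4))
            (simp add: M.smult_l_distr M.M.minus_eq M.M.a_ac M.M.r_neg M.M.r_neg1 M.M.r_neg2)
        show "h (frag_of (a \<odot>\<^bsub>M\<^esub> m, y) - frag_of (m, a \<odot>\<^bsub>N\<^esub> y)) = \<zero>\<^bsub>M\<^esub>"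
          if "a \<in> carrier R" "m \<in> carrier M" "y \<in> carrier N" for a m y
          using that cn(1)
          by (simp only: hdiff[OF fragF fragF] hfrag M.smult_closed N.smult_closed cn(5))
            (simp add: M.smult_assoc1[symmetric] M.R.m_comm M.M.minus_eq M.M.r_neg)
      qed
      then show "c \<in> kernel ?F (add_monoid M) h" using subsetD[OF relF c] by (simp add: kernel_def)
    qed
    then have "?H \<subseteq> kernel ?F (add_monoid M) h" using Hmin h.subgroup_kernel by blast
    then have kill: "h c = \<zero>\<^bsub>M\<^esub>" if "c \<in> ?H" for c using that by (auto simp: kernel_def)
    show ?thesis
    proof (rule inj_onI)
      fix m m' assume m: "m \<in> carrier M" "m' \<in> carrier M" "\<nu> m = \<nu> m'"
      then have "h (frag_of (m, n) - frag_of (m', n)) = \<zero>\<^bsub>M\<^esub>" using kill q_eq unfolding \<nu> by blast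
      then have "m \<ominus>\<^bsub>M\<^esub> m' = \<zero>\<^bsub>M\<^esub>" using hdiff[OF fragF fragF] hfrag m nc cn(6) by simp
      then show "m = m'" using m by simp
    qed
  qed
  then show "bij_betw \<nu> (carrier M) (carrier T)" using onto by (simp add: bij_betw_def)
qed

text \<open>
  The induced homomorphism is \<open>m \<mapsto> b m n\<close>, transported along \<open>m \<mapsto> m \<otimes> n\<close>. It is unique because
  every tensor is pure.
\<close>

lemma tensor_lift_free_right:
  fixes R :: "('a, 'r) ring_scheme" and M :: "('a, 'm, 'e) module_scheme" and N :: "('a, 'n, 'f) module_scheme"
    and P :: "('a, 'p, 'g) module_scheme"
  assumes M: "module R M" and N: "module R N" and n: "free_generator R N n" and P: "module R P"
    and hom: "(\<lambda>m. b m n) \<in> module_hom R M P"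
    and bal: "\<And>m a. \<lbrakk>m \<in> carrier M; a \<in> carrier R\<rbrakk> \<Longrightarrow> b m (a \<odot>\<^bsub>N\<^esub> n) = b (a \<odot>\<^bsub>M\<^esub> m) n"
    and m: "m \<in> carrier M"
  shows "tensor_lift R M N P b (pure_tensor R M N m n) = b m n"
proof -
  interpret M: module R M by fact
  interpret N: module R N by fact
  let ?T = "tensor_module R M N" and ?\<nu> = "\<lambda>m. pure_tensor R M N m n"
  note t = tensor_free_right[OF M N n]
  interpret T: module R ?T by (rule t(1))
  note cn = N.coordinate[OF n]
  have nc: "n \<in> carrier N" using n by (simp add: free_generator_def)
  note surj = bij_betw_imp_surj_on[OF t(3)] and inj = bij_betw_imp_inj_on[OF t(3)]
  have ex: "\<exists>m. m \<in> carrier M \<and> x = ?\<nu> m" if "x \<in> carrier ?T" for x using that surj by auto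
  define h where "h = (\<lambda>x\<in>carrier ?T. b (inv_into (carrier M) ?\<nu> x) n)"
  have \<nu>c: "?\<nu> m \<in> carrier ?T" if "m \<in> carrier M" for m using that surj by auto
  have h\<nu>: "h (?\<nu> m) = b m n" if "m \<in> carrier M" for m
    using \<nu>c[OF that] inv_into_f_f[OF inj that] by (simp add: h_def)
  have hhom: "h \<in> module_hom R ?T P"
  proof (rule module_homI)
    fix x assume x: "x \<in> carrier ?T"
    obtain m where m: "m \<in> carrier M" "x = ?\<nu> m" using ex[OF x] by blast
    show "h x \<in> carrier P" using h\<nu> m module_hom_closed[OF hom] by auto
    show "h (r \<odot>\<^bsub>?T\<^esub> x) = r \<odot>\<^bsub>P\<^esub> h x" if r: "r \<in> carrier R" for r
      using module_hom_smult[OF t(2) r m(1)] module_hom_smult[OF hom r m(1)] h\<nu>[of "r \<odot>\<^bsub>M\<^esub> m"] h\<nu>[OF m(1)] m r by simp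
    fix y assume y: "y \<in> carrier ?T"
    obtain m' where m': "m' \<in> carrier M" "y = ?\<nu> m'" using ex[OF y] by blast
    show "h (x \<oplus>\<^bsub>?T\<^esub> y) = h x \<oplus>\<^bsub>P\<^esub> h y"
      using module_hom_add[OF t(2) m(1) m'(1)] module_hom_add[OF hom m(1) m'(1)]
        h\<nu>[of "m \<oplus>\<^bsub>M\<^esub> m'"] h\<nu>[OF m(1)] h\<nu>[OF m'(1)] m m' by simp
  qed
  have hpure: "h (pure_tensor R M N m y) = b m y" if m: "m \<in> carrier M" and y: "y \<in> carrier N" for m y
  proof -
    obtain a where a: "a \<in> carrier R" "y = a \<odot>\<^bsub>N\<^esub> n" using cn(1,2)[OF y] by metis
    show ?thesis unfolding a(2) t(4)[OF m a(1)] using h\<nu>[of "a \<odot>\<^bsub>M\<^esub> m"] bal[OF m a(1)] m a(1) by simp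
  qed
  have "tensor_lift R M N P b = h"
    unfolding tensor_lift_def
  proof (rule the_equality)
    show "h \<in> module_hom R ?T P \<and> h \<in> extensional (carrier ?T) \<and>
      (\<forall>m\<in>carrier M. \<forall>n\<in>carrier N. h (pure_tensor R M N m n) = b m n)"
      using hhom hpure by (auto simp: h_def)
    fix h' assume h': "h' \<in> module_hom R ?T P \<and> h' \<in> extensional (carrier ?T) \<and>
      (\<forall>m\<in>carrier M. \<forall>n\<in>carrier N. h' (pure_tensor R M N m n) = b m n)"
    show "h' = h"
    proof (rule extensionalityI)
      show "h' \<in> extensional (carrier ?T)" "h \<in> extensional (carrier ?T)" using h' by (auto simp: h_def)
      fix x assume x: "x \<in> carrier ?T"
      obtain m where m: "m \<in> carrier M" "x = ?\<nu> m" using ex[OF x] by blast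
      show "h' x = h x" using h' hpure m nc by simp
    qed
  qed
  then show ?thesis using hpure[OF m nc] by simp
qed


section \<open>The dualizing module\<close>

text \<open>
  A form \<open>f\<close> that vanishes on the kernel of \<open>S\<close> descends to the image of \<open>S\<close>, from where it is
  extended.
\<close>

lemma (in vectorspace) factor_linear_form:
  assumes fin: "fin_dim" and M: "vectorspace K M" and D: "submodule K D M" and f: "linear_form_on K M D f"
    and S: "S \<in> module_hom K M V"
    and ker: "\<And>x. \<lbrakk>x \<in> D; S x = \<zero>\<^bsub>V\<^esub>\<rbrakk> \<Longrightarrow> f x = \<zero>\<^bsub>K\<^esub>"
  obtains g where "linear_form_on K V (carrier V) g" "\<And>x. x \<in> D \<Longrightarrow> g (S x) = f x"
proof -
  interpret M: vectorspace K M by fact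
  interpret S: mod_hom K M V S by unfold_locales (rule S)
  note D' = submoduleD[OF D]
  have Dc: "x \<in> carrier M" if "x \<in> D" for x using D'(1) that by auto
  have eq: "f x = f y" if "x \<in> D" "y \<in> D" "S x = S y" for x y
  proof -
    have "S (x \<ominus>\<^bsub>M\<^esub> y) = \<zero>\<^bsub>V\<^esub>" using that Dc S.f_im by simp
    then have "f x \<ominus>\<^bsub>K\<^esub> f y = \<zero>\<^bsub>K\<^esub>"
      using ker M.linear_form_on_minus[OF f D that(1,2)] by simp
    then show ?thesis using linear_form_onD(1)[OF f] that by simp
  qed
  have U: "submodule K (S ` D) V"
  proof (rule submodule_criterion[OF module_axioms])
    show "S ` D \<subseteq> carrier V" using Dc S.f_im by auto
    show "\<zero>\<^bsub>V\<^esub> \<in> S ` D" using D'(2) S.f0_is_0 by (metis imageI)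
    fix u assume "u \<in> S ` D"
    then obtain x where x: "x \<in> D" "u = S x" by blast
    show "c \<odot>\<^bsub>V\<^esub> u \<in> S ` D" if "c \<in> carrier K" for c
      using D'(4)[OF that x(1)] S.f_smult[OF that Dc[OF x(1)]] x(2) by (metis imageI)
    fix v assume "v \<in> S ` D"
    then obtain y where y: "y \<in> D" "v = S y" by blast
    show "u \<oplus>\<^bsub>V\<^esub> v \<in> S ` D"
      using D'(3)[OF x(1) y(1)] S.f_add[OF Dc[OF x(1)] Dc[OF y(1)]] x(2) y(2) by (metis imageI)
  qed
  define h where "h u = f (inv_into D S u)" for u
  have h: "h (S x) = f x" if "x \<in> D" for x
    unfolding h_def using that by (intro eq inv_into_into f_inv_into_f) auto
  have "linear_form_on K V (S ` D) h"
  proof (rule linear_form_onI)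
    fix u assume "u \<in> S ` D"
    then obtain x where x: "x \<in> D" "u = S x" by blast
    show "h u \<in> carrier K" unfolding x(2) h[OF x(1)] by (rule linear_form_onD(1)[OF f x(1)])
    show "h (c \<odot>\<^bsub>V\<^esub> u) = c \<otimes>\<^bsub>K\<^esub> h u" if c: "c \<in> carrier K" for c
      unfolding x(2) h[OF x(1)]
      using h[OF D'(4)[OF c x(1)]] S.f_smult[OF c Dc[OF x(1)]] linear_form_onD(3)[OF f c x(1)] by simp
    fix v assume "v \<in> S ` D"
    then obtain y where y: "y \<in> D" "v = S y" by blast
    show "h (u \<oplus>\<^bsub>V\<^esub> v) = h u \<oplus>\<^bsub>K\<^esub> h v"
      unfolding x(2) y(2) h[OF x(1)] h[OF y(1)]
      using h[OF D'(3)[OF x(1) y(1)]] S.f_add[OF Dc[OF x(1)] Dc[OF y(1)]]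
        linear_form_onD(2)[OF f x(1) y(1)] by simp
  qed
  then obtain g where g: "linear_form_on K V (carrier V) g" "\<And>u. u \<in> S ` D \<Longrightarrow> g u = h u"
    using extend_linear_form[OF fin U] by blast
  show thesis using that[OF g(1)] g(2) h by simp
qed

lemma (in vectorspace) exists_nonvanishing_form:
  assumes fin: "fin_dim" and a: "a \<in> carrier V" "a \<noteq> \<zero>\<^bsub>V\<^esub>"
  obtains g where "linear_form_on K V (carrier V) g" "g a \<noteq> \<zero>\<^bsub>K\<^esub>"
proof -
  have mk: "module K (self_module K)" by (rule R.module_self_module)
  then have vk: "vectorspace K (self_module K)" by (simp add: vectorspace_def field_axioms)
  have S: "(\<lambda>c. c \<odot>\<^bsub>V\<^esub> a) \<in> module_hom K (self_module K) V"
    by (rule module_homI) (use a in \<open>auto simp: smult_l_distr smult_assoc1\<close>)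
  have f: "linear_form_on K (self_module K) (carrier K) (\<lambda>c. c)"
    by (rule linear_form_onI) auto
  have sub: "submodule K (carrier K) (self_module K)" using submodule_carrier[OF mk] by simp
  have ker: "c = \<zero>\<^bsub>K\<^esub>" if "c \<in> carrier K" "c \<odot>\<^bsub>V\<^esub> a = \<zero>\<^bsub>V\<^esub>" for c
  proof (rule ccontr)
    assume c: "c \<noteq> \<zero>\<^bsub>K\<^esub>"
    have "a = inv\<^bsub>K\<^esub> c \<odot>\<^bsub>V\<^esub> \<zero>\<^bsub>V\<^esub>" by (rule mult_inverse[OF that(1) a(1) that(2) c])
    then show False using a(2) inverse_exists[OF that(1) c] by simp
  qed
  obtain g where g: "linear_form_on K V (carrier V) g" "\<And>c. c \<in> carrier K \<Longrightarrow> g (c \<odot>\<^bsub>V\<^esub> a) = c"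
    using factor_linear_form[OF fin vk sub f S ker] by blast
  have "g a = \<one>\<^bsub>K\<^esub>" using g(2)[OF R.one_closed] a by simp
  then show thesis using that[OF g(1)] by simp
qed

lemma (in vectorspace) subspace_fin_dim:
  assumes fin: "fin_dim" and W: "submodule K W V"
  shows "vectorspace K (V\<lparr>carrier := W\<rparr>)" "vectorspace.fin_dim K (V\<lparr>carrier := W\<rparr>)"
proof -
  have "subspace K W V" by (simp add: subspace_def W vectorspace_axioms)
  then show vs: "vectorspace K (V\<lparr>carrier := W\<rparr>)" by (rule subspace_is_vs)
  obtain S where S: "finite S" "S \<subseteq> W" "span S = W" using max_indpt_attained[OF fin W] by metis
  then show "vectorspace.fin_dim K (V\<lparr>carrier := W\<rparr>)"
    unfolding vectorspace.fin_dim_def[OF vs] using span_li_not_depend(1)[OF S(2) W] by auto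
qed

lemma dualizing_simps:
  "\<kappa> \<in> carrier (dualizing_module k A) \<longleftrightarrow> linear_form_on k A (carrier A) \<kappa> \<and> \<kappa> \<in> extensional (carrier A)"
  "\<kappa> \<oplus>\<^bsub>dualizing_module k A\<^esub> \<kappa>' = (\<lambda>x\<in>carrier A. \<kappa> x \<oplus>\<^bsub>k\<^esub> \<kappa>' x)"
  "\<zero>\<^bsub>dualizing_module k A\<^esub> = (\<lambda>x\<in>carrier A. \<zero>\<^bsub>k\<^esub>)"
  "a \<odot>\<^bsub>dualizing_module k A\<^esub> \<kappa> = (\<lambda>x\<in>carrier A. \<kappa> (a \<otimes>\<^bsub>A\<^esub> x))"
  by (auto simp: dualizing_module_def hom_module_def linear_form_on_def module_hom_def)

lemma module_dualizing_module:
  fixes k :: "('k, 'z) ring_scheme" and A :: "('k, 'a) module"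
  assumes A: "algebra k A"
  shows "module A (dualizing_module k A)"
proof -
  interpret Ar: cring A by (rule algebra.M_cring[OF A])
  interpret k: cring k by (rule algebra.R_cring[OF A])
  note cs = module.smult_closed[OF algebra.module[OF A]]
  let ?K = "dualizing_module k A"
  have v: "\<kappa> x \<in> carrier k" if "\<kappa> \<in> carrier ?K" "x \<in> carrier A" for \<kappa> x
    using that by (auto simp: dualizing_simps linear_form_on_def)
  have va: "\<kappa> (x \<oplus>\<^bsub>A\<^esub> y) = \<kappa> x \<oplus>\<^bsub>k\<^esub> \<kappa> y" if "\<kappa> \<in> carrier ?K" "x \<in> carrier A" "y \<in> carrier A" for \<kappa> x y
    using that by (auto simp: dualizing_simps linear_form_on_def)
  have vs: "\<kappa> (c \<odot>\<^bsub>A\<^esub> x) = c \<otimes>\<^bsub>k\<^esub> \<kappa> x" if "\<kappa> \<in> carrier ?K" "c \<in> carrier k" "x \<in> carrier A" for \<kappa> c x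
    using that by (auto simp: dualizing_simps linear_form_on_def)
  have ext: "\<kappa> = \<kappa>'" if "\<kappa> \<in> extensional (carrier A)" "\<kappa>' \<in> extensional (carrier A)"
    "\<And>x. x \<in> carrier A \<Longrightarrow> \<kappa> x = \<kappa>' x" for \<kappa> \<kappa>' :: "'a \<Rightarrow> 'k"
    using that by (rule extensionalityI)
  have kE: "\<kappa> \<in> extensional (carrier A)" if "\<kappa> \<in> carrier ?K" for \<kappa> using that by (simp add: dualizing_simps)
  have addc: "\<kappa> \<oplus>\<^bsub>?K\<^esub> \<kappa>' \<in> carrier ?K" if "\<kappa> \<in> carrier ?K" "\<kappa>' \<in> carrier ?K" for \<kappa> \<kappa>'
    unfolding dualizing_simps(1,2)
    using that by (auto intro!: linear_form_onI simp: cs v va vs k.a_ac k.r_distr)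
  have zeroc: "\<zero>\<^bsub>?K\<^esub> \<in> carrier ?K"
    unfolding dualizing_simps(1,3) by (auto intro!: linear_form_onI simp: cs)
  have smultc: "a \<odot>\<^bsub>?K\<^esub> \<kappa> \<in> carrier ?K" if "a \<in> carrier A" "\<kappa> \<in> carrier ?K" for a \<kappa>
  proof -
    have "a \<otimes>\<^bsub>A\<^esub> (c \<odot>\<^bsub>A\<^esub> x) = c \<odot>\<^bsub>A\<^esub> (a \<otimes>\<^bsub>A\<^esub> x)" if "c \<in> carrier k" "x \<in> carrier A" for c x
      using algebra.smult_assoc2[OF A, of c x a] that \<open>a \<in> carrier A\<close> cs[of c x]
        Ar.m_comm[of a "c \<odot>\<^bsub>A\<^esub> x"] Ar.m_comm[of a x] by simp
    then show ?thesis unfolding dualizing_simps(1,4)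
      using that by (auto intro!: linear_form_onI simp: cs v va vs Ar.r_distr)
  qed
  have negc: "(\<lambda>x\<in>carrier A. \<ominus>\<^bsub>k\<^esub> \<kappa> x) \<in> carrier ?K" if "\<kappa> \<in> carrier ?K" for \<kappa>
    unfolding dualizing_simps(1)
    using that by (auto intro!: linear_form_onI simp: cs v va vs k.minus_add k.r_minus)
  show ?thesis
  proof (rule moduleI)
    show "cring A" by (rule algebra.M_cring[OF A])
    show "abelian_group ?K"
    proof (rule abelian_groupI)
      show "\<kappa> \<oplus>\<^bsub>?K\<^esub> \<kappa>' \<in> carrier ?K" if "\<kappa> \<in> carrier ?K" "\<kappa>' \<in> carrier ?K" for \<kappa> \<kappa>' using addc that .
      show "\<zero>\<^bsub>?K\<^esub> \<in> carrier ?K" by (rule zeroc)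
      show "\<kappa> \<oplus>\<^bsub>?K\<^esub> \<kappa>' \<oplus>\<^bsub>?K\<^esub> \<kappa>'' = \<kappa> \<oplus>\<^bsub>?K\<^esub> (\<kappa>' \<oplus>\<^bsub>?K\<^esub> \<kappa>'')"
        if "\<kappa> \<in> carrier ?K" "\<kappa>' \<in> carrier ?K" "\<kappa>'' \<in> carrier ?K" for \<kappa> \<kappa>' \<kappa>''
        by (rule ext) (use that in \<open>auto simp: dualizing_simps(2) v k.a_assoc\<close>)
      show "\<kappa> \<oplus>\<^bsub>?K\<^esub> \<kappa>' = \<kappa>' \<oplus>\<^bsub>?K\<^esub> \<kappa>" if "\<kappa> \<in> carrier ?K" "\<kappa>' \<in> carrier ?K" for \<kappa> \<kappa>'
        by (rule ext) (use that in \<open>auto simp: dualizing_simps(2) v k.a_comm\<close>)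
      show "\<zero>\<^bsub>?K\<^esub> \<oplus>\<^bsub>?K\<^esub> \<kappa> = \<kappa>" if "\<kappa> \<in> carrier ?K" for \<kappa>
        by (rule ext) (use that kE in \<open>auto simp: dualizing_simps(2,3) v\<close>)
      show "\<exists>\<kappa>'\<in>carrier ?K. \<kappa>' \<oplus>\<^bsub>?K\<^esub> \<kappa> = \<zero>\<^bsub>?K\<^esub>" if "\<kappa> \<in> carrier ?K" for \<kappa>
      proof (rule bexI[OF _ negc[OF that]], rule ext)
        show "(\<lambda>x\<in>carrier A. \<ominus>\<^bsub>k\<^esub> \<kappa> x) \<oplus>\<^bsub>?K\<^esub> \<kappa> \<in> extensional (carrier A)" by (simp add: dualizing_simps(2))
        show "\<zero>\<^bsub>?K\<^esub> \<in> extensional (carrier A)" by (simp add: dualizing_simps(3))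
        show "((\<lambda>x\<in>carrier A. \<ominus>\<^bsub>k\<^esub> \<kappa> x) \<oplus>\<^bsub>?K\<^esub> \<kappa>) x = \<zero>\<^bsub>?K\<^esub> x" if "x \<in> carrier A" for x
          using that v[OF \<open>\<kappa> \<in> carrier ?K\<close>] by (simp add: dualizing_simps(2,3) k.l_neg)
      qed
    qed
    show "a \<odot>\<^bsub>?K\<^esub> \<kappa> \<in> carrier ?K" if "a \<in> carrier A" "\<kappa> \<in> carrier ?K" for a \<kappa> using smultc that .
    show "(a \<oplus>\<^bsub>A\<^esub> b) \<odot>\<^bsub>?K\<^esub> \<kappa> = a \<odot>\<^bsub>?K\<^esub> \<kappa> \<oplus>\<^bsub>?K\<^esub> b \<odot>\<^bsub>?K\<^esub> \<kappa>"
      if "a \<in> carrier A" "b \<in> carrier A" "\<kappa> \<in> carrier ?K" for a b \<kappa>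
      by (rule ext) (use that in \<open>auto simp: dualizing_simps(2,4) v va Ar.l_distr\<close>)
    show "a \<odot>\<^bsub>?K\<^esub> (\<kappa> \<oplus>\<^bsub>?K\<^esub> \<kappa>') = a \<odot>\<^bsub>?K\<^esub> \<kappa> \<oplus>\<^bsub>?K\<^esub> a \<odot>\<^bsub>?K\<^esub> \<kappa>'"
      if "a \<in> carrier A" "\<kappa> \<in> carrier ?K" "\<kappa>' \<in> carrier ?K" for a \<kappa> \<kappa>'
      by (rule ext) (use that in \<open>auto simp: dualizing_simps(2,4) v\<close>)
    show "(a \<otimes>\<^bsub>A\<^esub> b) \<odot>\<^bsub>?K\<^esub> \<kappa> = a \<odot>\<^bsub>?K\<^esub> (b \<odot>\<^bsub>?K\<^esub> \<kappa>)"
      if "a \<in> carrier A" "b \<in> carrier A" "\<kappa> \<in> carrier ?K" for a b \<kappa>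
      by (rule ext) (use that in \<open>auto simp: dualizing_simps(4) Ar.m_ac\<close>)
    show "\<one>\<^bsub>A\<^esub> \<odot>\<^bsub>?K\<^esub> \<kappa> = \<kappa>" if "\<kappa> \<in> carrier ?K" for \<kappa>
      by (rule ext) (use that kE in \<open>auto simp: dualizing_simps(4)\<close>)
  qed
qed

lemma linear_form_dualizing:
  assumes "linear_form_on k A (carrier A) g" "module k A"
  shows "restrict g (carrier A) \<in> carrier (dualizing_module k A)"
proof -
  interpret module k A by fact
  show ?thesis unfolding dualizing_simps
    using linear_form_onD[OF assms(1)] by (auto intro!: linear_form_onI)
qed

text \<open>
  A form that vanishes on the common annihilator of \<open>F\<close> is a sum of multiples \<open>j \<lambda>\<^sub>j\<close> with \<open>j \<in> F\<close>; the
  set \<open>X\<close> stands for any set of forms that contains these multiples and is closed under addition. Peel off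
  one \<open>j\<close> at a time. On the common annihilator \<open>N\<close> of the other elements, \<open>\<kappa>\<close> factors through
  multiplication by \<open>j\<close>, so it agrees there with some \<open>j \<lambda>\<close>.
\<close>

lemma form_vanishing_on_annihilator:
  assumes k: "field k" and A: "algebra k A" and fin: "vectorspace.fin_dim k A"
    and F: "finite F" "F \<subseteq> carrier A"
    and X0: "\<zero>\<^bsub>dualizing_module k A\<^esub> \<in> X"
    and Xadd: "\<And>\<kappa> \<kappa>'. \<lbrakk>\<kappa> \<in> X; \<kappa>' \<in> X\<rbrakk> \<Longrightarrow> \<kappa> \<oplus>\<^bsub>dualizing_module k A\<^esub> \<kappa>' \<in> X"
    and XF: "\<And>j \<kappa>. \<lbrakk>j \<in> F; \<kappa> \<in> carrier (dualizing_module k A)\<rbrakk> \<Longrightarrow> j \<odot>\<^bsub>dualizing_module k A\<^esub> \<kappa> \<in> X"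
    and \<kappa>: "\<kappa> \<in> carrier (dualizing_module k A)"
      "\<And>a. \<lbrakk>a \<in> carrier A; \<And>j. j \<in> F \<Longrightarrow> j \<otimes>\<^bsub>A\<^esub> a = \<zero>\<^bsub>A\<^esub>\<rbrakk> \<Longrightarrow> \<kappa> a = \<zero>\<^bsub>k\<^esub>"
  shows "\<kappa> \<in> X"
  using F XF \<kappa>
proof (induction F arbitrary: \<kappa> rule: finite_induct)
  case empty
  have "\<kappa> = \<zero>\<^bsub>dualizing_module k A\<^esub>"
  proof (rule extensionalityI[of _ "carrier A"])
    show "\<kappa> \<in> extensional (carrier A)" using empty by (simp add: dualizing_simps)
    show "\<zero>\<^bsub>dualizing_module k A\<^esub> \<in> extensional (carrier A)" by (simp add: dualizing_simps)
    show "\<kappa> x = \<zero>\<^bsub>dualizing_module k A\<^esub> x" if "x \<in> carrier A" for x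
      using empty(4)[OF that] that by (simp add: dualizing_simps)
  qed
  then show ?case using X0 by simp
next
  case (insert j F)
  interpret Ar: cring A by (rule algebra.M_cring[OF A])
  interpret V: vectorspace k A by (simp add: vectorspace_def algebra.module[OF A] k)
  let ?K = "dualizing_module k A"
  interpret K: module A ?K by (rule module_dualizing_module[OF A])
  have j: "j \<in> carrier A" and Fc: "F \<subseteq> carrier A" using insert.prems(1) by auto
  define N where "N = {a \<in> carrier A. \<forall>i\<in>F. i \<otimes>\<^bsub>A\<^esub> a = \<zero>\<^bsub>A\<^esub>}"
  have sm: "i \<otimes>\<^bsub>A\<^esub> (c \<odot>\<^bsub>A\<^esub> x) = c \<odot>\<^bsub>A\<^esub> (i \<otimes>\<^bsub>A\<^esub> x)"
    if "i \<in> carrier A" "c \<in> carrier k" "x \<in> carrier A" for i c x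
    using algebra.smult_assoc2[OF A, of c x i] that by (simp add: Ar.m_comm)
  have N: "submodule k N A"
  proof (rule submodule_criterion[OF algebra.module[OF A]])
    show "N \<subseteq> carrier A" by (auto simp: N_def)
    show "\<zero>\<^bsub>A\<^esub> \<in> N" using Fc by (auto simp: N_def)
    show "x \<oplus>\<^bsub>A\<^esub> y \<in> N" if "x \<in> N" "y \<in> N" for x y
      using that Fc by (auto simp: N_def Ar.r_distr subset_iff)
    show "c \<odot>\<^bsub>A\<^esub> x \<in> N" if "c \<in> carrier k" "x \<in> N" for c x
      using that Fc by (auto simp: N_def sm subset_iff)
  qed
  have \<kappa>form: "linear_form_on k A (carrier A) \<kappa>" using insert.prems(3) by (simp add: dualizing_simps)
  have f: "linear_form_on k A N \<kappa>"
    using \<kappa>form submoduleD(1)[OF N] by (auto simp: linear_form_on_def subset_iff)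
  have S: "(\<lambda>a. j \<otimes>\<^bsub>A\<^esub> a) \<in> module_hom k A A"
    by (rule module_homI) (use j in \<open>auto simp: Ar.r_distr sm\<close>)
  have ker: "\<kappa> x = \<zero>\<^bsub>k\<^esub>" if "x \<in> N" "j \<otimes>\<^bsub>A\<^esub> x = \<zero>\<^bsub>A\<^esub>" for x
    by (rule insert.prems(4)) (use that in \<open>auto simp: N_def\<close>)
  obtain g where g: "linear_form_on k A (carrier A) g" "\<And>x. x \<in> N \<Longrightarrow> g (j \<otimes>\<^bsub>A\<^esub> x) = \<kappa> x"
    using V.factor_linear_form[OF fin V.vectorspace_axioms N f S ker] by blast
  define lam where "lam = restrict g (carrier A)"
  have lam: "lam \<in> carrier ?K" unfolding lam_def by (rule linear_form_dualizing[OF g(1) algebra.module[OF A]])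
  have jlam: "j \<odot>\<^bsub>?K\<^esub> lam \<in> carrier ?K" using j lam by simp
  have jx: "j \<odot>\<^bsub>?K\<^esub> lam \<in> X" using insert.prems(2) lam by simp
  let ?\<mu> = "\<kappa> \<ominus>\<^bsub>?K\<^esub> j \<odot>\<^bsub>?K\<^esub> lam"
  have \<mu>: "?\<mu> \<in> carrier ?K" using insert.prems(3) jlam by simp
  have \<kappa>eq: "\<kappa> = ?\<mu> \<oplus>\<^bsub>?K\<^esub> j \<odot>\<^bsub>?K\<^esub> lam"
    using insert.prems(3) jlam by (simp add: K.M.minus_eq K.M.a_assoc K.M.l_neg)
  have \<mu>k: "?\<mu> a \<in> carrier k" if "a \<in> carrier A" for a
    using \<mu> that by (simp add: dualizing_simps linear_form_on_def)
  have "?\<mu> \<in> X"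
  proof (rule insert.IH[OF Fc _ \<mu>])
    show "i \<odot>\<^bsub>?K\<^esub> \<kappa>' \<in> X" if "i \<in> F" "\<kappa>' \<in> carrier ?K" for i \<kappa>' using insert.prems(2) that by simp
    fix a assume a: "a \<in> carrier A" "\<And>i. i \<in> F \<Longrightarrow> i \<otimes>\<^bsub>A\<^esub> a = \<zero>\<^bsub>A\<^esub>"
    have aN: "a \<in> N" using a by (simp add: N_def)
    have "(j \<odot>\<^bsub>?K\<^esub> lam) a = \<kappa> a" using g(2)[OF aN] a j by (simp add: dualizing_simps lam_def)
    moreover have "\<kappa> a = (?\<mu> \<oplus>\<^bsub>?K\<^esub> j \<odot>\<^bsub>?K\<^esub> lam) a" using \<kappa>eq by simp
    moreover have "(?\<mu> \<oplus>\<^bsub>?K\<^esub> j \<odot>\<^bsub>?K\<^esub> lam) a = ?\<mu> a \<oplus>\<^bsub>k\<^esub> (j \<odot>\<^bsub>?K\<^esub> lam) a"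
      using a(1) by (simp add: dualizing_simps(2))
    ultimately have "\<kappa> a = ?\<mu> a \<oplus>\<^bsub>k\<^esub> \<kappa> a" by simp
    then show "?\<mu> a = \<zero>\<^bsub>k\<^esub>"
      using \<mu>k[OF a(1)] linear_form_onD(1)[OF \<kappa>form a(1)] by (metis V.R.add.r_cancel_one')
  qed
  then show ?case using Xadd[OF _ jx] \<kappa>eq by metis
qed


section \<open>Restriction to a subscheme and its residual scheme\<close>

lemma algebra_length_function:
  assumes k: "field k" and A: "algebra k A" and fin: "vectorspace.fin_dim k A"
  shows "\<exists>d. length_function A d"
proof -
  interpret Ar: cring A by (rule algebra.M_cring[OF A])
  interpret V: vectorspace k A by (simp add: vectorspace_def algebra.module[OF A] k)
  have sub: "submodule k I A" if I: "ideal I A" for I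
  proof -
    interpret I: ideal I A by fact
    show ?thesis
    proof (rule submodule_criterion[OF algebra.module[OF A]])
      show "I \<subseteq> carrier A" using I.Icarr by blast
      show "\<zero>\<^bsub>A\<^esub> \<in> I" by (rule I.zero_closed)
      show "x \<oplus>\<^bsub>A\<^esub> y \<in> I" if "x \<in> I" "y \<in> I" for x y using that by (rule I.a_closed)
      show "c \<odot>\<^bsub>A\<^esub> x \<in> I" if "c \<in> carrier k" "x \<in> I" for c x
      proof -
        have xc: "x \<in> carrier A" using that I.Icarr by blast
        have "c \<odot>\<^bsub>A\<^esub> x = (c \<odot>\<^bsub>A\<^esub> \<one>\<^bsub>A\<^esub>) \<otimes>\<^bsub>A\<^esub> x"
          using algebra.smult_assoc2[OF A that(1) Ar.one_closed xc] xc by simp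
        then show ?thesis using I.I_l_closed[OF that(2)] V.smult_closed[OF that(1) Ar.one_closed] by simp
      qed
    qed
  qed
  have "length_function A V.max_indpt"
    unfolding length_function_def using V.max_indpt_strict_mono[OF fin sub sub] by blast
  then show ?thesis by blast
qed

lemma ideal_times_submodule:
  assumes M: "module A M" and I: "I \<subseteq> carrier A"
  shows "submodule A (ideal_times A I M) M"
    and "\<And>i x. \<lbrakk>i \<in> I; x \<in> carrier M\<rbrakk> \<Longrightarrow> i \<odot>\<^bsub>M\<^esub> x \<in> ideal_times A I M"
    and "\<And>U. \<lbrakk>submodule A U M; \<And>i x. \<lbrakk>i \<in> I; x \<in> carrier M\<rbrakk> \<Longrightarrow> i \<odot>\<^bsub>M\<^esub> x \<in> U\<rbrakk> \<Longrightarrow> ideal_times A I M \<subseteq> U"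
proof -
  interpret M: module A M by fact
  let ?S = "{a \<odot>\<^bsub>M\<^esub> x | a x. a \<in> I \<and> x \<in> carrier M}"
  have S: "?S \<subseteq> carrier M" using I by auto
  show "submodule A (ideal_times A I M) M" unfolding ideal_times_def by (rule M.span_is_submodule[OF S])
  show "i \<odot>\<^bsub>M\<^esub> x \<in> ideal_times A I M" if "i \<in> I" "x \<in> carrier M" for i x
    unfolding ideal_times_def using M.in_own_span[OF S] that by blast
  show "ideal_times A I M \<subseteq> U" if "submodule A U M" "\<And>i x. \<lbrakk>i \<in> I; x \<in> carrier M\<rbrakk> \<Longrightarrow> i \<odot>\<^bsub>M\<^esub> x \<in> U" for U
    unfolding ideal_times_def by (rule M.span_is_subset[OF _ that(1)]) (use that(2) in blast)
qed

lemma ideal_times_free: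
  assumes L: "module A L" and x: "free_generator A L x" and I: "ideal I A"
  shows "l \<in> ideal_times A I L \<longleftrightarrow> l \<in> carrier L \<and> coordinate A L x l \<in> I"
proof -
  interpret L: module A L by fact
  interpret I: ideal I A by fact
  note c = L.coordinate[OF x]
  have Ic: "I \<subseteq> carrier A" using I.Icarr by blast
  note t = ideal_times_submodule[OF L Ic]
  have z: "coordinate A L x \<zero>\<^bsub>L\<^esub> = \<zero>\<^bsub>A\<^esub>" using c(5)[OF L.R.zero_closed L.M.zero_closed] c(1)[OF L.M.zero_closed] by simp
  have U: "submodule A {l \<in> carrier L. coordinate A L x l \<in> I} L"
    by (rule submodule_criterion[OF L]) (auto simp: c(4,5) z I.I_l_closed)
  have "ideal_times A I L \<subseteq> {l \<in> carrier L. coordinate A L x l \<in> I}"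
    by (rule t(3)[OF U]) (use Ic in \<open>auto simp: c(1,5) I.I_r_closed\<close>)
  moreover have "l \<in> ideal_times A I L" if "l \<in> carrier L" "coordinate A L x l \<in> I"
    using t(2)[OF that(2), of x] c(2)[OF that(1)] x by (simp add: free_generator_def)
  ultimately show ?thesis by blast
qed

lemma residual_ideal_subset: "residual_ideal A I \<subseteq> carrier A"
  by (auto simp: residual_ideal_def)

lemma module_hom_restrict_scalars:
  assumes A: "algebra k A" and f: "f \<in> module_hom A M N"
  shows "f \<in> module_hom k (restrict_scalars A M) (restrict_scalars A N)"
proof -
  interpret Ar: cring A by (rule algebra.M_cring[OF A])
  note cs = module.smult_closed[OF algebra.module[OF A]]
  show ?thesis
    by (rule module_homI)
      (use module_hom_closed[OF f] module_hom_add[OF f] module_hom_smult[OF f] in \<open>auto simp: cs\<close>)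
qed

lemma submodule_image:
  assumes M: "module R M" and N: "module R N" and f: "f \<in> module_hom R M N" and U: "submodule R U M"
  shows "submodule R (f ` U) N"
proof -
  interpret f: mod_hom R M N f using M N f by (simp add: mod_hom_def mod_hom_axioms_def)
  note U' = submoduleD[OF U]
  have Uc: "u \<in> carrier M" if "u \<in> U" for u using U'(1) that by auto
  show ?thesis
  proof (rule submodule_criterion[OF N])
    show "f ` U \<subseteq> carrier N" using Uc f.f_im by auto
    show "\<zero>\<^bsub>N\<^esub> \<in> f ` U" using U'(2) f.f0_is_0 by (metis imageI)
    fix y assume "y \<in> f ` U"
    then obtain u where u: "u \<in> U" "y = f u" by blast
    show "r \<odot>\<^bsub>N\<^esub> y \<in> f ` U" if "r \<in> carrier R" for r
      using U'(4)[OF that u(1)] f.f_smult[OF that Uc[OF u(1)]] u(2) by (metis imageI)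
    fix z assume "z \<in> f ` U"
    then obtain v where v: "v \<in> U" "z = f v" by blast
    show "y \<oplus>\<^bsub>N\<^esub> z \<in> f ` U"
      using U'(3)[OF u(1) v(1)] f.f_add[OF Uc[OF u(1)] Uc[OF v(1)]] u(2) v(2) by (metis imageI)
  qed
qed

lemma module_hom_comp:
  assumes "f \<in> module_hom R M N" "g \<in> module_hom R N P"
  shows "(\<lambda>x. g (f x)) \<in> module_hom R M P"
  using assms by (auto simp: module_hom_def Pi_def)

lemma ideal_times_iso:
  assumes M: "module A M" and N: "module A N" and f: "f \<in> module_hom A M N" "bij_betw f (carrier M) (carrier N)"
    and J: "J \<subseteq> carrier A" and m: "m \<in> carrier M"
  shows "f m \<in> ideal_times A J N \<longleftrightarrow> m \<in> ideal_times A J M"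
proof -
  interpret f: mod_hom A M N f using M N f by (simp add: mod_hom_def mod_hom_axioms_def)
  interpret M: module A M by (rule M)
  note surj = bij_betw_imp_surj_on[OF f(2)] and inj = bij_betw_imp_inj_on[OF f(2)]
  note JM = ideal_times_submodule[OF M J] and JN = ideal_times_submodule[OF N J]
  have JMc: "ideal_times A J M \<subseteq> carrier M" by (rule submoduleD(1)[OF JM(1)])
  have "ideal_times A J N \<subseteq> f ` ideal_times A J M"
  proof (rule JN(3)[OF submodule_image[OF M N f(1) JM(1)]])
    fix j y assume j: "j \<in> J" and "y \<in> carrier N"
    then obtain u where u: "u \<in> carrier M" "y = f u" using surj by blast
    have jc: "j \<in> carrier A" using j J by blast
    show "j \<odot>\<^bsub>N\<^esub> y \<in> f ` ideal_times A J M"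
      using JM(2)[OF j u(1)] f.f_smult[OF jc u(1)] u(2) by (metis imageI)
  qed
  moreover have "submodule A {u \<in> carrier M. f u \<in> ideal_times A J N} M"
    by (rule submodule_criterion[OF M]) (use submoduleD[OF JN(1)] in \<open>auto simp: f.f_add f.f_smult f.f0_is_0\<close>)
  then have "ideal_times A J M \<subseteq> {u \<in> carrier M. f u \<in> ideal_times A J N}"
  proof (rule JM(3))
    fix j u assume j: "j \<in> J" and u: "u \<in> carrier M"
    then have jc: "j \<in> carrier A" using J by blast
    have "f (j \<odot>\<^bsub>M\<^esub> u) \<in> ideal_times A J N"
      unfolding f.f_smult[OF jc u] by (rule JN(2)[OF j]) (use u f.f_im in simp)
    then show "j \<odot>\<^bsub>M\<^esub> u \<in> {u \<in> carrier M. f u \<in> ideal_times A J N}" using jc u by simp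
  qed
  ultimately show ?thesis using m JMc inj by (auto dest: inj_onD)
qed

text \<open>
  One inclusion is \<open>J I = 0\<close>. For the other one, take a finite set \<open>F\<close> that spans \<open>J\<close> over the field.
  The common annihilator of \<open>F\<close> is \<open>Ann J = Ann (Ann I) = I\<close>, so a form that vanishes on \<open>I\<close> is a sum
  of multiples of forms by elements of \<open>F\<close>.
\<close>

lemma residual_ideal_times_dualizing_module:
  assumes gor: "finite_gorenstein_scheme k A" and I: "ideal I A"
    and \<kappa>: "\<kappa> \<in> carrier (dualizing_module k A)"
  shows "\<kappa> \<in> ideal_times A (residual_ideal A I) (dualizing_module k A) \<longleftrightarrow> (\<forall>i\<in>I. \<kappa> i = \<zero>\<^bsub>k\<^esub>)"
proof -
  have k: "field k" and A: "algebra k A" and fin: "vectorspace.fin_dim k A"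
    and loc: "\<And>P. primeideal P A \<Longrightarrow> gorenstein_local_ring (localized_ring A (carrier A - P))"
    using gor by (auto simp: finite_gorenstein_scheme_def finite_scheme_def)
  have Ac: "cring A" by (rule algebra.M_cring[OF A])
  interpret Ar: cring A by (rule Ac)
  interpret V: vectorspace k A by (simp add: vectorspace_def algebra.module[OF A] k)
  interpret I: ideal I A by (rule I)
  let ?K = "dualizing_module k A" and ?J = "residual_ideal A I"
  have K: "module A ?K" by (rule module_dualizing_module[OF A])
  obtain d where d: "length_function A d" using algebra_length_function[OF k A fin] by blast
  have Ic: "I \<subseteq> carrier A" using I.Icarr by blast
  have Jc: "?J \<subseteq> carrier A" by (rule residual_ideal_subset)
  note JK = ideal_times_submodule[OF K Jc]
  have "ideal_times A ?J ?K \<subseteq> {\<kappa> \<in> carrier ?K. \<forall>i\<in>I. \<kappa> i = \<zero>\<^bsub>k\<^esub>}"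
  proof (rule JK(3)[OF submodule_criterion[OF K]])
    let ?U = "{\<kappa> \<in> carrier ?K. \<forall>i\<in>I. \<kappa> i = \<zero>\<^bsub>k\<^esub>}"
    interpret K: module A ?K by (rule K)
    show "?U \<subseteq> carrier ?K" by blast
    show "\<zero>\<^bsub>?K\<^esub> \<in> ?U" using K.M.zero_closed Ic by (simp add: dualizing_simps(3) subset_iff)
    show "\<mu> \<oplus>\<^bsub>?K\<^esub> \<mu>' \<in> ?U" if "\<mu> \<in> ?U" "\<mu>' \<in> ?U" for \<mu> \<mu>'
      using that Ic K.M.a_closed[of \<mu> \<mu>'] by (simp add: dualizing_simps(2) subset_iff)
    show "b \<odot>\<^bsub>?K\<^esub> \<mu> \<in> ?U" if "b \<in> carrier A" "\<mu> \<in> ?U" for b \<mu>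
      using that Ic K.smult_closed[of b \<mu>] by (simp add: dualizing_simps(4) subset_iff I.I_l_closed)
    fix j \<mu> assume j: "j \<in> ?J" and \<mu>: "\<mu> \<in> carrier ?K"
    have "linear_form_on k A (carrier A) \<mu>" using \<mu> by (simp add: dualizing_simps(1))
    then have "\<mu> \<zero>\<^bsub>A\<^esub> = \<zero>\<^bsub>k\<^esub>" by (rule V.linear_form_on_zero[OF _ Ar.zero_closed])
    then show "j \<odot>\<^bsub>?K\<^esub> \<mu> \<in> ?U"
      using j Jc \<mu> Ic K.smult_closed[of j \<mu>] by (simp add: dualizing_simps(4) subset_iff residual_ideal_def)
  qed
  moreover have "\<kappa> \<in> ideal_times A ?J ?K" if van: "\<And>i. i \<in> I \<Longrightarrow> \<kappa> i = \<zero>\<^bsub>k\<^esub>"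
  proof -
    have Jsub: "submodule k ?J A"
    proof (rule submodule_criterion[OF algebra.module[OF A] Jc])
      show "\<zero>\<^bsub>A\<^esub> \<in> ?J" by (auto simp: residual_ideal_def I.Icarr)
      show "u \<oplus>\<^bsub>A\<^esub> v \<in> ?J" if "u \<in> ?J" "v \<in> ?J" for u v
        using that by (auto simp: residual_ideal_def I.Icarr Ar.l_distr)
      show "a \<odot>\<^bsub>A\<^esub> v \<in> ?J" if "a \<in> carrier k" "v \<in> ?J" for a v
        using that algebra.smult_assoc2[OF A that(1)] by (auto simp: residual_ideal_def I.Icarr)
    qed
    obtain F where F: "finite F" "F \<subseteq> ?J" "V.span F = ?J" using V.max_indpt_attained[OF fin Jsub] by metis
    have annF: "a \<in> I" if a: "a \<in> carrier A" "\<And>j. j \<in> F \<Longrightarrow> j \<otimes>\<^bsub>A\<^esub> a = \<zero>\<^bsub>A\<^esub>" for a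
    proof (rule ccontr)
      assume "a \<notin> I"
      then obtain y where y: "y \<in> carrier A" "\<And>i. i \<in> I \<Longrightarrow> y \<otimes>\<^bsub>A\<^esub> i = \<zero>\<^bsub>A\<^esub>" "y \<otimes>\<^bsub>A\<^esub> a \<noteq> \<zero>\<^bsub>A\<^esub>"
        using gorenstein_double_annihilator[OF Ac d loc I a(1)] by blast
      let ?N = "{j \<in> carrier A. j \<otimes>\<^bsub>A\<^esub> a = \<zero>\<^bsub>A\<^esub>}"
      have "submodule k ?N A"
        by (rule submodule_criterion[OF algebra.module[OF A]])
          (auto simp: a(1) Ar.l_distr algebra.smult_assoc2[OF A])
      moreover have "F \<subseteq> ?N" using a(2) F(2) Jc by auto
      ultimately have "?J \<subseteq> ?N" using V.span_is_subset[of F ?N] F(3) by simp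
      moreover have "y \<in> ?J" using y by (simp add: residual_ideal_def)
      ultimately show False using y(3) by blast
    qed
    show ?thesis
    proof (rule form_vanishing_on_annihilator[OF k A fin F(1) _ _ _ _ \<kappa>])
      show "F \<subseteq> carrier A" using F(2) Jc by auto
      show "\<zero>\<^bsub>?K\<^esub> \<in> ideal_times A ?J ?K" by (rule submoduleD(2)[OF JK(1)])
      show "\<mu> \<oplus>\<^bsub>?K\<^esub> \<mu>' \<in> ideal_times A ?J ?K"
        if "\<mu> \<in> ideal_times A ?J ?K" "\<mu>' \<in> ideal_times A ?J ?K" for \<mu> \<mu>'
        by (rule submoduleD(3)[OF JK(1) that])
      show "j \<odot>\<^bsub>?K\<^esub> \<mu> \<in> ideal_times A ?J ?K" if "j \<in> F" "\<mu> \<in> carrier ?K" for j \<mu>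
        by (rule JK(2)) (use that F(2) in auto)
      show "\<kappa> a = \<zero>\<^bsub>k\<^esub>" if "a \<in> carrier A" "\<And>j. j \<in> F \<Longrightarrow> j \<otimes>\<^bsub>A\<^esub> a = \<zero>\<^bsub>A\<^esub>" for a
        by (rule van[OF annF[OF that]])
    qed
  qed
  ultimately show ?thesis by blast
qed

text \<open>
  The restriction of \<open>\<kappa>\<close> to \<open>I\<close> vanishes on the kernel \<open>I \<inter> U\<close> of \<open>I \<rightarrow> A/U\<close>. So it factors through
  \<open>A/U\<close>, and \<open>\<kappa>\<^sub>2\<close> is the pullback to \<open>A\<close> of a form on \<open>A/U\<close>.
\<close>

lemma split_form:
  assumes k: "field k" and A: "algebra k A" and fin: "vectorspace.fin_dim k A"
    and I: "submodule k I A" and U: "submodule k U A"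
    and \<kappa>: "\<kappa> \<in> carrier (dualizing_module k A)" and van: "\<And>a. \<lbrakk>a \<in> I; a \<in> U\<rbrakk> \<Longrightarrow> \<kappa> a = \<zero>\<^bsub>k\<^esub>"
  obtains \<kappa>2 where "\<kappa>2 \<in> carrier (dualizing_module k A)" "\<And>a. a \<in> U \<Longrightarrow> \<kappa>2 a = \<zero>\<^bsub>k\<^esub>"
    "\<And>a. a \<in> I \<Longrightarrow> \<kappa>2 a = \<kappa> a"
proof -
  interpret V: vectorspace k A by (simp add: vectorspace_def algebra.module[OF A] k)
  let ?Q = "quotient_module A U" and ?T = "\<lambda>x. U +>\<^bsub>A\<^esub> x"
  note q = quotient_module_projection[OF algebra.module[OF A] U]
  interpret Q: vectorspace k ?Q by (simp add: vectorspace_def q(1) k)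
  interpret T: linear_map k A ?Q ?T
    by (intro linear_map.intro mod_hom.intro mod_hom_axioms.intro V.vectorspace_axioms Q.vectorspace_axioms
        algebra.module[OF A] q(1,2))
  have Qfin: "Q.fin_dim" by (rule T.surj_fin_dim[OF fin q(3)])
  have Ic: "I \<subseteq> carrier A" and Uc: "U \<subseteq> carrier A" using submoduleD(1) I U by auto
  have f: "linear_form_on k A I \<kappa>"
    using \<kappa> Ic by (auto simp: dualizing_simps linear_form_on_def subset_iff)
  have ker: "\<kappa> a = \<zero>\<^bsub>k\<^esub>" if "a \<in> I" "?T a = \<zero>\<^bsub>?Q\<^esub>" for a
    using van[OF that(1)] q(4)[of a] that Ic by auto
  obtain g where g: "linear_form_on k ?Q (carrier ?Q) g" "\<And>a. a \<in> I \<Longrightarrow> g (?T a) = \<kappa> a"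
    using Q.factor_linear_form[OF Qfin V.vectorspace_axioms I f q(2) ker] by blast
  have Tc: "?T a \<in> carrier ?Q" if "a \<in> carrier A" for a using q(3) that by auto
  have gT: "linear_form_on k A (carrier A) (\<lambda>a. g (?T a))"
    by (rule linear_form_onI)
      (simp_all add: Tc linear_form_onD[OF g(1)] module_hom_add[OF q(2)] module_hom_smult[OF q(2)])
  show thesis
  proof (rule that)
    show "restrict (\<lambda>a. g (?T a)) (carrier A) \<in> carrier (dualizing_module k A)"
      by (rule linear_form_dualizing[OF gT algebra.module[OF A]])
    show "restrict (\<lambda>a. g (?T a)) (carrier A) a = \<zero>\<^bsub>k\<^esub>" if "a \<in> U" for a
    proof -
      have ac: "a \<in> carrier A" using that Uc by auto
      have "?T a = \<zero>\<^bsub>?Q\<^esub>" using q(4)[OF ac] that by simp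
      then have "g (?T a) = \<zero>\<^bsub>k\<^esub>" using Q.linear_form_on_zero[OF g(1) Q.M.zero_closed] by simp
      then show ?thesis using ac by simp
    qed
    show "restrict (\<lambda>a. g (?T a)) (carrier A) a = \<kappa> a" if "a \<in> I" for a
      using g(2)[OF that] that Ic by auto
  qed
qed

text \<open>
  Multiplying \<open>\<kappa> \<otimes> \<psi>\<close> by \<open>l\<close> gives \<open>\<psi>(l) \<kappa>\<close>, whose value at \<open>1\<close> is \<open>\<kappa>(\<psi>(l))\<close>.
\<close>

lemma trace_multiply_sections:
  assumes A: "algebra k A" and L: "module A L" and x: "free_generator A L x"
    and l: "l \<in> carrier L" and \<kappa>: "\<kappa> \<in> carrier (dualizing_module k A)"
  defines "\<psi> \<equiv> restrict (coordinate A L x) (carrier L)"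
  shows "trace_map A (multiply_sections k A L l (pure_tensor A (dualizing_module k A) (inverse_bundle A L) \<kappa> \<psi>)) =
    \<kappa> (coordinate A L x l)"
proof -
  interpret L: module A L by fact
  let ?K = "dualizing_module k A" and ?D = "inverse_bundle A L"
  have K: "module A ?K" by (rule module_dualizing_module[OF A])
  interpret K: module A ?K by (rule K)
  note c = L.coordinate[OF x]
  note D = inverse_bundle_free[OF L x, folded \<psi>_def]
  have \<psi>l: "\<psi> l = coordinate A L x l" using l by (simp add: \<psi>_def)
  have cl: "coordinate A L x l \<in> carrier A" by (rule c(1)[OF l])
  have "multiply_sections k A L l (pure_tensor A ?K ?D \<kappa> \<psi>) = \<psi> l \<odot>\<^bsub>?K\<^esub> \<kappa>"
    unfolding multiply_sections_def
  proof (rule tensor_lift_free_right[OF K D(1,2) K _ _ \<kappa>, of "\<lambda>\<kappa> \<phi>. \<phi> l \<odot>\<^bsub>?K\<^esub> \<kappa>"])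
    show "(\<lambda>\<kappa>. \<psi> l \<odot>\<^bsub>?K\<^esub> \<kappa>) \<in> module_hom A ?K ?K"
      unfolding \<psi>l
      by (rule module_homI)
        (use cl in \<open>simp_all add: K.smult_r_distr K.smult_assoc1[symmetric] L.R.m_comm\<close>)
    show "(a \<odot>\<^bsub>?D\<^esub> \<psi>) l \<odot>\<^bsub>?K\<^esub> \<kappa>' = \<psi> l \<odot>\<^bsub>?K\<^esub> (a \<odot>\<^bsub>?K\<^esub> \<kappa>')" if "\<kappa>' \<in> carrier ?K" "a \<in> carrier A" for \<kappa>' a
      unfolding \<psi>l D(3)[OF that(2) l] using that cl by (simp add: K.smult_assoc1[symmetric] L.R.m_comm)
  qed
  then show ?thesis unfolding trace_map_def \<psi>l using cl by (simp add: dualizing_simps(4))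
qed

theorem proposition2p2:
  fixes k :: "'k ring" and A :: "('k, 'a) module" and L :: "('a, 'l) module"
    and I\<^sub>1 :: "'a set" and V :: "'l set" and r s :: int
  assumes "finite_gorenstein_scheme k A"
    and "int (degree_of k A) = r + s + 2"
    and "ideal I\<^sub>1 A"
    and "linear_series k A V L"
    and "projective_dimension k A V L = r"
  shows "failure_to_span k A I\<^sub>1 V L =
    failure_of_independent_conditions k A (residual_ideal A I\<^sub>1)
      (gale_transform k A V L) (gale_bundle k A L)"
proof -
  have k: "field k" and A: "algebra k A" and fin: "vectorspace.fin_dim k A"
    and gor: "\<And>P. primeideal P A \<Longrightarrow> gorenstein_local_ring (localized_ring A (carrier A - P))"
    using assms(1) by (auto simp: finite_gorenstein_scheme_def finite_scheme_def)
  have lb: "line_bundle A L" and Vsub: "submodule k V (restrict_scalars A L)"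
    using assms(4) by (auto simp: linear_series_def subspace_def)
  have L: "module A L" using lb by (simp add: line_bundle_def)
  obtain d where d: "length_function A d" using algebra_length_function[OF k A fin] by blast
  obtain x where x: "free_generator A L x" using line_bundle_free_generator[OF d lb] by blast
  let ?I = "I\<^sub>1" and ?J = "residual_ideal A I\<^sub>1"
  have Ac: "cring A" by (rule algebra.M_cring[OF A])
  interpret Ar: cring A by (rule Ac)
  interpret Ak: vectorspace k A by (simp add: vectorspace_def algebra.module[OF A] k)
  interpret L: module A L by (rule L)
  interpret I: ideal ?I A by (rule assms(3))
  let ?K = "dualizing_module k A" and ?D = "inverse_bundle A L" and ?G = "gale_bundle k A L"
  let ?c = "coordinate A L x" and ?\<psi> = "restrict (coordinate A L x) (carrier L)"
  let ?rL = "restrict_scalars A L" and ?rK = "restrict_scalars A ?K"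
  note c = L.coordinate[OF x]
  have K: "module A ?K" by (rule module_dualizing_module[OF A])
  interpret K: module A ?K by (rule K)
  note D = inverse_bundle_free[OF L x]
  let ?\<nu> = "\<lambda>\<kappa>. pure_tensor A ?K ?D \<kappa> ?\<psi>"
  note \<nu> = tensor_free_right[OF K D(1,2), folded gale_bundle_def]
  have G: "module A ?G" by (rule \<nu>(1))
  interpret G: module A ?G by (rule G)
  interpret \<nu>: mod_hom A ?K ?G ?\<nu> by unfold_locales (rule \<nu>(2))
  have \<nu>c: "?\<nu> \<kappa> \<in> carrier ?G" if "\<kappa> \<in> carrier ?K" for \<kappa> using bij_betw_imp_surj_on[OF \<nu>(3)] that by auto
  have \<nu>ex: "\<exists>\<kappa>. \<kappa> \<in> carrier ?K \<and> g = ?\<nu> \<kappa>" if "g \<in> carrier ?G" for g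
    using bij_betw_imp_surj_on[OF \<nu>(3)] that by auto
  have pair: "trace_map A (multiply_sections k A L l (?\<nu> \<kappa>)) = \<kappa> (?c l)"
    if "l \<in> carrier L" "\<kappa> \<in> carrier ?K" for l \<kappa> by (rule trace_multiply_sections[OF A L x that])
  have form: "linear_form_on k A (carrier A) \<kappa>" if "\<kappa> \<in> carrier ?K" for \<kappa> using that by (simp add: dualizing_simps)
  have VL: "V \<subseteq> carrier L" using submoduleD(1)[OF Vsub] by simp

  \<comment> \<open>the left-hand side is the dimension of \<open>V \<inter> I L\<close>\<close>
  define P where "P = {v \<in> V. ?c v \<in> ?I}"
  have Ic: "?I \<subseteq> carrier A" using I.Icarr by blast
  have Jc: "?J \<subseteq> carrier A" by (rule residual_ideal_subset)
  note IL = ideal_times_submodule[OF L Ic] and JG = ideal_times_submodule[OF G Jc]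
  have Peq: "{v \<in> V. restriction_map A ?I L v = \<zero>\<^bsub>restricted_sheaf A ?I L\<^esub>} = P"
  proof -
    have "restriction_map A ?I L v = \<zero>\<^bsub>restricted_sheaf A ?I L\<^esub> \<longleftrightarrow> ?c v \<in> ?I" if "v \<in> V" for v
    proof -
      have vL: "v \<in> carrier L" using that VL by auto
      show ?thesis
        using quotient_module_projection(4)[OF L IL(1) vL] ideal_times_free[OF L x assms(3), of v] vL
        by (simp add: restriction_map_def restricted_sheaf_def)
    qed
    then show ?thesis by (auto simp: P_def)
  qed
  have rL: "module k ?rL" by (rule module_restrict_scalars[OF A L])
  interpret rL: vectorspace k ?rL by (simp add: vectorspace_def rL k)
  have xL: "x \<in> carrier L" using x by (simp add: free_generator_def)
  have cs: "a \<odot>\<^bsub>A\<^esub> y = (a \<odot>\<^bsub>A\<^esub> \<one>\<^bsub>A\<^esub>) \<otimes>\<^bsub>A\<^esub> y" if "a \<in> carrier k" "y \<in> carrier A" for a y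
    using algebra.smult_assoc2[OF A that(1) Ar.one_closed that(2)] that by simp
  have k1: "a \<odot>\<^bsub>A\<^esub> \<one>\<^bsub>A\<^esub> \<in> carrier A" if "a \<in> carrier k" for a using that by simp
  have rLfin: "rL.fin_dim"
  proof -
    let ?T = "\<lambda>a. a \<odot>\<^bsub>L\<^esub> x"
    have "?T \<in> module_hom k A ?rL"
    proof (rule module_homI)
      show "?T (a \<odot>\<^bsub>A\<^esub> y) = a \<odot>\<^bsub>?rL\<^esub> ?T y" if "a \<in> carrier k" "y \<in> carrier A" for a y
        unfolding cs[OF that] using L.smult_assoc1[OF k1[OF that(1)] that(2) xL] by simp
    qed (use xL in \<open>simp_all add: L.smult_l_distr\<close>)
    then interpret T: linear_map k A ?rL ?T
      by (intro linear_map.intro mod_hom.intro mod_hom_axioms.intro Ak.vectorspace_axioms rL.vectorspace_axioms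
          algebra.module[OF A] rL)
    show ?thesis
      using T.surj_fin_dim[OF fin] x by (simp add: free_generator_def bij_betw_def)
  qed
  have Psub: "submodule k P ?rL"
  proof (rule submodule_criterion[OF rL])
    note V = submoduleD[OF Vsub]
    have c0: "?c \<zero>\<^bsub>L\<^esub> = \<zero>\<^bsub>A\<^esub>" using c(3)[OF Ar.zero_closed] xL by simp
    show "P \<subseteq> carrier ?rL" using VL by (auto simp: P_def)
    show "\<zero>\<^bsub>?rL\<^esub> \<in> P" using V(2) c0 by (simp add: P_def)
    show "u \<oplus>\<^bsub>?rL\<^esub> v \<in> P" if uv: "u \<in> P" "v \<in> P" for u v
    proof -
      have "u \<in> carrier L" "v \<in> carrier L" using uv VL by (auto simp: P_def)
      then show ?thesis using uv V(3)[of u v] c(4) by (simp add: P_def)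
    qed
    show "a \<odot>\<^bsub>?rL\<^esub> v \<in> P" if av: "a \<in> carrier k" "v \<in> P" for a v
    proof -
      have "v \<in> carrier L" using av VL by (auto simp: P_def)
      then show ?thesis using av V(4)[of a v] c(5) k1 by (simp add: P_def I.I_l_closed)
    qed
  qed
  note Pvs = rL.subspace_fin_dim[OF rLfin Psub]

  \<comment> \<open>the right-hand side is the dimension of a quotient \<open>Q\<close> of the dualizing module\<close>
  let ?W = "gale_transform k A V L"
  let ?Q1 = "restricted_sheaf A ?J ?G" and ?p1 = "restriction_map A ?J ?G"
  note q1 = quotient_module_projection[OF G JG(1), folded restricted_sheaf_def restriction_map_def]
  define W' where "W' = {\<kappa> \<in> carrier ?K. \<forall>v\<in>V. \<kappa> (?c v) = \<zero>\<^bsub>k\<^esub>}"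
  have W: "?W = ?\<nu> ` W'"
  proof -
    have "?\<nu> \<kappa> \<in> ?W \<longleftrightarrow> \<kappa> \<in> W'" if "\<kappa> \<in> carrier ?K" for \<kappa>
      using that \<nu>c pair VL by (auto simp: gale_transform_def W'_def subset_iff)
    moreover have "?W \<subseteq> carrier ?G" "W' \<subseteq> carrier ?K" by (auto simp: gale_transform_def W'_def)
    ultimately show ?thesis using \<nu>ex by blast
  qed
  have rK: "module k ?rK" by (rule module_restrict_scalars[OF A K])
  interpret rK: vectorspace k ?rK by (simp add: vectorspace_def rK k)
  let ?rQ1 = "restrict_scalars A ?Q1"
  have rQ1: "module k ?rQ1" by (rule module_restrict_scalars[OF A q1(1)])
  let ?f = "\<lambda>\<kappa>. ?p1 (?\<nu> \<kappa>)"
  have f: "?f \<in> module_hom k ?rK ?rQ1"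
    by (rule module_hom_restrict_scalars[OF A module_hom_comp[OF \<nu>(2) q1(2)]])
  have Kadd: "(\<kappa> \<oplus>\<^bsub>?K\<^esub> \<kappa>') a = \<kappa> a \<oplus>\<^bsub>k\<^esub> \<kappa>' a" if "a \<in> carrier A" for \<kappa> \<kappa>' a
    using that by (simp add: dualizing_simps)
  have Ksm: "(b \<odot>\<^bsub>?K\<^esub> \<kappa>) a = \<kappa> (b \<otimes>\<^bsub>A\<^esub> a)" if "a \<in> carrier A" for \<kappa> a b
    using that by (simp add: dualizing_simps)
  have K0: "\<zero>\<^bsub>?K\<^esub> a = \<zero>\<^bsub>k\<^esub>" if "a \<in> carrier A" for a using that by (simp add: dualizing_simps)
  have Kscal: "((b \<odot>\<^bsub>A\<^esub> \<one>\<^bsub>A\<^esub>) \<odot>\<^bsub>?K\<^esub> \<kappa>) a = b \<otimes>\<^bsub>k\<^esub> \<kappa> a"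
    if "a \<in> carrier A" "b \<in> carrier k" "\<kappa> \<in> carrier ?K" for \<kappa> a b
    using that linear_form_onD(3)[OF form[OF that(3)] that(2,1)] by (simp add: Ksm cs[symmetric])
  have Kminus: "(\<kappa> \<ominus>\<^bsub>?K\<^esub> \<kappa>') a = \<kappa> a \<ominus>\<^bsub>k\<^esub> \<kappa>' a"
    if a: "a \<in> carrier A" and \<kappa>: "\<kappa> \<in> carrier ?K" "\<kappa>' \<in> carrier ?K" for \<kappa> \<kappa>' a
  proof -
    have "\<kappa> = (\<kappa> \<ominus>\<^bsub>?K\<^esub> \<kappa>') \<oplus>\<^bsub>?K\<^esub> \<kappa>'" using \<kappa> by (simp add: K.M.minus_eq K.M.a_assoc K.M.l_neg)
    then have "\<kappa> a = (\<kappa> \<ominus>\<^bsub>?K\<^esub> \<kappa>') a \<oplus>\<^bsub>k\<^esub> \<kappa>' a" using Kadd[OF a] by metis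
    moreover have "(\<kappa> \<ominus>\<^bsub>?K\<^esub> \<kappa>') a \<in> carrier k" "\<kappa>' a \<in> carrier k"
      using linear_form_onD(1)[OF form a] \<kappa> by simp_all
    ultimately show ?thesis by (simp add: Ak.R.minus_eq Ak.R.a_assoc Ak.R.r_neg)
  qed
  have W'sub: "submodule k W' ?rK"
  proof (rule submodule_criterion[OF rK])
    have cv: "?c v \<in> carrier A" if "v \<in> V" for v using c(1) VL that by blast
    show "W' \<subseteq> carrier ?rK" by (auto simp: W'_def)
    show "\<zero>\<^bsub>?rK\<^esub> \<in> W'" using cv by (auto simp: W'_def K0)
    show "\<kappa> \<oplus>\<^bsub>?rK\<^esub> \<kappa>' \<in> W'" if "\<kappa> \<in> W'" "\<kappa>' \<in> W'" for \<kappa> \<kappa>'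
      using that cv by (auto simp: W'_def Kadd)
    show "b \<odot>\<^bsub>?rK\<^esub> \<kappa> \<in> W'" if "b \<in> carrier k" "\<kappa> \<in> W'" for b \<kappa>
      using that cv k1 by (auto simp: W'_def Kscal)
  qed
  let ?N = "?p1 ` ?W"
  have N: "submodule k ?N ?rQ1"
    using submodule_image[OF rK rQ1 f W'sub] by (simp add: W image_image)
  let ?Q = "quotient_module ?rQ1 ?N"
  note q2 = quotient_module_projection[OF rQ1 N]
  have Qvs: "vectorspace k ?Q" by (simp add: vectorspace_def q2(1) k)
  let ?T = "\<lambda>\<kappa>. ?N +>\<^bsub>?rQ1\<^esub> (?f \<kappa>)"
  have T: "?T \<in> module_hom k ?rK ?Q" by (rule module_hom_comp[OF f q2(2)])
  have fonto: "?f ` carrier ?K = carrier ?Q1"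
    using q1(3) bij_betw_imp_surj_on[OF \<nu>(3)] by (metis image_image)
  have Tonto: "?T ` carrier ?rK = carrier ?Q"
  proof -
    have "?T ` carrier ?rK = (\<lambda>y. ?N +>\<^bsub>?rQ1\<^esub> y) ` (?f ` carrier ?K)" by (simp add: image_image)
    then show ?thesis using q2(3) fonto by simp
  qed

  \<comment> \<open>sections of \<open>J (K \<otimes> L\<^sup>-\<^sup>1)\<close> correspond to the forms that vanish on \<open>I\<close>\<close>
  have JG_iff: "?\<nu> \<kappa> \<in> ideal_times A ?J ?G \<longleftrightarrow> (\<forall>i\<in>?I. \<kappa> i = \<zero>\<^bsub>k\<^esub>)" if "\<kappa> \<in> carrier ?K" for \<kappa>
    using ideal_times_iso[OF K G \<nu>(2,3) Jc that] residual_ideal_times_dualizing_module[OF assms(1,3) that] by simp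
  have Isub: "submodule k ?I A"
  proof (rule submodule_criterion[OF algebra.module[OF A] Ic])
    show "b \<odot>\<^bsub>A\<^esub> y \<in> ?I" if "b \<in> carrier k" "y \<in> ?I" for b y
      unfolding cs[OF that(1) I.Icarr[OF that(2)]] by (rule I.I_l_closed[OF that(2) k1[OF that(1)]])
  qed (rule I.zero_closed, rule I.a_closed)
  define V' where "V' = ?c ` V"
  have V': "submodule k V' A"
  proof -
    have "?c \<in> module_hom k ?rL A"
      by (rule module_homI) (simp_all add: c(1,4,5) k1 cs[symmetric])
    then show ?thesis unfolding V'_def by (rule submodule_image[OF rL algebra.module[OF A] _ Vsub])
  qed

  \<comment> \<open>the kernel of the map to \<open>Q\<close> is the annihilator of \<open>V \<inter> I L\<close>\<close>
  have right: "?T \<kappa> = \<zero>\<^bsub>?Q\<^esub> \<longleftrightarrow> (\<forall>p\<in>P. \<kappa> (?c p) = \<zero>\<^bsub>k\<^esub>)" if \<kappa>: "\<kappa> \<in> carrier ?K" for \<kappa>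
  proof -
    have fc: "?f \<kappa> \<in> carrier ?rQ1" using fonto \<kappa> by auto
    have feq: "?f \<kappa> = ?f \<mu> \<longleftrightarrow> ?\<nu> (\<kappa> \<ominus>\<^bsub>?K\<^esub> \<mu>) \<in> ideal_times A ?J ?G" if \<mu>: "\<mu> \<in> carrier ?K" for \<mu>
    proof -
      interpret Q1: module A ?Q1 by (rule q1(1))
      interpret p: mod_hom A ?G ?Q1 ?p1 by unfold_locales (rule q1(2))
      have m: "\<kappa> \<ominus>\<^bsub>?K\<^esub> \<mu> \<in> carrier ?K" using \<kappa> \<mu> by simp
      have "?p1 (?\<nu> (\<kappa> \<ominus>\<^bsub>?K\<^esub> \<mu>)) = ?f \<kappa> \<ominus>\<^bsub>?Q1\<^esub> ?f \<mu>"
        using \<nu>.f_minus[OF \<kappa> \<mu>] p.f_minus[OF \<nu>c[OF \<kappa>] \<nu>c[OF \<mu>]] by simp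
      moreover have "?f \<kappa> \<ominus>\<^bsub>?Q1\<^esub> ?f \<mu> = \<zero>\<^bsub>?Q1\<^esub> \<longleftrightarrow> ?f \<kappa> = ?f \<mu>"
        using p.f_im \<nu>c \<kappa> \<mu> by simp
      ultimately show ?thesis using q1(4)[OF \<nu>c[OF m]] by simp
    qed
    have "?T \<kappa> = \<zero>\<^bsub>?Q\<^esub> \<longleftrightarrow> (\<exists>\<mu>\<in>W'. ?f \<kappa> = ?f \<mu>)"
      using q2(4)[OF fc] by (auto simp: W image_iff)
    also have "\<dots> \<longleftrightarrow> (\<exists>\<mu>\<in>W'. ?\<nu> (\<kappa> \<ominus>\<^bsub>?K\<^esub> \<mu>) \<in> ideal_times A ?J ?G)"
      using feq by (intro bex_cong refl) (auto simp: W'_def)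
    also have "\<dots> \<longleftrightarrow> (\<forall>p\<in>P. \<kappa> (?c p) = \<zero>\<^bsub>k\<^esub>)"
    proof
      assume "\<exists>\<mu>\<in>W'. ?\<nu> (\<kappa> \<ominus>\<^bsub>?K\<^esub> \<mu>) \<in> ideal_times A ?J ?G"
      then obtain \<mu> where \<mu>: "\<mu> \<in> W'" "?\<nu> (\<kappa> \<ominus>\<^bsub>?K\<^esub> \<mu>) \<in> ideal_times A ?J ?G" by blast
      have \<mu>c: "\<mu> \<in> carrier ?K" using \<mu>(1) by (simp add: W'_def)
      show "\<forall>p\<in>P. \<kappa> (?c p) = \<zero>\<^bsub>k\<^esub>"
      proof
        fix p assume p: "p \<in> P"
        then have pV: "p \<in> V" "?c p \<in> ?I" "?c p \<in> carrier A" using Ic by (auto simp: P_def)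
        have "(\<kappa> \<ominus>\<^bsub>?K\<^esub> \<mu>) (?c p) = \<zero>\<^bsub>k\<^esub>" using JG_iff[of "\<kappa> \<ominus>\<^bsub>?K\<^esub> \<mu>"] \<mu>(2) pV(2) \<kappa> \<mu>c by simp
        then have "\<kappa> (?c p) \<ominus>\<^bsub>k\<^esub> \<mu> (?c p) = \<zero>\<^bsub>k\<^esub>" using Kminus[OF pV(3) \<kappa> \<mu>c] by simp
        moreover have "\<mu> (?c p) = \<zero>\<^bsub>k\<^esub>" using \<mu>(1) pV(1) by (simp add: W'_def)
        ultimately show "\<kappa> (?c p) = \<zero>\<^bsub>k\<^esub>"
          using linear_form_onD(1)[OF form[OF \<kappa>] pV(3)] by (simp add: Ak.R.minus_eq)
      qed
    next
      assume van: "\<forall>p\<in>P. \<kappa> (?c p) = \<zero>\<^bsub>k\<^esub>"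
      have "\<kappa> a = \<zero>\<^bsub>k\<^esub>" if "a \<in> ?I" "a \<in> V'" for a
        using that van by (auto simp: V'_def P_def)
      then obtain \<mu> where \<mu>: "\<mu> \<in> carrier ?K" "\<And>a. a \<in> V' \<Longrightarrow> \<mu> a = \<zero>\<^bsub>k\<^esub>" "\<And>a. a \<in> ?I \<Longrightarrow> \<mu> a = \<kappa> a"
        using split_form[OF k A fin Isub V' \<kappa>] by blast
      have "\<mu> \<in> W'" using \<mu>(1,2) by (auto simp: W'_def V'_def)
      moreover have "(\<kappa> \<ominus>\<^bsub>?K\<^esub> \<mu>) i = \<zero>\<^bsub>k\<^esub>" if i: "i \<in> ?I" for i
        using Kminus[OF _ \<kappa> \<mu>(1), of i] \<mu>(3)[OF i] I.Icarr[OF i] linear_form_onD(1)[OF form[OF \<kappa>], of i]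
        by (simp add: Ak.R.minus_eq Ak.R.r_neg)
      then have "?\<nu> (\<kappa> \<ominus>\<^bsub>?K\<^esub> \<mu>) \<in> ideal_times A ?J ?G" using JG_iff[of "\<kappa> \<ominus>\<^bsub>?K\<^esub> \<mu>"] \<kappa> \<mu>(1) by simp
      ultimately show "\<exists>\<mu>\<in>W'. ?\<nu> (\<kappa> \<ominus>\<^bsub>?K\<^esub> \<mu>) \<in> ideal_times A ?J ?G" by blast
    qed
    finally show ?thesis .
  qed
  have PL: "p \<in> carrier L" if "p \<in> P" for p using that VL by (auto simp: P_def)
  have "vectorspace.dim k (?rL\<lparr>carrier := P\<rparr>) = vectorspace.dim k ?Q"
  proof (rule pairing_dim_eq[OF Pvs Qvs rK.vectorspace_axioms T Tonto, of "\<lambda>p \<kappa>. \<kappa> (?c p)"])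
    show "linear_form_on k (?rL\<lparr>carrier := P\<rparr>) (carrier (?rL\<lparr>carrier := P\<rparr>)) (\<lambda>p. \<kappa> (?c p))"
      if "\<kappa> \<in> carrier ?rK" for \<kappa>
    proof -
      have \<kappa>: "\<kappa> \<in> carrier ?K" using that by simp
      show ?thesis
        by (rule linear_form_onI)
          (simp_all add: PL c(1,4,5) k1 linear_form_onD[OF form[OF \<kappa>]] cs[symmetric])
    qed
    show "linear_form_on k ?rK (carrier ?rK) (\<lambda>\<kappa>. \<kappa> (?c p))" if "p \<in> carrier (?rL\<lparr>carrier := P\<rparr>)" for p
    proof -
      have cp: "?c p \<in> carrier A" using that PL c(1) by simp
      show ?thesis
        by (rule linear_form_onI) (simp_all add: cp Kadd Kscal linear_form_onD(1)[OF form])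
    qed
    show "p = \<zero>\<^bsub>?rL\<lparr>carrier := P\<rparr>\<^esub>"
      if p: "p \<in> carrier (?rL\<lparr>carrier := P\<rparr>)" "\<And>\<kappa>. \<kappa> \<in> carrier ?rK \<Longrightarrow> \<kappa> (?c p) = \<zero>\<^bsub>k\<^esub>" for p
    proof -
      have pL: "p \<in> carrier L" using p(1) PL by simp
      have "?c p = \<zero>\<^bsub>A\<^esub>"
      proof (rule ccontr)
        assume nz: "?c p \<noteq> \<zero>\<^bsub>A\<^esub>"
        obtain g where g: "linear_form_on k A (carrier A) g" "g (?c p) \<noteq> \<zero>\<^bsub>k\<^esub>"
          using Ak.exists_nonvanishing_form[OF fin c(1)[OF pL] nz] by blast
        then show False
          using p(2)[of "restrict g (carrier A)"] linear_form_dualizing[OF g(1) algebra.module[OF A]] c(1)[OF pL] by simp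
      qed
      then show ?thesis using c(2)[OF pL] xL by simp
    qed
    show "?T \<kappa> = \<zero>\<^bsub>?Q\<^esub> \<longleftrightarrow> (\<forall>p\<in>carrier (?rL\<lparr>carrier := P\<rparr>). \<kappa> (?c p) = \<zero>\<^bsub>k\<^esub>)" if "\<kappa> \<in> carrier ?rK" for \<kappa>
      using right[of \<kappa>] that by simp
  qed
  then show ?thesis
    unfolding failure_to_span_def failure_of_independent_conditions_def Peq .
qed

end
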